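(* Let $(X_i,D_i,Y_i^T,Y_i^C)$, $i=1,\dots,n$, be a sample of $n$ individuals from the distribution of $(X,D,Y^T,Y^C)$, with covariates $X\in\mathbb{R}^K$, treatment assignment $D\in\{0,1\}$, potential outcomes $Y^T,Y^C$, and observed outcome $Y_i=D_iY_i^T+(1-D_i)Y_i^C$. Assume unconfoundedness, $(Y^T,Y^C)\perp D\mid X$; overlap, $0<p(X)<1$ a.s., where $p(X)=\mathbf{P}(D=1\mid X)$; and that the propensity score function $p(\cdot)$ is known. Let $\tilde\beta_{ipw}$, $\tilde x_{ipw}$ and the linearly modified estimator $\tilde\beta_{lm}=\tilde\beta_{ipw}-\hat\alpha^T\tilde x_{ipw}$ be as defined in the context. Then $\tilde\beta_{lm}$ is more efficient than $\tilde\beta_{ipw}$ in estimating the average treatment effect $\beta=\mathbf{E}Y^T-\mathbf{E}Y^C$ (that is, $\text{asyvar}(\tilde\beta_{lm})\le\text{asyvar}(\tilde\beta_{ipw})$), and strictly more efficient unless $$\text{asycov}(\tilde x_{ipw},\tilde\beta_{ipw})=0,$$ which is equivalent to the fact that $$\frac{1}{p(X)}(\beta_T(X)-\beta_T)+\frac{1}{1-p(X)}(\beta_C(X)-\beta_C)\quad\text{is uncorrelated with } X.$$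
   Context: Notation: $\beta_T(X)=\mathbf{E}[Y^T\mid X]$, $\beta_C(X)=\mathbf{E}[Y^C\mid X]$, $\beta_T=\mathbf{E}[\beta_T(X)]$, $\beta_C=\mathbf{E}[\beta_C(X)]$, $\bar X=\frac1n\sum_{i=1}^nX_i$. Estimators: $$\tilde\beta_{ipw}=\frac{\sum_{i=1}^n D_iY_i/p(X_i)}{\sum_{i=1}^n D_i/p(X_i)}-\frac{\sum_{i=1}^n(1-D_i)Y_i/(1-p(X_i))}{\sum_{i=1}^n(1-D_i)/(1-p(X_i))},$$ $$\tilde x_{ipw}=\frac{\sum_{i=1}^n D_iX_i/p(X_i)}{\sum_{i=1}^n D_i/p(X_i)}-\frac{\sum_{i=1}^n(1-D_i)X_i/(1-p(X_i))}{\sum_{i=1}^n(1-D_i)/(1-p(X_i))}\in\mathbb{R}^K,$$ and $\hat\alpha=\hat A^{-1}\hat b$, where $$\hat A=\frac1n\sum_{i=1}^n\frac{(X_i-\bar X)(X_i-\bar X)^T}{p(X_i)(1-p(X_i))},$$ $$\hat b=\frac1n\sum_{j=1}^n(X_j-\bar X)\left(\frac{D_j}{p(X_j)^2}\Big(Y_j^T-\frac1n\sum_{i=1}^n\frac{D_iY_i}{p(X_i)}\Big)+\frac{1-D_j}{(1-p(X_j))^2}\Big(Y_j^C-\frac1n\sum_{i=1}^n\frac{(1-D_i)Y_i}{1-p(X_i)}\Big)\right).$$ Here $\text{asyvar}(\cdot)$ denotes asymptotic variance (the variance of the limiting normal law of the estimation error scaled by $\sqrt n$), and $\text{asycov}(\cdot,\cdot)$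 denotes the asymptotic covariance matrix, under the same scaling, between two estimators. More efficient means having smaller asymptotic variance.
   Formalization: Added so that the asymptotic variances and α̂ exist: 1/(p(X)(1-p(X))), |X|²/(p(X)(1-p(X))), (Y^T)²/p(X) and (Y^C)²/(1-p(X)) have finite expectation, and no nonzero linear combination of the covariates X is a.s. constant. *)

theory Defs
  imports "HOL-Probability.Probability"
begin

definition sigma_gen :: "'a measure \<Rightarrow> ('a \<Rightarrow> 'b::topological_space) \<Rightarrow> 'a measure" where
  "sigma_gen M X = vimage_algebra (space M) X borel"

definition cond_expectation ::
  "'a measure \<Rightarrow> ('a \<Rightarrow> 'b::topological_space) \<Rightarrow> ('a \<Rightarrow> real) \<Rightarrow> 'a \<Rightarrow> real" where
  "cond_expectation M X Z = real_cond_exp M (sigma_gen M X) Z"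

definition cond_probability ::
  "'a measure \<Rightarrow> ('a \<Rightarrow> 'b::topological_space) \<Rightarrow> ('a \<Rightarrow> bool) \<Rightarrow> 'a \<Rightarrow> real" where
  "cond_probability M X E = cond_expectation M X (indicator {\<omega> \<in> space M. E \<omega>})"

definition cond_indep ::
  "'a measure \<Rightarrow> ('a \<Rightarrow> 'b::topological_space) \<Rightarrow> ('a \<Rightarrow> 'c::topological_space)
    \<Rightarrow> ('a \<Rightarrow> 'd::topological_space) \<Rightarrow> bool" where
  "cond_indep M X U V \<longleftrightarrow>
     (\<forall>A \<in> sets borel. \<forall>B \<in> sets borel.
        AE \<omega> in M. cond_probability M X (\<lambda>\<omega>. U \<omega> \<in> A \<and> V \<omega> \<in> B) \<omega>
                 = cond_probability M X (\<lambda>\<omega>. U \<omega> \<in> A) \<omega> * cond_probability M X (\<lambda>\<omega>. V \<omega> \<in> B) \<omega>)"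

text \<open>Covariance of a vector-valued and a scalar variable: for \<open>U\<close> with values in
  \<open>real ^ 'k\<close> it is the \<open>K \<times> 1\<close> matrix of the covariances \<open>Cov(U $ k, V)\<close>, as a vector.\<close>

definition covariance ::
  "'a measure \<Rightarrow> ('a \<Rightarrow> 'b::euclidean_space) \<Rightarrow> ('a \<Rightarrow> real) \<Rightarrow> 'b" where
  "covariance M U V =
     (LINT \<omega>|M. (V \<omega> - (LINT \<omega>'|M. V \<omega>')) *\<^sub>R (U \<omega> - (LINT \<omega>'|M. U \<omega>')))"

text \<open>The integrability conditions ensure that the covariance is a genuine one, as the Bochner
  integral of a non-integrable function is 0.\<close>

definition uncorrelated ::
  "'a measure \<Rightarrow> ('a \<Rightarrow> 'b::euclidean_space) \<Rightarrow> ('a \<Rightarrow> real) \<Rightarrow> bool" where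
  "uncorrelated M U V \<longleftrightarrow>
     integrable M U \<and> integrable M V \<and> integrable M (\<lambda>\<omega>. V \<omega> *\<^sub>R U \<omega>) \<and> covariance M U V = 0"

text \<open>Normal law with mean \<open>m\<close> and standard deviation \<open>s\<close>; a point mass if \<open>s = 0\<close>.\<close>

definition normal_law :: "real \<Rightarrow> real \<Rightarrow> real measure" where
  "normal_law m s = (if s = 0 then return borel m else density lborel (\<lambda>x. ennreal (normal_density m s x)))"

definition multivariate_normal :: "'b::euclidean_space measure \<Rightarrow> bool" where
  "multivariate_normal \<mu> \<longleftrightarrow>
     prob_space \<mu> \<and> sets \<mu> = sets borel \<and>
     (\<forall>v. \<exists>m s. s \<ge> 0 \<and> distr \<mu> borel (\<lambda>x. v \<bullet> x) = normal_law m s)"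

text \<open>Weak convergence in arbitrary dimension; \<open>weak_conv_m\<close> is only available on the line.\<close>

definition weakly_converges ::
  "(nat \<Rightarrow> 'b::topological_space measure) \<Rightarrow> 'b measure \<Rightarrow> bool" where
  "weakly_converges \<mu>s \<mu> \<longleftrightarrow>
     (\<forall>f :: 'b \<Rightarrow> real. continuous_on UNIV f \<longrightarrow> bounded (range f) \<longrightarrow>
        (\<lambda>n. LINT x|\<mu>s n. f x) \<longlonglongrightarrow> (LINT x|\<mu>. f x))"

text \<open>\<open>T n\<close> is the estimator of \<open>\<theta>\<close> from a sample of size \<open>n\<close>.\<close>

definition has_limiting_normal_law ::
  "'a measure \<Rightarrow> (nat \<Rightarrow> 'a \<Rightarrow> 'b::euclidean_space) \<Rightarrow> 'b \<Rightarrow> 'b measure \<Rightarrow> bool" where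
  "has_limiting_normal_law M T \<theta> \<mu> \<longleftrightarrow>
     multivariate_normal \<mu> \<and>
     weakly_converges (\<lambda>n. distr M borel (\<lambda>\<omega>. sqrt (real n) *\<^sub>R (T n \<omega> - \<theta>))) \<mu>"

definition asymptotically_normal ::
  "'a measure \<Rightarrow> (nat \<Rightarrow> 'a \<Rightarrow> 'b::euclidean_space) \<Rightarrow> 'b \<Rightarrow> bool" where
  "asymptotically_normal M T \<theta> \<longleftrightarrow> (\<exists>\<mu>. has_limiting_normal_law M T \<theta> \<mu>)"

definition limiting_law ::
  "'a measure \<Rightarrow> (nat \<Rightarrow> 'a \<Rightarrow> 'b::euclidean_space) \<Rightarrow> 'b \<Rightarrow> 'b measure" where
  "limiting_law M T \<theta> = (THE \<mu>. has_limiting_normal_law M T \<theta> \<mu>)"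

definition asyvar :: "'a measure \<Rightarrow> (nat \<Rightarrow> 'a \<Rightarrow> real) \<Rightarrow> real \<Rightarrow> real" where
  "asyvar M T \<theta> =
     (let \<mu> = limiting_law M T \<theta> in LINT x|\<mu>. (x - (LINT y|\<mu>. y))\<^sup>2)"

definition asycov ::
  "'a measure \<Rightarrow> (nat \<Rightarrow> 'a \<Rightarrow> 'b::euclidean_space) \<Rightarrow> 'b \<Rightarrow> (nat \<Rightarrow> 'a \<Rightarrow> real) \<Rightarrow> real \<Rightarrow> 'b" where
  "asycov M S \<sigma> T \<tau> = covariance (limiting_law M (\<lambda>n \<omega>. (S n \<omega>, T n \<omega>)) (\<sigma>, \<tau>)) fst snd"

text \<open>A sample of size \<open>n\<close> is the initial segment (indices \<open>0, ..., n - 1\<close>) of the sequences \<open>x\<close>, \<open>d\<close>,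
  \<open>yT\<close>, \<open>yC\<close> of covariates, treatment indicators (in \<open>{0, 1}\<close>) and potential outcomes.
  Below, division by a vanishing sum of weights gives 0 and \<open>matrix_inv\<close> of a singular matrix is an
  unspecified constant.\<close>

definition obs_outcome :: "(nat \<Rightarrow> real) \<Rightarrow> (nat \<Rightarrow> real) \<Rightarrow> (nat \<Rightarrow> real) \<Rightarrow> nat \<Rightarrow> real" where
  "obs_outcome d yT yC i = d i * yT i + (1 - d i) * yC i"

definition ipw_contrast ::
  "('x \<Rightarrow> real) \<Rightarrow> nat \<Rightarrow> (nat \<Rightarrow> 'x) \<Rightarrow> (nat \<Rightarrow> real) \<Rightarrow> (nat \<Rightarrow> 'b::real_vector) \<Rightarrow> 'b" where
  "ipw_contrast p n x d z =
     (\<Sum>i<n. (d i / p (x i)) *\<^sub>R z i) /\<^sub>R (\<Sum>i<n. d i / p (x i))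
     - (\<Sum>i<n. ((1 - d i) / (1 - p (x i))) *\<^sub>R z i) /\<^sub>R (\<Sum>i<n. (1 - d i) / (1 - p (x i)))"

definition beta_ipw ::
  "('x \<Rightarrow> real) \<Rightarrow> nat \<Rightarrow> (nat \<Rightarrow> 'x) \<Rightarrow> (nat \<Rightarrow> real) \<Rightarrow> (nat \<Rightarrow> real) \<Rightarrow> (nat \<Rightarrow> real) \<Rightarrow> real" where
  "beta_ipw p n x d yT yC = ipw_contrast p n x d (obs_outcome d yT yC)"

definition x_ipw ::
  "('x::real_vector \<Rightarrow> real) \<Rightarrow> nat \<Rightarrow> (nat \<Rightarrow> 'x) \<Rightarrow> (nat \<Rightarrow> real) \<Rightarrow> 'x" where
  "x_ipw p n x d = ipw_contrast p n x d x"

definition sample_mean :: "nat \<Rightarrow> (nat \<Rightarrow> 'b::real_vector) \<Rightarrow> 'b" where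
  "sample_mean n z = (\<Sum>i<n. z i) /\<^sub>R real n"

definition outer :: "real ^ 'k \<Rightarrow> real ^ 'k \<Rightarrow> real ^ 'k ^ 'k" where
  "outer u v = (\<chi> a b. u $ a * v $ b)"

definition A_hat :: "(real ^ 'k \<Rightarrow> real) \<Rightarrow> nat \<Rightarrow> (nat \<Rightarrow> real ^ 'k) \<Rightarrow> real ^ 'k ^ 'k" where
  "A_hat p n x =
     sample_mean n (\<lambda>i. outer (x i - sample_mean n x) (x i - sample_mean n x)
                          /\<^sub>R (p (x i) * (1 - p (x i))))"

definition b_hat ::
  "(real ^ 'k \<Rightarrow> real) \<Rightarrow> nat \<Rightarrow> (nat \<Rightarrow> real ^ 'k) \<Rightarrow> (nat \<Rightarrow> real) \<Rightarrow> (nat \<Rightarrow> real) \<Rightarrow> (nat \<Rightarrow> real)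
    \<Rightarrow> real ^ 'k" where
  "b_hat p n x d yT yC =
     (let y = obs_outcome d yT yC;
          mT = sample_mean n (\<lambda>i. d i * y i / p (x i));
          mC = sample_mean n (\<lambda>i. (1 - d i) * y i / (1 - p (x i)))
      in sample_mean n (\<lambda>j.
           (d j / (p (x j))\<^sup>2 * (yT j - mT) + (1 - d j) / (1 - p (x j))\<^sup>2 * (yC j - mC))
             *\<^sub>R (x j - sample_mean n x)))"

definition alpha_hat ::
  "(real ^ 'k \<Rightarrow> real) \<Rightarrow> nat \<Rightarrow> (nat \<Rightarrow> real ^ 'k) \<Rightarrow> (nat \<Rightarrow> real) \<Rightarrow> (nat \<Rightarrow> real) \<Rightarrow> (nat \<Rightarrow> real)
    \<Rightarrow> real ^ 'k" where
  "alpha_hat p n x d yT yC = matrix_inv (A_hat p n x) *v b_hat p n x d yT yC"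

definition beta_lm ::
  "(real ^ 'k \<Rightarrow> real) \<Rightarrow> nat \<Rightarrow> (nat \<Rightarrow> real ^ 'k) \<Rightarrow> (nat \<Rightarrow> real) \<Rightarrow> (nat \<Rightarrow> real) \<Rightarrow> (nat \<Rightarrow> real)
    \<Rightarrow> real" where
  "beta_lm p n x d yT yC = beta_ipw p n x d yT yC - alpha_hat p n x d yT yC \<bullet> x_ipw p n x d"

end

theory Submission
  imports Defs
begin

text \<open>
  With weights \<open>w\<^sub>T = D / p(X)\<close> and \<open>w\<^sub>C = (1 - D) / (1 - p(X))\<close>, the pair of \<open>x_ipw\<close> and \<open>beta_ipw\<close> is
  asymptotically linear with influence function
  \<open>\<zeta> = w\<^sub>T ((X, Y\<^sub>T) - E (X, Y\<^sub>T)) - w\<^sub>C ((X, Y\<^sub>C) - E (X, Y\<^sub>C))\<close>, so by the central limit theorem it has a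
  normal limit with the covariance of \<open>\<zeta>\<close>. Unconfoundedness gives \<open>E (w\<^sub>T g(X, Y\<^sub>T)) = E (g(X, Y\<^sub>T))\<close>;
  since \<open>w\<^sub>T w\<^sub>C = 0\<close>, the covariance of the covariate block of \<open>\<zeta>\<close> is the expectation \<open>A\<close> of
  \<open>(X - E X) (X - E X)\<^sup>T / (p(X) (1 - p(X)))\<close>, and its mixed block \<open>b\<close> is the covariance of \<open>X\<close> with the
  variable in the last condition of the theorem. As \<open>A_hat\<close> and \<open>b_hat\<close> converge to \<open>A\<close> and \<open>b\<close> in
  probability, \<open>beta_lm\<close> has the influence function \<open>(- \<alpha>, 1) \<bullet> \<zeta>\<close> with \<open>A \<alpha> = b\<close>. Hence its asymptotic
  variance is smaller by \<open>\<alpha> \<bullet> A \<alpha>\<close>, which is positive unless \<open>b = 0\<close>.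
\<close>

section \<open>Weak convergence from trigonometric polynomials\<close>

text \<open>The limiting law is a definite description over measures on a Euclidean space, so three
  things must be produced there: a Gaussian law with a prescribed, possibly singular covariance;
  convergence against every bounded continuous function; and uniqueness of the limit. The central
  limit theorem is applied to one projection at a time, so test functions are reduced to cosines of
  projections, and tightness controls what happens far out.

  Each weighted sum is centered before it is divided by its random sum of weights. That sum over n
  tends to 1, so normalizing the weights enters the influence function only through the subtracted
  mean. Replacing \<alpha> by its estimate has no first-order effect, because \<open>x_ipw\<close>
  estimates 0 and is of order 1 / sqrt n.\<close>

lemma finite_measure_eqI_bounded_continuous:
  fixes \<mu> \<nu> :: "'b::metric_space measure"
  assumes "finite_measure \<mu>" "finite_measure \<nu>"
    and sets: "sets \<mu> = sets borel" "sets \<nu> = sets borel"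
    and eq: "\<And>f :: 'b \<Rightarrow> real. continuous_on UNIV f \<Longrightarrow> bounded (range f) \<Longrightarrow> (LINT x|\<mu>. f x) = (LINT x|\<nu>. f x)"
  shows "\<mu> = \<nu>"
proof -
  have closed_eq: "emeasure \<mu> F = emeasure \<nu> F" if F: "closed F" for F
  proof (cases "F = {}")
    case False
    \<comment> \<open>Tent functions that equal 1 on \<open>F\<close> and, since \<open>F\<close> is
      closed, eventually vanish at each point outside. Dominated convergence recovers the measure of
      \<open>F\<close> from integrals of bounded continuous functions.\<close>
    define f where "f n x = max 0 (1 - real n * infdist x F)" for n x
    have cont: "continuous_on UNIV (f n)" for n
      unfolding f_def by (intro continuous_intros)
    have bd: "\<bar>f n x\<bar> \<le> 1" for n x
      unfolding f_def using infdist_nonneg[of x F] by (auto simp: max_def)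
    have lim: "(\<lambda>n. f n x) \<longlonglongrightarrow> indicator F x" for x
    proof (cases "x \<in> F")
      case True
      then show ?thesis by (simp add: f_def)
    next
      case False
      then have pos: "infdist x F > 0"
        using in_closed_iff_infdist_zero[OF F \<open>F \<noteq> {}\<close>, of x] infdist_nonneg[of x F] by force
      obtain N where N: "1 / infdist x F < real N"
        using reals_Archimedean2 by blast
      have "f n x = 0" if "n \<ge> N" for n
      proof -
        have "1 < real n * infdist x F"
          using N that pos by (smt (verit, best) divide_less_eq mult_right_mono of_nat_mono)
        then show ?thesis by (simp add: f_def)
      qed
      then have "\<forall>\<^sub>F n in sequentially. f n x = 0"
        using eventually_sequentially by blast
      then show ?thesis using False by (simp add: tendsto_eventually)
    qed
    have conv: "(\<lambda>n. LINT x|m. f n x) \<longlonglongrightarrow> measure m F"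
      if m: "finite_measure m" "sets m = sets borel" for m :: "'b measure"
    proof -
      interpret finite_measure m by fact
      have [measurable]: "F \<in> sets m" using m F by auto
      have [measurable]: "f n \<in> borel_measurable m" for n
        using borel_measurable_continuous_onI[OF cont] m(2) measurable_cong_sets by blast
      have "(\<lambda>n. LINT x|m. f n x) \<longlonglongrightarrow> (LINT x|m. indicator F x)"
        by (rule integral_dominated_convergence[where w="\<lambda>_. 1"]) (use lim bd in auto)
      then show ?thesis using sets_eq_imp_space_eq[OF m(2)] by simp
    qed
    have "measure \<mu> F = measure \<nu> F"
    proof (rule LIMSEQ_unique[OF conv])
      have "(LINT x|\<mu>. f n x) = (LINT x|\<nu>. f n x)" for n
        by (rule eq[OF cont]) (use bd in \<open>auto simp: bounded_iff\<close>)
      then show "(\<lambda>n. LINT x|\<mu>. f n x) \<longlonglongrightarrow> measure \<nu> F"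
        using conv[OF assms(2) sets(2)] by simp
    qed (use assms in auto)
    then show ?thesis
      using assms by (simp add: finite_measure.emeasure_eq_measure)
  qed simp
  have borel: "sets (borel :: 'b measure) = sigma_sets UNIV (Collect closed)"
    unfolding borel_eq_closed by simp
  show ?thesis
  proof (rule measure_eqI_generator_eq[where E="Collect closed" and \<Omega>=UNIV and A="\<lambda>_. UNIV"])
    show "Int_stable (Collect closed :: 'b set set)"
      by (auto simp: Int_stable_def)
    show "emeasure \<mu> UNIV \<noteq> \<infinity>" for i :: nat
      using finite_measure.emeasure_finite[OF assms(1)] by simp
  qed (use closed_eq sets borel in auto)
qed

text \<open>The phase \<open>c\<close> supplies sines and constants, and product-to-sum formulas
  then supply products, so these two rules already generate an algebra. Every generator depends on
  one projection \<open>v \<bullet> x\<close> only, which is what a one-dimensional limit theorem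
  can handle.\<close>

inductive_set trig_polys :: "('b::euclidean_space \<Rightarrow> real) set" where
  cos: "(\<lambda>x. a * cos (v \<bullet> x + c)) \<in> trig_polys"
| add: "f \<in> trig_polys \<Longrightarrow> g \<in> trig_polys \<Longrightarrow> (\<lambda>x. f x + g x) \<in> trig_polys"

lemma trig_polys_const: "(\<lambda>x. a) \<in> trig_polys"
  using trig_polys.cos[of a 0 0] by simp

lemma trig_polys_mult:
  assumes "f \<in> trig_polys" "g \<in> trig_polys"
  shows "(\<lambda>x. f x * g x) \<in> trig_polys"
  using assms
proof (induction f)
  case (cos a v c)
  then show ?case
  proof (induction g)
    case (cos a' v' c')
    have "(\<lambda>x. (a * cos (v \<bullet> x + c)) * (a' * cos (v' \<bullet> x + c')))
        = (\<lambda>x. a * a' / 2 * cos ((v - v') \<bullet> x + (c - c')) + a * a' / 2 * cos ((v + v') \<bullet> x + (c + c')))"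
    proof
      fix x
      have 1: "(v - v') \<bullet> x + (c - c') = (v \<bullet> x + c) - (v' \<bullet> x + c')"
        "(v + v') \<bullet> x + (c + c') = (v \<bullet> x + c) + (v' \<bullet> x + c')"
        by (auto simp: inner_diff_left inner_add_left)
      show "(a * cos (v \<bullet> x + c)) * (a' * cos (v' \<bullet> x + c'))
        = a * a' / 2 * cos ((v - v') \<bullet> x + (c - c')) + a * a' / 2 * cos ((v + v') \<bullet> x + (c + c'))"
        unfolding 1 cos_diff cos_add by (simp add: field_simps)
    qed
    then show ?case
      by (simp only: trig_polys.add[OF trig_polys.cos trig_polys.cos])
  next
    case (add f g)
    then show ?case using trig_polys.add by (simp add: distrib_left)
  qed
next
  case (add f g)
  then show ?case using trig_polys.add by (simp add: distrib_right)
qed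

lemma trig_polys_continuous: "f \<in> trig_polys \<Longrightarrow> continuous_on S f"
  by (induction rule: trig_polys.induct) (auto intro!: continuous_intros)

lemma trig_polys_bounded:
  assumes "f \<in> trig_polys"
  shows "\<exists>B>0. \<forall>x. \<bar>f x\<bar> \<le> B"
  using assms
proof induction
  case (cos a v c)
  have "\<bar>a * cos (v \<bullet> x + c)\<bar> \<le> \<bar>a\<bar> + 1" for x
  proof -
    have "\<bar>a\<bar> * \<bar>cos (v \<bullet> x + c)\<bar> \<le> \<bar>a\<bar> * 1" by (intro mult_left_mono) auto
    then show ?thesis by (simp add: abs_mult)
  qed
  then show ?case by (intro exI[of _ "\<bar>a\<bar> + 1"]) auto
next
  case (add f g)
  then obtain B C where "B > 0" "C > 0" "\<And>x. \<bar>f x\<bar> \<le> B" "\<And>x. \<bar>g x\<bar> \<le> C" by blast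
  then have "B + C > 0" "\<bar>f x + g x\<bar> \<le> B + C" for x
    by (auto intro: order_trans[OF abs_triangle_ineq add_mono])
  then show ?case by blast
qed

lemma trig_polys_polynomial:
  assumes "real_polynomial_function q" "g \<in> trig_polys"
  shows "(\<lambda>x. q (g x)) \<in> trig_polys"
  using assms
proof (induction q)
  case (linear f)
  then interpret bounded_linear f by simp
  have "f (g x) = f 1 * g x" for x
    using scaleR[of "g x" 1] by simp
  then show ?case
    using trig_polys_mult[OF trig_polys_const[of "f 1"] linear.prems] by simp
qed (auto intro: trig_polys_const trig_polys.add trig_polys_mult)

text \<open>Truncating the trigonometric polynomial that approximates \<open>f\<close> on the ball, and approximating
  the truncation by a polynomial, bounds the approximation off the ball independently of \<open>e\<close>.\<close>

lemma trig_polys_approx: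
  fixes f :: "'b::euclidean_space \<Rightarrow> real"
  assumes "continuous_on UNIV f" and B: "\<And>x. \<bar>f x\<bar> \<le> B" and "e > 0"
  shows "\<exists>k\<in>trig_polys. (\<forall>x\<in>cball 0 r. \<bar>f x - k x\<bar> \<le> 2 * e) \<and> (\<forall>x. \<bar>f x - k x\<bar> \<le> 2 * B + e)"
proof -
  have sep: "\<exists>f\<in>trig_polys. f x \<noteq> f y" if "x \<noteq> y" for x y :: 'b
  proof (rule ccontr)
    assume *: "\<not> ?thesis"
    \<comment> \<open>Scaled so that the projections of \<open>x\<close> and \<open>y\<close> onto
      \<open>d\<close> differ by exactly 1; the phase \<open>- (d \<bullet> y)\<close> then compares
      cos 1 with cos 0.\<close>
    define d where "d = (x - y) /\<^sub>R (norm (x - y))\<^sup>2"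
    have "d \<bullet> (x - y) = 1"
      using that by (simp add: d_def power2_norm_eq_inner)
    then have 1: "d \<bullet> x - d \<bullet> y = 1" by (simp add: inner_diff_right)
    have "cos (d \<bullet> x + c) = cos (d \<bullet> y + c)" for c
      using * trig_polys.cos[of 1 d c] by auto
    from this[of "- (d \<bullet> y)"] 1 have "cos 1 = (1::real)" by (simp add: algebra_simps)
    moreover have "cos 1 < (cos 0 :: real)"
      by (rule cos_monotone_0_pi) (use pi_gt3 in auto)
    ultimately show False by simp
  qed
  interpret function_ring_on trig_polys "cball (0::'b) r"
    by unfold_locales (auto intro: trig_polys_continuous trig_polys.add trig_polys_mult trig_polys_const sep)
  obtain g where g: "g \<in> trig_polys" "\<And>x. x \<in> cball 0 r \<Longrightarrow> \<bar>f x - g x\<bar> < e"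
    using Stone_Weierstrass_basic[of f e] assms continuous_on_subset by blast
  obtain G where G: "\<And>x. \<bar>g x\<bar> \<le> G" using trig_polys_bounded[OF g(1)] by blast
  define clamp where "clamp t = max (- B) (min B t)" for t
  obtain q where q: "real_polynomial_function q" "\<And>t. t \<in> {-G..G} \<Longrightarrow> \<bar>clamp t - q t\<bar> < e"
    by (rule Stone_Weierstrass_real_polynomial_function[of "{-G..G}" clamp e])
      (use \<open>e > 0\<close> in \<open>auto simp: clamp_def intro!: continuous_intros\<close>)
  have 1: "\<bar>clamp (g x) - q (g x)\<bar> < e" for x
    using q(2)[of "g x"] G[of x] by (simp add: abs_le_iff)
  have 2: "\<bar>f x - clamp (g x)\<bar> < e" if "x \<in> cball 0 r" for x
    using g(2)[OF that] B[of x] by (auto simp: clamp_def)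
  have 3: "\<bar>f x - clamp (g x)\<bar> \<le> 2 * B" for x
    using B[of x] by (auto simp: clamp_def)
  show ?thesis
  proof (intro bexI conjI ballI allI)
    show "(\<lambda>x. q (g x)) \<in> trig_polys" by (rule trig_polys_polynomial) fact+
    show "\<bar>f x - q (g x)\<bar> \<le> 2 * e" if "x \<in> cball 0 r" for x
      using 1[of x] 2[OF that] by linarith
    show "\<bar>f x - q (g x)\<bar> \<le> 2 * B + e" for x
      using 1[of x] 3[of x] by linarith
  qed
qed

text \<open>Covering the exceptional sets by measurable ones frees both notions from measurability
  side conditions.\<close>

definition tends_in_prob :: "'a measure \<Rightarrow> (nat \<Rightarrow> 'a \<Rightarrow> 'b::metric_space) \<Rightarrow> 'b \<Rightarrow> bool" where
  "tends_in_prob M T c \<longleftrightarrow> (\<forall>e>0. \<forall>\<^sub>F n in sequentially.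
     \<exists>A\<in>sets M. measure M A < e \<and> (\<forall>\<omega>\<in>space M - A. dist (T n \<omega>) c < e))"

definition bounded_in_prob :: "'a measure \<Rightarrow> (nat \<Rightarrow> 'a \<Rightarrow> 'b::real_normed_vector) \<Rightarrow> bool" where
  "bounded_in_prob M T \<longleftrightarrow> (\<forall>e>0. \<exists>K. \<forall>\<^sub>F n in sequentially.
     \<exists>A\<in>sets M. measure M A < e \<and> (\<forall>\<omega>\<in>space M - A. norm (T n \<omega>) \<le> K))"

text \<open>The integrands differ by at most \<open>e + C * indicator A\<close>: a crude bound on a
  rare event and a fine one off it. The rare event is a tail event under tightness, or the
  exceptional set of convergence in probability.\<close>

lemma (in prob_space) expectation_diff_le:
  assumes f: "f \<in> borel_measurable M" "\<And>\<omega>. \<bar>f \<omega>\<bar> \<le> F" and g: "g \<in> borel_measurable M" "\<And>\<omega>. \<bar>g \<omega>\<bar> \<le> G"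
    and A: "A \<in> sets M" "prob A \<le> d" and C: "C \<ge> 0"
    and in_A: "\<And>\<omega>. \<omega> \<in> space M \<Longrightarrow> \<bar>f \<omega> - g \<omega>\<bar> \<le> C"
    and out: "\<And>\<omega>. \<omega> \<in> space M - A \<Longrightarrow> \<bar>f \<omega> - g \<omega>\<bar> \<le> e"
    and "e \<ge> 0"
  shows "\<bar>expectation f - expectation g\<bar> \<le> e + C * d"
proof -
  note [measurable] = f(1) g(1) A(1)
  have [simp]: "integrable M f" "integrable M g"
    using f g by (auto intro: integrable_const_bound[where B=F] integrable_const_bound[where B=G])
  have "\<bar>expectation f - expectation g\<bar> = \<bar>expectation (\<lambda>\<omega>. f \<omega> - g \<omega>)\<bar>"
    by simp
  also have "\<dots> \<le> expectation (\<lambda>\<omega>. \<bar>f \<omega> - g \<omega>\<bar>)"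
    by (rule integral_abs_bound)
  also have "\<dots> \<le> expectation (\<lambda>\<omega>. e + C * indicator A \<omega>)"
  proof (rule integral_mono)
    show "integrable M (\<lambda>\<omega>. e + C * indicator A \<omega>)"
      by (auto intro!: Bochner_Integration.integrable_add integrable_mult_right integrable_real_indicator simp: emeasure_eq_measure)
    show "\<bar>f \<omega> - g \<omega>\<bar> \<le> e + C * indicator A \<omega>" if "\<omega> \<in> space M" for \<omega>
      using in_A[OF that] out[of \<omega>] that \<open>e \<ge> 0\<close> by (auto simp: indicator_def)
  qed auto
  also have "\<dots> = e + C * prob A"
    by (subst Bochner_Integration.integral_add)
      (auto simp: prob_space emeasure_eq_measure intro!: integrable_mult_right integrable_real_indicator)
  also have "\<dots> \<le> e + C * d" using A C by (intro add_left_mono mult_left_mono) auto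
  finally show ?thesis .
qed

text \<open>A Cramer-Wold device: on a large ball \<open>f\<close> is close to a trigonometric
  polynomial, whose integrals converge by linearity, and outside the ball a fixed error bound is
  multiplied by a small probability. The hypothesis on cosines involves one-dimensional projections
  only.\<close>

lemma weakly_converges_distrI:
  fixes T :: "nat \<Rightarrow> 'a \<Rightarrow> 'b::euclidean_space"
  assumes M: "prob_space M" and \<mu>: "prob_space \<mu>" "sets \<mu> = sets borel"
    and T [measurable]: "\<And>n. T n \<in> borel_measurable M"
    and tight: "bounded_in_prob M T"
    and cos: "\<And>v c. (\<lambda>n. LINT \<omega>|M. cos (v \<bullet> T n \<omega> + c)) \<longlonglongrightarrow> (LINT x|\<mu>. cos (v \<bullet> x + c))"
  shows "weakly_converges (\<lambda>n. distr M borel (T n)) \<mu>"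
  unfolding weakly_converges_def
proof (intro allI impI)
  fix f :: "'b \<Rightarrow> real"
  assume f: "continuous_on UNIV f" "bounded (range f)"
  interpret M: prob_space M by fact
  interpret \<mu>: prob_space \<mu> by fact
  note [measurable_cong] = \<mu>(2)
  have [measurable]: "g \<in> borel_measurable borel" if "continuous_on UNIV g" for g :: "'b \<Rightarrow> real"
    using that by (rule borel_measurable_continuous_onI)
  from f(2) obtain B where B: "B > 0" "\<And>x. \<bar>f x\<bar> \<le> B"
    by (auto simp: bounded_pos)
  have trig: "(\<lambda>n. LINT \<omega>|M. k (T n \<omega>)) \<longlonglongrightarrow> (LINT x|\<mu>. k x) \<and>
      (\<forall>n. integrable M (\<lambda>\<omega>. k (T n \<omega>))) \<and> integrable \<mu> k" if "k \<in> trig_polys" for k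
    using that
  proof induction
    case (cos a v c)
    have "\<bar>cos x\<bar> \<le> 1" for x :: real by simp
    then show ?case
      using assms(6)[of v c]
      by (auto intro!: tendsto_mult_left integrable_mult_right M.integrable_const_bound[of _ 1] \<mu>.integrable_const_bound[of _ 1])
  next
    case (add f g)
    then show ?case by (auto intro!: tendsto_add)
  qed
  have *: "\<forall>\<^sub>F n in sequentially. \<bar>(LINT \<omega>|M. f (T n \<omega>)) - (LINT x|\<mu>. f x)\<bar> < e * (4 * B + 8)"
    if e: "0 < e" "e \<le> 1" for e
  proof -
    obtain K where K: "\<forall>\<^sub>F n in sequentially.
        \<exists>A\<in>sets M. measure M A < e \<and> (\<forall>\<omega>\<in>space M - A. norm (T n \<omega>) \<le> K)"
      using tight e(1) unfolding bounded_in_prob_def by blast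
    \<comment> \<open>Tightness of the limit law itself: the complements of growing balls decrease
      to the empty set.\<close>
    have "(\<lambda>n. measure \<mu> (UNIV - cball 0 (real n))) \<longlonglongrightarrow> measure \<mu> (\<Inter>n. UNIV - cball 0 (real n))"
    proof (rule \<mu>.finite_Lim_measure_decseq)
      show "decseq (\<lambda>n. UNIV - cball (0::'b) (real n))"
        by (intro decseq_SucI Diff_mono subset_cball) auto
      show "range (\<lambda>n. UNIV - cball 0 (real n)) \<subseteq> sets \<mu>"
        unfolding \<mu>(2) by (intro image_subsetI sets.Diff) simp_all
    qed
    moreover have "(\<Inter>n. UNIV - cball (0::'b) (real n)) = {}"
    proof (intro equals0I)
      fix x :: 'b assume *: "x \<in> (\<Inter>n. UNIV - cball 0 (real n))"
      obtain n where "norm x \<le> real n" using real_arch_simple by blast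
      then show False using * by auto
    qed
    ultimately have "(\<lambda>n. measure \<mu> (UNIV - cball 0 (real n))) \<longlonglongrightarrow> 0"
      by (simp only: measure_empty)
    then have "\<forall>\<^sub>F n in sequentially. measure \<mu> (UNIV - cball 0 (real n)) < e"
      using e(1) by (rule order_tendstoD(2))
    then obtain K' where K': "measure \<mu> (UNIV - cball 0 (real K')) < e"
      using eventually_happens'[OF sequentially_bot] by blast
    \<comment> \<open>One radius for both sides, so that the same approximant \<open>k\<close>
      serves the sample laws and the limit law.\<close>
    define r where "r = max K (real K')"
    obtain k where k: "k \<in> trig_polys" "\<And>x. x \<in> cball 0 r \<Longrightarrow> \<bar>f x - k x\<bar> \<le> 2 * e"
        "\<And>x. \<bar>f x - k x\<bar> \<le> 2 * B + e"
      using trig_polys_approx[OF f(1) B(2) e(1), of r] by blast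
    obtain C where C: "\<And>x. \<bar>k x\<bar> \<le> C" using trig_polys_bounded[OF k(1)] by blast
    note [measurable] = borel_measurable_continuous_onI[OF f(1)]
      borel_measurable_continuous_onI[OF trig_polys_continuous[OF k(1)]]
    have 1: "\<bar>(LINT x|\<mu>. f x) - (LINT x|\<mu>. k x)\<bar> \<le> 2 * e + (2 * B + e) * e"
    proof (rule \<mu>.expectation_diff_le[OF _ B(2) _ C, where A="UNIV - cball 0 (real K')"])
      show "\<bar>f x - k x\<bar> \<le> 2 * e" if "x \<in> space \<mu> - (UNIV - cball 0 (real K'))" for x
        by (rule k) (use that in \<open>auto simp: r_def\<close>)
    qed (use e K' B(1) k(3) \<mu>(2) in auto)
    have 2: "\<forall>\<^sub>F n in sequentially. \<bar>(LINT \<omega>|M. f (T n \<omega>)) - (LINT \<omega>|M. k (T n \<omega>))\<bar> \<le> 2 * e + (2 * B + e) * e"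
      using K
    proof eventually_elim
      case (elim n)
      then obtain A where A: "A \<in> sets M" "measure M A < e" "\<And>\<omega>. \<omega> \<in> space M - A \<Longrightarrow> norm (T n \<omega>) \<le> K"
        by blast
      show ?case
      proof (rule M.expectation_diff_le[OF _ B(2) _ C, where A=A])
        show "\<bar>f (T n \<omega>) - k (T n \<omega>)\<bar> \<le> 2 * e" if "\<omega> \<in> space M - A" for \<omega>
          by (rule k) (use A(3)[OF that] in \<open>auto simp: r_def\<close>)
      qed (use e A B(1) k(3) in auto)
    qed
    have 3: "\<forall>\<^sub>F n in sequentially. \<bar>(LINT \<omega>|M. k (T n \<omega>)) - (LINT x|\<mu>. k x)\<bar> < e"
      using trig[OF k(1)] e(1) by (auto simp: tendsto_iff dist_real_def)
    \<comment> \<open>Two approximation errors and one convergence error; \<open>e \<le> 1\<close>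
      makes the quadratic term linear, and the sum is then at most
      \<open>7 * e + 4 * B * e\<close>.\<close>
    have 4: "2 * (2 * e + (2 * B + e) * e) + e \<le> e * (4 * B + 8)"
    proof -
      have "e * e \<le> e * 1" using e by (intro mult_left_mono) auto
      then have "2 * (2 * e + (2 * B + e) * e) + e \<le> 5 * e + 4 * B * e + 2 * e"
        by (simp add: algebra_simps)
      also have "\<dots> \<le> e * (4 * B + 8)" using e by (simp add: algebra_simps)
      finally show ?thesis .
    qed
    have triangle: "\<bar>s - u\<bar> < E" if "\<bar>s - t\<bar> \<le> d" "\<bar>t - w\<bar> < e" "\<bar>u - w\<bar> \<le> d" "2 * d + e \<le> E" for s t u w d E :: real
      using that by linarith
    from 2 3 show ?thesis
    proof eventually_elim
      case (elim n)
      then show ?case by (rule triangle[OF _ _ 1 4])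
    qed
  qed
  have "(\<lambda>n. LINT \<omega>|M. f (T n \<omega>)) \<longlonglongrightarrow> (LINT x|\<mu>. f x)"
    unfolding tendsto_iff dist_real_def
  proof (intro allI impI)
    fix d :: real assume d: "d > 0"
    define e where "e = min 1 (d / (4 * B + 8))"
    have e: "0 < e" "e \<le> 1" using d B(1) by (auto simp: e_def)
    have "e * (4 * B + 8) \<le> d"
      using B(1) d by (subst pos_le_divide_eq[symmetric]) (auto simp: e_def)
    then show "\<forall>\<^sub>F n in sequentially. \<bar>(LINT \<omega>|M. f (T n \<omega>)) - (LINT x|\<mu>. f x)\<bar> < d"
      using *[OF e] by (auto elim: eventually_mono)
  qed
  then show "(\<lambda>n. LINT x|distr M borel (T n). f x) \<longlonglongrightarrow> (LINT x|\<mu>. f x)"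
    using borel_measurable_continuous_onI[OF f(1)] by (simp add: integral_distr)
qed

section \<open>Centered Gaussian measures\<close>

lemma integrable_mult_of_squares:
  fixes f g :: "'a \<Rightarrow> real"
  assumes [measurable]: "f \<in> borel_measurable M" "g \<in> borel_measurable M"
    and "integrable M (\<lambda>x. (f x)\<^sup>2)" "integrable M (\<lambda>x. (g x)\<^sup>2)"
  shows "integrable M (\<lambda>x. f x * g x)"
proof (rule Bochner_Integration.integrable_bound[where f="\<lambda>x. (f x)\<^sup>2 + (g x)\<^sup>2"])
  show "AE x in M. norm (f x * g x) \<le> norm ((f x)\<^sup>2 + (g x)\<^sup>2)"
  proof (intro AE_I2)
    fix x
    have "2 * (\<bar>f x\<bar> * \<bar>g x\<bar>) \<le> (f x)\<^sup>2 + (g x)\<^sup>2"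
      using sum_squares_bound[of "\<bar>f x\<bar>" "\<bar>g x\<bar>"] by simp
    moreover have "0 \<le> \<bar>f x\<bar> * \<bar>g x\<bar>" by simp
    ultimately show "norm (f x * g x) \<le> norm ((f x)\<^sup>2 + (g x)\<^sup>2)"
      unfolding real_norm_def abs_mult by linarith
  qed
qed (use assms in auto)

lemma integrable_inner_square:
  fixes f :: "'a \<Rightarrow> 'b::euclidean_space"
  assumes [measurable]: "f \<in> borel_measurable M" and sq: "integrable M (\<lambda>x. (norm (f x))\<^sup>2)"
  shows "integrable M (\<lambda>x. (v \<bullet> f x)\<^sup>2)"
proof (rule Bochner_Integration.integrable_bound[where f="\<lambda>x. (norm v)\<^sup>2 * (norm (f x))\<^sup>2"])
  show "AE x in M. norm ((v \<bullet> f x)\<^sup>2) \<le> norm ((norm v)\<^sup>2 * (norm (f x))\<^sup>2)"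
    using Cauchy_Schwarz_ineq[of v] by (simp add: power2_norm_eq_inner)
qed (use sq in auto)

text \<open>Cholesky factorization by Gram-Schmidt: removing from every variable its projection onto
  \<open>\<zeta> i\<close> leaves a Gram matrix over the smaller index set. The variables may be
  linearly dependent, so a pivot may vanish.\<close>

lemma gram_factorization:
  fixes \<zeta> :: "'i \<Rightarrow> 'a \<Rightarrow> real"
  assumes "finite I"
    and "\<And>a. a \<in> I \<Longrightarrow> \<zeta> a \<in> borel_measurable M"
    and "\<And>a. a \<in> I \<Longrightarrow> integrable M (\<lambda>\<omega>. (\<zeta> a \<omega>)\<^sup>2)"
  shows "\<exists>L :: 'i \<Rightarrow> 'i \<Rightarrow> real. \<forall>a\<in>I. \<forall>b\<in>I. (LINT \<omega>|M. \<zeta> a \<omega> * \<zeta> b \<omega>) = (\<Sum>j\<in>I. L j a * L j b)"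
  using assms
proof (induction I arbitrary: \<zeta>)
  case (insert i I)
  define Q where "Q a b = (LINT \<omega>|M. \<zeta> a \<omega> * \<zeta> b \<omega>)" for a b
  define q where "q = Q i i"
  \<comment> \<open>The residual after projection onto \<open>\<zeta> i\<close>. For
    \<open>q = 0\<close> the quotient is 0 by the convention on division and nothing is subtracted,
    as it should be: \<open>\<zeta> i\<close> then vanishes almost everywhere.\<close>
  define \<eta> where "\<eta> a \<omega> = \<zeta> a \<omega> - Q a i / q * \<zeta> i \<omega>" for a \<omega>
  have [measurable]: "\<zeta> i \<in> borel_measurable M" using insert.prems by simp
  have int: "integrable M (\<lambda>\<omega>. \<zeta> a \<omega> * \<zeta> b \<omega>)" if "a \<in> insert i I" "b \<in> insert i I" for a b
    using insert.prems that by (intro integrable_mult_of_squares) auto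
  have Q_sym: "Q a b = Q b a" for a b
    by (simp add: Q_def mult.commute)
  have q_nonneg: "q \<ge> 0" by (simp add: q_def Q_def)
  have Q0: "Q a i = 0" if "q = 0" "a \<in> insert i I" for a
  proof -
    have "AE \<omega> in M. \<zeta> i \<omega> * \<zeta> i \<omega> = 0"
      using that(1) int[of i i] unfolding q_def Q_def
      by (subst (asm) integral_nonneg_eq_0_iff_AE) auto
    then have "AE \<omega> in M. \<zeta> a \<omega> * \<zeta> i \<omega> = 0" by eventually_elim auto
    then show ?thesis unfolding Q_def by (rule integral_eq_zero_AE)
  qed
  have exp: "\<eta> a \<omega> * \<eta> b \<omega> = \<zeta> a \<omega> * \<zeta> b \<omega> - Q b i / q * (\<zeta> a \<omega> * \<zeta> i \<omega>)
      - Q a i / q * (\<zeta> b \<omega> * \<zeta> i \<omega>) + Q a i / q * (Q b i / q) * (\<zeta> i \<omega> * \<zeta> i \<omega>)" for a b \<omega>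
    unfolding \<eta>_def by (simp add: algebra_simps)
  have int_\<eta>: "integrable M (\<lambda>\<omega>. \<eta> a \<omega> * \<eta> b \<omega>)" if "a \<in> I" "b \<in> I" for a b
    unfolding exp using that int by auto
  have Q_\<eta>: "(LINT \<omega>|M. \<eta> a \<omega> * \<eta> b \<omega>) = Q a b - Q a i * Q b i / q" if "a \<in> I" "b \<in> I" for a b
  proof -
    have "(LINT \<omega>|M. \<eta> a \<omega> * \<eta> b \<omega>)
        = Q a b - Q b i / q * Q a i - Q a i / q * Q b i + Q a i / q * (Q b i / q) * q"
      unfolding exp q_def Q_def using that int by simp
    also have "\<dots> = Q a b - Q a i * Q b i / q"
      by (cases "q = 0") (auto simp: field_simps)
    finally show ?thesis .
  qed
  obtain L where L: "\<And>a b. a \<in> I \<Longrightarrow> b \<in> I \<Longrightarrow> (LINT \<omega>|M. \<eta> a \<omega> * \<eta> b \<omega>) = (\<Sum>j\<in>I. L j a * L j b)"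
    using insert.IH[of \<eta>] insert.prems int_\<eta> by (auto simp: \<eta>_def power2_eq_square)
  \<comment> \<open>Row \<open>i\<close> holds the projection coefficients, normalized by the square
    root of the pivot. Column \<open>i\<close> is 0 in the other rows, since the projection leaves
    nothing of \<open>\<zeta> i\<close>.\<close>
  define L' where "L' j a = (if j = i then Q a i / sqrt q else if a = i then 0 else L j a)" for j a
  have split: "(\<Sum>j\<in>insert i I. L' j a * L' j b)
      = Q a i * Q b i / q + (if a = i \<or> b = i then 0 else \<Sum>j\<in>I. L j a * L j b)" for a b
  proof -
    have "(\<Sum>j\<in>I. L' j a * L' j b) = (\<Sum>j\<in>I. if a = i \<or> b = i then 0 else L j a * L j b)"
      by (rule sum.cong) (use insert.hyps in \<open>auto simp: L'_def\<close>)
    moreover have "L' i a * L' i b = Q a i * Q b i / q"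
      using q_nonneg by (simp add: L'_def)
    ultimately show ?thesis using insert.hyps by simp
  qed
  have "Q a b = (\<Sum>j\<in>insert i I. L' j a * L' j b)" if "a \<in> insert i I" "b \<in> insert i I" for a b
  proof (cases "a = i \<or> b = i")
    case True
    then show ?thesis
      unfolding split using Q0 that Q_sym by (cases "q = 0") (auto simp: q_def)
  next
    case False
    then show ?thesis unfolding split using that Q_\<eta>[of a b] L[of a b] by simp
  qed
  then show ?case unfolding Q_def by blast
qed simp

section \<open>Centered Gaussian laws through their projections\<close>

abbreviation "std_normal \<equiv> std_normal_distribution"

interpretation std_normal: real_distribution std_normal
  by (rule real_dist_normal_dist)

lemma normal_law_eq_distr:
  assumes "s \<ge> 0"
  shows "normal_law 0 s = distr std_normal borel (\<lambda>t. s * t)"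
proof (cases "s = 0")
  case True
  then show ?thesis by (simp add: normal_law_def std_normal.distr_const)
next
  case False
  have "distributed std_normal lborel (\<lambda>x. x) std_normal_density"
    by (auto simp: distributed_def distr_id2)
  from std_normal.normal_density_affine[OF this, of s 0]
  have "distributed std_normal lborel (\<lambda>t. s * t) (normal_density 0 s)"
    using False assms by simp
  then have "density lborel (normal_density 0 s) = distr std_normal lborel (\<lambda>t. s * t)"
    by (simp add: distributed_def)
  also have "\<dots> = distr std_normal borel (\<lambda>t. s * t)"
    by (rule distr_cong) auto
  finally show ?thesis using False by (simp add: normal_law_def)
qed

text \<open>\<open>V v\<close> is the variance of the projection onto \<open>v\<close>, so
  \<open>V\<close> is the quadratic form of the covariance. Scaling a standard normal variable
  includes the point mass for \<open>V v = 0\<close> without a case distinction.\<close>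

definition centered_gaussian :: "('b::euclidean_space \<Rightarrow> real) \<Rightarrow> 'b measure \<Rightarrow> bool" where
  "centered_gaussian V \<mu> \<longleftrightarrow> prob_space \<mu> \<and> sets \<mu> = sets borel \<and> (\<forall>v. V v \<ge> 0) \<and>
     (\<forall>v. distr \<mu> borel (\<lambda>x. v \<bullet> x) = distr std_normal borel (\<lambda>t. sqrt (V v) * t))"

lemma centered_gaussian_multivariate_normal:
  assumes "centered_gaussian V \<mu>"
  shows "multivariate_normal \<mu>"
  unfolding multivariate_normal_def
proof (intro conjI allI exI)
  fix v
  have "V v \<ge> 0" using assms by (simp add: centered_gaussian_def)
  then show "0 \<le> sqrt (V v)" by simp
  then show "distr \<mu> borel (\<lambda>x. v \<bullet> x) = normal_law 0 (sqrt (V v))"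
    using assms by (simp add: centered_gaussian_def normal_law_eq_distr)
qed (use assms in \<open>auto simp: centered_gaussian_def\<close>)

lemma centered_gaussian_integral:
  fixes f :: "real \<Rightarrow> real"
  assumes "centered_gaussian V \<mu>" and [measurable]: "f \<in> borel_measurable borel"
  shows "(LINT x|\<mu>. f (v \<bullet> x)) = (LINT t|std_normal. f (sqrt (V v) * t))"
    and "integrable \<mu> (\<lambda>x. f (v \<bullet> x)) \<longleftrightarrow> integrable std_normal (\<lambda>t. f (sqrt (V v) * t))"
proof -
  have [measurable_cong]: "sets \<mu> = sets borel"
    and eq: "distr \<mu> borel (\<lambda>x. v \<bullet> x) = distr std_normal borel (\<lambda>t. sqrt (V v) * t)"
    using assms by (auto simp: centered_gaussian_def)
  show "(LINT x|\<mu>. f (v \<bullet> x)) = (LINT t|std_normal. f (sqrt (V v) * t))"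
    using arg_cong[OF eq, of "\<lambda>m. LINT t|m. f t"] by (simp add: integral_distr)
  show "integrable \<mu> (\<lambda>x. f (v \<bullet> x)) \<longleftrightarrow> integrable std_normal (\<lambda>t. f (sqrt (V v) * t))"
    using arg_cong[OF eq, of "\<lambda>m. integrable m f"] by (simp add: integrable_distr_eq)
qed

lemma centered_gaussian_moments:
  assumes "centered_gaussian V \<mu>"
  shows "integrable \<mu> (\<lambda>x. v \<bullet> x)" "(LINT x|\<mu>. v \<bullet> x) = 0"
    and "integrable \<mu> (\<lambda>x. (v \<bullet> x)\<^sup>2)" "(LINT x|\<mu>. (v \<bullet> x)\<^sup>2) = V v"
proof -
  have 1: "integrable std_normal (\<lambda>t. t)" "(LINT t|std_normal. t) = 0"
    using integrable_std_normal_distribution_moment[of 1] integral_std_normal_distribution_moment_odd[of 1] by auto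
  have 2: "integrable std_normal (\<lambda>t. t\<^sup>2)" "(LINT t|std_normal. t\<^sup>2) = 1"
    using integrable_std_normal_distribution_moment[of 2] std_normal_distribution_even_moments(1)[of 1] by auto
  have "V v \<ge> 0" using assms by (simp add: centered_gaussian_def)
  then show "(LINT x|\<mu>. (v \<bullet> x)\<^sup>2) = V v" "integrable \<mu> (\<lambda>x. (v \<bullet> x)\<^sup>2)"
    using 2 centered_gaussian_integral[OF assms, of "\<lambda>t. t\<^sup>2" v] by (simp_all add: power_mult_distrib)
  have "integrable std_normal (\<lambda>t. sqrt (V v) * t)" "(LINT t|std_normal. sqrt (V v) * t) = sqrt (V v) * 0"
    using integrable_mult_right[of "sqrt (V v)", OF 1(1)]
      integral_mult_right_zero[of std_normal "sqrt (V v)" "\<lambda>t. t"] 1(2) by metis+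
  then show "integrable \<mu> (\<lambda>x. v \<bullet> x)" "(LINT x|\<mu>. v \<bullet> x) = 0"
    using centered_gaussian_integral[OF assms, of "\<lambda>t. t" v] by auto
qed

text \<open>The Gram factorization writes the quadratic form as a sum of squares of
  \<open>v \<bullet> l j\<close>. The random combination of the vectors \<open>l j\<close> with
  independent standard normal coefficients, one for each basis vector, then has the desired
  projections, also when the form is singular.\<close>

lemma centered_gaussian_exists:
  fixes \<zeta> :: "'a \<Rightarrow> 'b::euclidean_space"
  assumes [measurable]: "\<zeta> \<in> borel_measurable M"
    and sq: "integrable M (\<lambda>\<omega>. (norm (\<zeta> \<omega>))\<^sup>2)"
  shows "\<exists>\<mu>. centered_gaussian (\<lambda>v. LINT \<omega>|M. (v \<bullet> \<zeta> \<omega>)\<^sup>2) \<mu>"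
proof -
  note int_sq = integrable_inner_square[OF assms]
  obtain L :: "'b \<Rightarrow> 'b \<Rightarrow> real" where L: "\<And>a b. a \<in> Basis \<Longrightarrow> b \<in> Basis \<Longrightarrow>
      (LINT \<omega>|M. (a \<bullet> \<zeta> \<omega>) * (b \<bullet> \<zeta> \<omega>)) = (\<Sum>j\<in>Basis. L j a * L j b)"
  proof -
    have "\<exists>L :: 'b \<Rightarrow> 'b \<Rightarrow> real. \<forall>a\<in>Basis. \<forall>b\<in>Basis. (LINT \<omega>|M. (a \<bullet> \<zeta> \<omega>) * (b \<bullet> \<zeta> \<omega>)) = (\<Sum>j\<in>Basis. L j a * L j b)"
      by (rule gram_factorization[where \<zeta>="\<lambda>a \<omega>. a \<bullet> \<zeta> \<omega>" and I=Basis]) (use int_sq in simp_all)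
    then show ?thesis using that by blast
  qed
  define l where "l j = (\<Sum>a\<in>Basis. L j a *\<^sub>R a)" for j
  define V where "V v = (LINT \<omega>|M. (v \<bullet> \<zeta> \<omega>)\<^sup>2)" for v
  have V: "V v = (\<Sum>j\<in>Basis. (v \<bullet> l j)\<^sup>2)" for v
  proof -
    have v: "v \<bullet> y = (\<Sum>a\<in>Basis. (v \<bullet> a) * (a \<bullet> y))" for y
      using euclidean_inner[of v y] by (simp add: inner_commute)
    have int: "integrable M (\<lambda>\<omega>. (a \<bullet> \<zeta> \<omega>) * (b \<bullet> \<zeta> \<omega>))" for a b
      using int_sq by (intro integrable_mult_of_squares) auto
    have "(v \<bullet> \<zeta> \<omega>)\<^sup>2 = (\<Sum>a\<in>Basis. \<Sum>b\<in>Basis. (v \<bullet> a) * (v \<bullet> b) * ((a \<bullet> \<zeta> \<omega>) * (b \<bullet> \<zeta> \<omega>)))" for \<omega>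
      unfolding power2_eq_square v[of "\<zeta> \<omega>"] sum_product by (simp add: ac_simps)
    then have "V v = (\<Sum>a\<in>Basis. \<Sum>b\<in>Basis. (v \<bullet> a) * (v \<bullet> b) * (LINT \<omega>|M. (a \<bullet> \<zeta> \<omega>) * (b \<bullet> \<zeta> \<omega>)))"
      using int by (simp add: V_def)
    also have "\<dots> = (\<Sum>a\<in>Basis. \<Sum>b\<in>Basis. \<Sum>j\<in>Basis. (L j a * (v \<bullet> a)) * (L j b * (v \<bullet> b)))"
      by (intro sum.cong refl) (simp add: L sum_distrib_left ac_simps)
    also have "\<dots> = (\<Sum>j\<in>Basis. \<Sum>a\<in>Basis. \<Sum>b\<in>Basis. (L j a * (v \<bullet> a)) * (L j b * (v \<bullet> b)))"
      by (subst sum.swap, subst (2) sum.swap) (rule refl)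
    also have "\<dots> = (\<Sum>j\<in>Basis. (v \<bullet> l j)\<^sup>2)"
      by (simp add: l_def inner_sum_right power2_eq_square sum_product)
    finally show ?thesis .
  qed
  interpret product_prob_space "\<lambda>_::'b. std_normal" Basis ..
  define N where "N = Pi\<^sub>M (Basis :: 'b set) (\<lambda>_. std_normal)"
  interpret N: prob_space N unfolding N_def by (rule P.prob_space_axioms)
  have comp: "(\<lambda>z. z j) \<in> borel_measurable N" if "j \<in> Basis" for j
    unfolding N_def using measurable_component_singleton[OF that, of "\<lambda>_. std_normal"] by simp
  define h where "h z = (\<Sum>j\<in>Basis. z j *\<^sub>R l j)" for z :: "'b \<Rightarrow> real"
  have [measurable]: "h \<in> borel_measurable N"
    unfolding h_def by (intro borel_measurable_sum borel_measurable_scaleR borel_measurable_const comp)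
  \<comment> \<open>Characteristic functions turn the sum of independent normal variables into a
    product of Gaussian factors, whose exponents add up to \<open>V v\<close>; this covers
    \<open>V v = 0\<close> as well.\<close>
  have proj: "distr N borel (\<lambda>z. v \<bullet> h z) = distr std_normal borel (\<lambda>t. sqrt (V v) * t)" for v
  proof (rule Levy_uniqueness)
    show "real_distribution (distr N borel (\<lambda>z. v \<bullet> h z))"
      by (intro N.real_distribution_distr) measurable
    show "real_distribution (distr std_normal borel (\<lambda>t. sqrt (V v) * t))"
      by (intro std_normal.real_distribution_distr) measurable
    show "char (distr N borel (\<lambda>z. v \<bullet> h z)) = char (distr std_normal borel (\<lambda>t. sqrt (V v) * t))"
    proof
      fix t
      have "char (distr N borel (\<lambda>z. v \<bullet> h z)) t = (LINT z|N. iexp (t * (v \<bullet> h z)))"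
        unfolding char_def by (subst integral_distr) measurable
      also have "\<dots> = (LINT z|N. (\<Prod>j\<in>Basis. iexp (t * (v \<bullet> l j) * z j)))"
      proof (intro Bochner_Integration.integral_cong refl)
        fix z
        have "t * (v \<bullet> h z) = (\<Sum>j\<in>Basis. t * (v \<bullet> l j) * z j)"
          by (simp add: h_def inner_sum_right sum_distrib_left ac_simps)
        then show "iexp (t * (v \<bullet> h z)) = (\<Prod>j\<in>Basis. iexp (t * (v \<bullet> l j) * z j))"
          by (simp add: sum_distrib_left exp_sum)
      qed
      also have "\<dots> = (\<Prod>j\<in>Basis. char std_normal (t * (v \<bullet> l j)))"
        unfolding N_def char_def
        by (subst product_integral_prod) (auto intro!: std_normal.integrable_iexp)
      also have "\<dots> = complex_of_real (\<Prod>j\<in>Basis. exp (- (t * (v \<bullet> l j))\<^sup>2 / 2))"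
        by (simp add: char_std_normal_distribution)
      also have "(\<Prod>j\<in>Basis. exp (- (t * (v \<bullet> l j))\<^sup>2 / 2)) = exp (- (t\<^sup>2 * V v) / 2)"
        by (subst exp_sum[symmetric])
          (simp_all add: V power_mult_distrib sum_distrib_left sum_negf sum_divide_distrib)
      also have "complex_of_real \<dots> = char std_normal (t * sqrt (V v))"
      proof -
        have "V v \<ge> 0" unfolding V by (intro sum_nonneg) auto
        then show ?thesis by (simp add: char_std_normal_distribution power_mult_distrib)
      qed
      also have "\<dots> = char (distr std_normal borel (\<lambda>t. sqrt (V v) * t)) t"
        unfolding char_def by (subst integral_distr) (auto simp: ac_simps)
      finally show "char (distr N borel (\<lambda>z. v \<bullet> h z)) t = char (distr std_normal borel (\<lambda>t. sqrt (V v) * t)) t" .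
    qed
  qed
  have "centered_gaussian V (distr N borel h)"
    unfolding centered_gaussian_def
  proof (intro conjI allI)
    show "prob_space (distr N borel h)" by (rule N.prob_space_distr) measurable
    show "V v \<ge> 0" for v unfolding V by (intro sum_nonneg) auto
    show "distr (distr N borel h) borel (\<lambda>x. v \<bullet> x) = distr std_normal borel (\<lambda>t. sqrt (V v) * t)" for v
      using proj[of v] by (subst distr_distr) (auto simp: comp_def)
  qed simp
  then show ?thesis unfolding V_def by blast
qed

section \<open>Convergence in probability\<close>

lemma tends_in_prob_compose:
  assumes T: "tends_in_prob M T c" and h: "isCont h c"
  shows "tends_in_prob M (\<lambda>n \<omega>. h (T n \<omega>)) (h c)"
  unfolding tends_in_prob_def
proof (intro allI impI)
  fix e :: real assume "e > 0"
  then obtain d where d: "d > 0" "\<And>x. dist x c < d \<Longrightarrow> dist (h x) (h c) < e"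
    using h unfolding continuous_at_eps_delta by blast
  \<comment> \<open>In \<open>tends_in_prob\<close> one number bounds both the exceptional
    probability and the distance, so it has to lie below \<open>e\<close> as well as below the
    modulus of continuity.\<close>
  define d' where "d' = min d e"
  have "d' > 0" using d \<open>e > 0\<close> by (simp add: d'_def)
  with T have "\<forall>\<^sub>F n in sequentially.
      \<exists>A\<in>sets M. measure M A < d' \<and> (\<forall>\<omega>\<in>space M - A. dist (T n \<omega>) c < d')"
    unfolding tends_in_prob_def by blast
  then show "\<forall>\<^sub>F n in sequentially.
      \<exists>A\<in>sets M. measure M A < e \<and> (\<forall>\<omega>\<in>space M - A. dist (h (T n \<omega>)) (h c) < e)"
    by (rule eventually_mono) (use d(2) in \<open>auto simp: d'_def\<close>)
qed

lemma tends_in_prob_const: "tends_in_prob M (\<lambda>n \<omega>. c) c"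
  unfolding tends_in_prob_def by (intro allI impI always_eventually bexI[of _ "{}"]) auto

text \<open>An identity that needs a nonzero denominator or determinant may fail on an event of
  small probability, namely where \<open>S\<close> is not yet near its limit. Restricting to
  \<open>n > 0\<close> keeps division by the sample size meaningful.\<close>

lemma tends_in_prob_cong_near:
  assumes T: "tends_in_prob M T c" and S: "tends_in_prob M S s" and "finite_measure M"
    and U: "open U" "s \<in> U"
    and eq: "\<And>n \<omega>. n > 0 \<Longrightarrow> S n \<omega> \<in> U \<Longrightarrow> T' n \<omega> = T n \<omega>"
  shows "tends_in_prob M T' c"
  unfolding tends_in_prob_def
proof (intro allI impI)
  interpret finite_measure M by fact
  fix e :: real assume "e > 0"
  obtain d where d: "d > 0" "ball s d \<subseteq> U"
    using U open_contains_ball by blast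
  define d' where "d' = min d (e / 2)"
  have d': "d' > 0" "d' \<le> d" "d' \<le> e / 2" using d \<open>e > 0\<close> by (auto simp: d'_def)
  have 1: "\<forall>\<^sub>F n in sequentially. \<exists>A\<in>sets M. measure M A < e / 2 \<and> (\<forall>\<omega>\<in>space M - A. dist (T n \<omega>) c < e / 2)"
    using T \<open>e > 0\<close> half_gt_zero unfolding tends_in_prob_def by blast
  have 2: "\<forall>\<^sub>F n in sequentially. \<exists>A\<in>sets M. measure M A < d' \<and> (\<forall>\<omega>\<in>space M - A. dist (S n \<omega>) s < d')"
    using S d' unfolding tends_in_prob_def by blast
  show "\<forall>\<^sub>F n in sequentially. \<exists>A\<in>sets M. measure M A < e \<and> (\<forall>\<omega>\<in>space M - A. dist (T' n \<omega>) c < e)"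
    using 1 2 eventually_gt_at_top[of 0]
  proof eventually_elim
    case (elim n)
    then obtain A B where A: "A \<in> sets M" "measure M A < e / 2" "\<And>\<omega>. \<omega> \<in> space M - A \<Longrightarrow> dist (T n \<omega>) c < e / 2"
      and B: "B \<in> sets M" "measure M B < d'" "\<And>\<omega>. \<omega> \<in> space M - B \<Longrightarrow> dist (S n \<omega>) s < d'"
      by blast
    show ?case
    proof (intro bexI conjI ballI)
      show "measure M (A \<union> B) < e"
        using measure_Un_le[OF A(1) B(1)] A(2) B(2) d'(3) by linarith
      fix \<omega> assume \<omega>: "\<omega> \<in> space M - (A \<union> B)"
      then have "S n \<omega> \<in> ball s d"
        using B(3)[of \<omega>] d'(2) by (auto simp: dist_commute)
      then have "T' n \<omega> = T n \<omega>" using eq elim(3) d(2) by blast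
      then show "dist (T' n \<omega>) c < e" using A(3)[of \<omega>] \<omega> \<open>e > 0\<close> by auto
    qed (use A B in auto)
  qed
qed

lemma tends_in_prob_cong:
  assumes "tends_in_prob M T c" "finite_measure M" "\<And>n \<omega>. n > 0 \<Longrightarrow> T' n \<omega> = T n \<omega>"
  shows "tends_in_prob M T' c"
  using tends_in_prob_cong_near[OF assms(1) assms(1) assms(2) open_UNIV] assms(3) by auto

lemma tends_in_prob_Pair:
  assumes "tends_in_prob M T c" "tends_in_prob M S s" "finite_measure M"
  shows "tends_in_prob M (\<lambda>n \<omega>. (T n \<omega>, S n \<omega>)) (c, s)"
  unfolding tends_in_prob_def
proof (intro allI impI)
  interpret finite_measure M by fact
  fix e :: real assume "e > 0"
  then have e2: "e / 2 > 0" by simp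
  have 1: "\<forall>\<^sub>F n in sequentially. \<exists>A\<in>sets M. measure M A < e / 2 \<and> (\<forall>\<omega>\<in>space M - A. dist (T n \<omega>) c < e / 2)"
    using assms(1) e2 unfolding tends_in_prob_def by blast
  have 2: "\<forall>\<^sub>F n in sequentially. \<exists>A\<in>sets M. measure M A < e / 2 \<and> (\<forall>\<omega>\<in>space M - A. dist (S n \<omega>) s < e / 2)"
    using assms(2) e2 unfolding tends_in_prob_def by blast
  show "\<forall>\<^sub>F n in sequentially. \<exists>A\<in>sets M. measure M A < e \<and> (\<forall>\<omega>\<in>space M - A. dist (T n \<omega>, S n \<omega>) (c, s) < e)"
    using 1 2
  proof eventually_elim
    case (elim n)
    then obtain A B where A: "A \<in> sets M" "measure M A < e / 2" "\<And>\<omega>. \<omega> \<in> space M - A \<Longrightarrow> dist (T n \<omega>) c < e / 2"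
      and B: "B \<in> sets M" "measure M B < e / 2" "\<And>\<omega>. \<omega> \<in> space M - B \<Longrightarrow> dist (S n \<omega>) s < e / 2"
      by blast
    show ?case
    proof (intro bexI conjI ballI)
      show "measure M (A \<union> B) < e"
        using measure_Un_le[OF A(1) B(1)] A(2) B(2) by linarith
      fix \<omega> assume \<omega>: "\<omega> \<in> space M - (A \<union> B)"
      have "dist (T n \<omega>, S n \<omega>) (c, s) \<le> dist (T n \<omega>) c + dist (S n \<omega>) s"
        unfolding dist_Pair_Pair by (rule sqrt_sum_squares_le_sum) auto
      also have "\<dots> < e" using A(3)[of \<omega>] B(3)[of \<omega>] \<omega> by auto
      finally show "dist (T n \<omega>, S n \<omega>) (c, s) < e" .
    qed (use A B in auto)
  qed
qed

lemma tends_in_prob_compose2: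
  assumes "tends_in_prob M T c" "tends_in_prob M S s" "finite_measure M"
    and "isCont (\<lambda>x. h (fst x) (snd x)) (c, s)"
  shows "tends_in_prob M (\<lambda>n \<omega>. h (T n \<omega>) (S n \<omega>)) (h c s)"
  using tends_in_prob_compose[OF tends_in_prob_Pair[OF assms(1-3)] assms(4)] by simp

lemma tends_in_prob_add:
  fixes c s :: "'b::real_normed_vector"
  assumes "tends_in_prob M T c" "tends_in_prob M S s" "finite_measure M"
  shows "tends_in_prob M (\<lambda>n \<omega>. T n \<omega> + S n \<omega>) (c + s)"
  by (rule tends_in_prob_compose2[OF assms]) (intro continuous_intros)

lemma tends_in_prob_diff:
  fixes c s :: "'b::real_normed_vector"
  assumes "tends_in_prob M T c" "tends_in_prob M S s" "finite_measure M"
  shows "tends_in_prob M (\<lambda>n \<omega>. T n \<omega> - S n \<omega>) (c - s)"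
  by (rule tends_in_prob_compose2[OF assms]) (intro continuous_intros)

lemma (in bounded_bilinear) tends_in_prob_prod:
  assumes "tends_in_prob M T c" "tends_in_prob M S s" "finite_measure M"
  shows "tends_in_prob M (\<lambda>n \<omega>. prod (T n \<omega>) (S n \<omega>)) (prod c s)"
  by (rule tends_in_prob_compose2[OF assms]) (intro continuous continuous_intros)

text \<open>The Slutsky step for remainders. The second factor has no limit in probability, only a
  limit in law, so the continuous mapping argument does not apply and boundedness in probability
  takes its place.\<close>

lemma (in bounded_bilinear) tends_in_prob_zero_prod_bounded:
  assumes "tends_in_prob M T 0" "bounded_in_prob M S" "finite_measure M"
  shows "tends_in_prob M (\<lambda>n \<omega>. prod (T n \<omega>) (S n \<omega>)) 0"
  unfolding tends_in_prob_def
proof (intro allI impI)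
  interpret finite_measure M by fact
  fix e :: real assume "e > 0"
  then have e2: "e / 2 > 0" by simp
  obtain K where K: "\<forall>\<^sub>F n in sequentially. \<exists>A\<in>sets M. measure M A < e / 2 \<and> (\<forall>\<omega>\<in>space M - A. norm (S n \<omega>) \<le> K)"
    using assms(2) e2 unfolding bounded_in_prob_def by blast
  obtain C where C: "C > 0" "\<And>a b. norm (prod a b) \<le> norm a * norm b * C"
    using pos_bounded by blast
  \<comment> \<open>The second bound keeps the product below \<open>e\<close>. Adding 1 to the
    absolute value of \<open>K\<close> keeps the denominator positive and the final inequality
    strict.\<close>
  define d where "d = min (e / 2) (e / ((\<bar>K\<bar> + 1) * C))"
  have d: "d > 0" "d \<le> e / 2" "d * ((\<bar>K\<bar> + 1) * C) \<le> e"
  proof -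
    have "(\<bar>K\<bar> + 1) * C > 0" using C(1) by (intro mult_pos_pos) auto
    then show "d > 0" "d * ((\<bar>K\<bar> + 1) * C) \<le> e"
      using \<open>e > 0\<close> by (simp add: d_def, subst pos_le_divide_eq[symmetric]) (auto simp: d_def)
    show "d \<le> e / 2" unfolding d_def by (rule min.cobounded1)
  qed
  have "\<forall>\<^sub>F n in sequentially. \<exists>A\<in>sets M. measure M A < d \<and> (\<forall>\<omega>\<in>space M - A. dist (T n \<omega>) 0 < d)"
    using assms(1) d(1) unfolding tends_in_prob_def by blast
  with K show "\<forall>\<^sub>F n in sequentially. \<exists>A\<in>sets M. measure M A < e \<and> (\<forall>\<omega>\<in>space M - A. dist (prod (T n \<omega>) (S n \<omega>)) 0 < e)"
  proof eventually_elim
    case (elim n)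
    then obtain A B where A: "A \<in> sets M" "measure M A < e / 2" "\<And>\<omega>. \<omega> \<in> space M - A \<Longrightarrow> norm (S n \<omega>) \<le> K"
      and B: "B \<in> sets M" "measure M B < d" "\<And>\<omega>. \<omega> \<in> space M - B \<Longrightarrow> dist (T n \<omega>) 0 < d"
      by blast
    show ?case
    proof (intro bexI conjI ballI)
      show "measure M (A \<union> B) < e"
        using measure_Un_le[OF A(1) B(1)] A(2) B(2) d(2) by linarith
      fix \<omega> assume \<omega>: "\<omega> \<in> space M - (A \<union> B)"
      have 1: "norm (T n \<omega>) < d" "norm (S n \<omega>) \<le> \<bar>K\<bar>" using A(3)[of \<omega>] B(3)[of \<omega>] \<omega> by auto
      have "norm (prod (T n \<omega>) (S n \<omega>)) \<le> norm (T n \<omega>) * (norm (S n \<omega>) * C)"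
        using C(2)[of "T n \<omega>" "S n \<omega>"] by (simp add: mult.assoc)
      also have "\<dots> \<le> d * (\<bar>K\<bar> * C)"
        using 1 C(1) d(1) by (intro mult_mono mult_right_mono) auto
      also have "\<dots> < d * ((\<bar>K\<bar> + 1) * C)"
        using C(1) d(1) by (simp add: distrib_right)
      finally show "dist (prod (T n \<omega>) (S n \<omega>)) 0 < e" using d(3) by simp
    qed (use A B in auto)
  qed
qed

lemma tends_in_prob_componentwise:
  fixes c :: "'b::euclidean_space"
  assumes "finite_measure M" and comp: "\<And>b. b \<in> Basis \<Longrightarrow> tends_in_prob M (\<lambda>n \<omega>. T n \<omega> \<bullet> b) (c \<bullet> b)"
  shows "tends_in_prob M T c"
  unfolding tends_in_prob_def
proof (intro allI impI)
  interpret finite_measure M by fact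
  fix e :: real assume "e > 0"
  \<comment> \<open>The tolerance is shared among the coordinates twice: in the union bound for the
    exceptional sets and in the bound of the norm by the sum of the coordinates.\<close>
  define d where "d = e / (real DIM('b))"
  have "d > 0" using \<open>e > 0\<close> by (simp add: d_def)
  have "\<forall>\<^sub>F n in sequentially. \<forall>b\<in>Basis. \<exists>A\<in>sets M. measure M A < d \<and> (\<forall>\<omega>\<in>space M - A. dist (T n \<omega> \<bullet> b) (c \<bullet> b) < d)"
    using comp \<open>d > 0\<close> unfolding tends_in_prob_def by (intro eventually_ball_finite) auto
  then show "\<forall>\<^sub>F n in sequentially. \<exists>A\<in>sets M. measure M A < e \<and> (\<forall>\<omega>\<in>space M - A. dist (T n \<omega>) c < e)"
  proof eventually_elim
    case (elim n)
    then obtain A where A: "\<And>b. b \<in> Basis \<Longrightarrow> A b \<in> sets M" "\<And>b. b \<in> Basis \<Longrightarrow> measure M (A b) < d"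
      "\<And>b \<omega>. b \<in> Basis \<Longrightarrow> \<omega> \<in> space M - A b \<Longrightarrow> dist (T n \<omega> \<bullet> b) (c \<bullet> b) < d"
      by metis
    show ?case
    proof (intro bexI conjI ballI)
      have "measure M (\<Union>b\<in>Basis. A b) \<le> (\<Sum>b\<in>Basis. measure M (A b))"
        using A by (intro finite_measure_subadditive_finite) auto
      also have "\<dots> < (\<Sum>b\<in>(Basis :: 'b set). d)" using A by (intro sum_strict_mono) auto
      also have "\<dots> = e" by (simp add: d_def)
      finally show "measure M (\<Union>b\<in>Basis. A b) < e" .
      fix \<omega> assume \<omega>: "\<omega> \<in> space M - (\<Union>b\<in>Basis. A b)"
      have "dist (T n \<omega>) c \<le> (\<Sum>b\<in>Basis. \<bar>(T n \<omega> - c) \<bullet> b\<bar>)"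
        unfolding dist_norm by (rule norm_le_l1)
      also have "\<dots> < (\<Sum>b\<in>(Basis :: 'b set). d)"
        using A(3) \<omega> by (intro sum_strict_mono) (auto simp: dist_real_def inner_diff_left)
      also have "\<dots> = e" by (simp add: d_def)
      finally show "dist (T n \<omega>) c < e" .
    qed (use A in auto)
  qed
qed

lemma bounded_in_prob_near:
  assumes Z: "bounded_in_prob M Z" and diff: "tends_in_prob M (\<lambda>n \<omega>. T n \<omega> - Z n \<omega>) 0" and "finite_measure M"
  shows "bounded_in_prob M T"
  unfolding bounded_in_prob_def
proof (intro allI impI)
  interpret finite_measure M by fact
  fix e :: real assume "e > 0"
  then have e2: "e / 2 > 0" by simp
  obtain K where K: "\<forall>\<^sub>F n in sequentially. \<exists>A\<in>sets M. measure M A < e / 2 \<and> (\<forall>\<omega>\<in>space M - A. norm (Z n \<omega>) \<le> K)"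
    using Z e2 unfolding bounded_in_prob_def by blast
  have "\<forall>\<^sub>F n in sequentially. \<exists>A\<in>sets M. measure M A < e / 2 \<and> (\<forall>\<omega>\<in>space M - A. dist (T n \<omega> - Z n \<omega>) 0 < e / 2)"
    using diff e2 unfolding tends_in_prob_def by blast
  with K have "\<forall>\<^sub>F n in sequentially. \<exists>A\<in>sets M. measure M A < e \<and> (\<forall>\<omega>\<in>space M - A. norm (T n \<omega>) \<le> K + e / 2)"
  proof eventually_elim
    case (elim n)
    then obtain A B where A: "A \<in> sets M" "measure M A < e / 2" "\<And>\<omega>. \<omega> \<in> space M - A \<Longrightarrow> norm (Z n \<omega>) \<le> K"
      and B: "B \<in> sets M" "measure M B < e / 2" "\<And>\<omega>. \<omega> \<in> space M - B \<Longrightarrow> dist (T n \<omega> - Z n \<omega>) 0 < e / 2"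
      by blast
    show ?case
    proof (intro bexI conjI ballI)
      show "measure M (A \<union> B) < e"
        using measure_Un_le[OF A(1) B(1)] A(2) B(2) by linarith
      fix \<omega> assume \<omega>: "\<omega> \<in> space M - (A \<union> B)"
      then show "norm (T n \<omega>) \<le> K + e / 2"
        using A(3)[of \<omega>] B(3)[of \<omega>] norm_triangle_sub[of "T n \<omega>" "Z n \<omega>"] by auto
    qed (use A B in auto)
  qed
  then show "\<exists>K. \<forall>\<^sub>F n in sequentially. \<exists>A\<in>sets M. measure M A < e \<and> (\<forall>\<omega>\<in>space M - A. norm (T n \<omega>) \<le> K)"
    by blast
qed

lemma bounded_in_prob_bounded_linear:
  assumes Z: "bounded_in_prob M Z" and "bounded_linear f"
  shows "bounded_in_prob M (\<lambda>n \<omega>. f (Z n \<omega>))"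
  unfolding bounded_in_prob_def
proof (intro allI impI)
  obtain C where C: "C \<ge> 0" "\<And>x. norm (f x) \<le> norm x * C"
    using bounded_linear.nonneg_bounded[OF assms(2)] by blast
  fix e :: real assume "e > 0"
  then obtain K where K: "\<forall>\<^sub>F n in sequentially. \<exists>A\<in>sets M. measure M A < e \<and> (\<forall>\<omega>\<in>space M - A. norm (Z n \<omega>) \<le> K)"
    using Z unfolding bounded_in_prob_def by blast
  have "norm (f x) \<le> K * C" if "norm x \<le> K" for x
    using C(2)[of x] mult_right_mono[OF that C(1)] by linarith
  with K have "\<forall>\<^sub>F n in sequentially. \<exists>A\<in>sets M. measure M A < e \<and> (\<forall>\<omega>\<in>space M - A. norm (f (Z n \<omega>)) \<le> K * C)"
    by (elim eventually_mono) blast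
  then show "\<exists>K. \<forall>\<^sub>F n in sequentially. \<exists>A\<in>sets M. measure M A < e \<and> (\<forall>\<omega>\<in>space M - A. norm (f (Z n \<omega>)) \<le> K)"
    by blast
qed

section \<open>Boundedness from second moments, and cosines of nearby variables\<close>

lemma (in prob_space) bounded_in_prob_second_moment:
  fixes Z :: "nat \<Rightarrow> 'a \<Rightarrow> 'b::euclidean_space"
  assumes [measurable]: "\<And>n. Z n \<in> borel_measurable M"
    and int: "\<And>n. integrable M (\<lambda>\<omega>. (norm (Z n \<omega>))\<^sup>2)"
    and le: "\<And>n. expectation (\<lambda>\<omega>. (norm (Z n \<omega>))\<^sup>2) \<le> C"
  shows "bounded_in_prob M Z"
  unfolding bounded_in_prob_def
proof (intro allI impI)
  fix e :: real assume "e > 0"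
  have "C \<ge> 0" using le[of 0] by (rule order_trans[rotated]) simp
  \<comment> \<open>Solves the Chebyshev bound \<open>C / K\<^sup>2 < e\<close>;
    \<open>C + 1\<close> keeps \<open>K\<close> positive for \<open>C = 0\<close>.\<close>
  define K where "K = sqrt (2 * (C + 1) / e)"
  have K: "K\<^sup>2 = 2 * (C + 1) / e" "K \<ge> 0" using \<open>C \<ge> 0\<close> \<open>e > 0\<close> by (auto simp: K_def)
  have "\<exists>A\<in>sets M. prob A < e \<and> (\<forall>\<omega>\<in>space M - A. norm (Z n \<omega>) \<le> K)" for n
  proof (intro bexI conjI ballI)
    have "prob {\<omega> \<in> space M. (norm (Z n \<omega>))\<^sup>2 \<ge> K\<^sup>2} \<le> expectation (\<lambda>\<omega>. (norm (Z n \<omega>))\<^sup>2) / K\<^sup>2"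
      using int K \<open>C \<ge> 0\<close> \<open>e > 0\<close> by (intro integral_Markov_inequality_measure[of _ _ "{}"]) auto
    also have "\<dots> \<le> C / K\<^sup>2" using le by (intro divide_right_mono) auto
    also have "\<dots> < e"
      using \<open>C \<ge> 0\<close> \<open>e > 0\<close> mult_right_mono[of 0 C e] unfolding K by (simp add: divide_less_eq)
    finally show "prob {\<omega> \<in> space M. (norm (Z n \<omega>))\<^sup>2 \<ge> K\<^sup>2} < e" .
    fix \<omega> assume "\<omega> \<in> space M - {\<omega> \<in> space M. (norm (Z n \<omega>))\<^sup>2 \<ge> K\<^sup>2}"
    then show "norm (Z n \<omega>) \<le> K"
      using power_mono[of K "norm (Z n \<omega>)" 2] K(2) by auto
  qed measurable
  then show "\<exists>K. \<forall>\<^sub>F n in sequentially. \<exists>A\<in>sets M. prob A < e \<and> (\<forall>\<omega>\<in>space M - A. norm (Z n \<omega>) \<le> K)"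
    by (intro exI[of _ K] always_eventually) auto
qed

lemma abs_cos_diff_le: "\<bar>cos a - cos b\<bar> \<le> \<bar>a - b\<bar>" for a b :: real
proof -
  have "cos a - cos b = 2 * sin ((a + b) / 2) * sin ((b - a) / 2)"
    by (rule cos_diff_cos)
  then have "\<bar>cos a - cos b\<bar> = 2 * \<bar>sin ((a + b) / 2)\<bar> * \<bar>sin ((b - a) / 2)\<bar>"
    by (simp add: abs_mult)
  also have "\<dots> \<le> 2 * 1 * \<bar>(b - a) / 2\<bar>"
    by (intro mult_mono abs_sin_x_le_abs_x) auto
  finally show ?thesis by (simp add: abs_minus_commute)
qed

lemma (in prob_space) expectation_cos_near:
  fixes T Z :: "nat \<Rightarrow> 'a \<Rightarrow> 'b::euclidean_space"
  assumes [measurable]: "\<And>n. T n \<in> borel_measurable M" "\<And>n. Z n \<in> borel_measurable M"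
    and diff: "tends_in_prob M (\<lambda>n \<omega>. T n \<omega> - Z n \<omega>) 0"
    and lim: "(\<lambda>n. expectation (\<lambda>\<omega>. cos (v \<bullet> Z n \<omega> + c))) \<longlonglongrightarrow> L"
  shows "(\<lambda>n. expectation (\<lambda>\<omega>. cos (v \<bullet> T n \<omega> + c))) \<longlonglongrightarrow> L"
proof (rule Lim_transform2[OF lim])
  show "(\<lambda>n. expectation (\<lambda>\<omega>. cos (v \<bullet> Z n \<omega> + c)) - expectation (\<lambda>\<omega>. cos (v \<bullet> T n \<omega> + c))) \<longlonglongrightarrow> 0"
    unfolding tendsto_iff dist_real_def diff_0_right
  proof (intro allI impI)
    fix e :: real assume "e > 0"
    \<comment> \<open>The Lipschitz bound for the cosine contributes \<open>norm v * d\<close>, the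
      exceptional set contributes \<open>2 * d\<close>, and one further \<open>d\<close> makes the
      estimate strict.\<close>
    define d where "d = e / (norm v + 3)"
    have "d > 0" using \<open>e > 0\<close> by (simp add: d_def add_nonneg_pos)
    then have "\<forall>\<^sub>F n in sequentially. \<exists>A\<in>sets M. prob A < d \<and> (\<forall>\<omega>\<in>space M - A. dist (T n \<omega> - Z n \<omega>) 0 < d)"
      using diff unfolding tends_in_prob_def by blast
    then show "\<forall>\<^sub>F n in sequentially. \<bar>expectation (\<lambda>\<omega>. cos (v \<bullet> Z n \<omega> + c)) - expectation (\<lambda>\<omega>. cos (v \<bullet> T n \<omega> + c))\<bar> < e"
    proof eventually_elim
      case (elim n)
      then obtain A where A: "A \<in> sets M" "prob A < d" "\<And>\<omega>. \<omega> \<in> space M - A \<Longrightarrow> norm (T n \<omega> - Z n \<omega>) < d"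
        by auto
      have "\<bar>expectation (\<lambda>\<omega>. cos (v \<bullet> Z n \<omega> + c)) - expectation (\<lambda>\<omega>. cos (v \<bullet> T n \<omega> + c))\<bar> \<le> norm v * d + 2 * d"
      proof (rule expectation_diff_le[where A=A and F=1 and G=1])
        show "\<bar>cos (v \<bullet> Z n \<omega> + c) - cos (v \<bullet> T n \<omega> + c)\<bar> \<le> 2" for \<omega>
          using abs_cos_le_one[of "v \<bullet> Z n \<omega> + c"] abs_cos_le_one[of "v \<bullet> T n \<omega> + c"] by linarith
        fix \<omega> assume \<omega>: "\<omega> \<in> space M - A"
        have "\<bar>cos (v \<bullet> Z n \<omega> + c) - cos (v \<bullet> T n \<omega> + c)\<bar> \<le> \<bar>v \<bullet> Z n \<omega> + c - (v \<bullet> T n \<omega> + c)\<bar>"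
          by (rule abs_cos_diff_le)
        also have "\<dots> = \<bar>v \<bullet> (T n \<omega> - Z n \<omega>)\<bar>" by (simp add: inner_diff_right)
        also have "\<dots> \<le> norm v * norm (T n \<omega> - Z n \<omega>)" by (rule Cauchy_Schwarz_ineq2)
        also have "\<dots> \<le> norm v * d" using A(3)[OF \<omega>] by (intro mult_left_mono) auto
        finally show "\<bar>cos (v \<bullet> Z n \<omega> + c) - cos (v \<bullet> T n \<omega> + c)\<bar> \<le> norm v * d" .
      qed (use A \<open>d > 0\<close> in auto)
      also have "\<dots> < (norm v + 3) * d" using \<open>d > 0\<close> by (simp add: distrib_right)
      also have "\<dots> = e"
      proof -
        have "norm v + 3 > 0" by (simp add: add_nonneg_pos)
        then show ?thesis by (simp add: d_def)
      qed
      finally show ?case .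
    qed
  qed
qed

section \<open>Limit theorems for samples\<close>

locale iid_sample = prob_space M for M :: "'b measure" +
  fixes W :: "nat \<Rightarrow> 'b \<Rightarrow> 'z::topological_space" and Q :: "'z measure"
  assumes indep: "indep_vars (\<lambda>_. borel) W UNIV"
    and law: "\<And>i. distr M borel (W i) = Q"
begin

lemma W_measurable [measurable]: "W i \<in> borel_measurable M"
  using indep unfolding indep_vars_def2 by auto

lemma prob_space_law: "prob_space Q"
  unfolding law[of 0, symmetric] by (rule prob_space_distr) measurable

lemma sets_law [measurable_cong]: "sets Q = sets borel"
  unfolding law[of 0, symmetric] by simp

lemma
  fixes g :: "'z \<Rightarrow> 'c::{banach, second_countable_topology}"
  assumes g: "g \<in> borel_measurable borel"
  shows expectation_W: "expectation (\<lambda>\<omega>. g (W i \<omega>)) = (LINT z|Q. g z)"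
    and integrable_W: "integrable M (\<lambda>\<omega>. g (W i \<omega>)) \<longleftrightarrow> integrable Q g"
  unfolding law[of i, symmetric] using g by (simp_all add: integral_distr integrable_distr_eq)

text \<open>Independent centered summands are orthogonal, so only the diagonal of the double sum
  survives. The linear growth in \<open>n\<close> is what the scaling by sqrt n cancels.\<close>

lemma second_moment_sum:
  fixes g :: "'z \<Rightarrow> real"
  assumes g [measurable]: "g \<in> borel_measurable borel"
    and sq: "integrable Q (\<lambda>z. (g z)\<^sup>2)" and mean: "(LINT z|Q. g z) = 0"
  shows "integrable M (\<lambda>\<omega>. (\<Sum>i<n. g (W i \<omega>))\<^sup>2)"
    and "expectation (\<lambda>\<omega>. (\<Sum>i<n. g (W i \<omega>))\<^sup>2) = real n * (LINT z|Q. (g z)\<^sup>2)"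
proof -
  interpret Q: prob_space Q by (rule prob_space_law)
  have sq_M: "integrable M (\<lambda>\<omega>. (g (W i \<omega>))\<^sup>2)" for i
    using integrable_W[of "\<lambda>z. (g z)\<^sup>2" i] sq by simp
  have int: "integrable M (\<lambda>\<omega>. g (W i \<omega>) * g (W j \<omega>))" for i j
    using sq_M by (intro integrable_mult_of_squares) auto
  have int1: "integrable M (\<lambda>\<omega>. g (W i \<omega>))" for i
    by (rule square_integrable_imp_integrable[OF _ sq_M]) measurable
  have indep_g: "indep_vars (\<lambda>_. borel) (\<lambda>i \<omega>. g (W i \<omega>)) UNIV"
    by (rule indep_vars_compose2[OF indep]) measurable
  have cross: "expectation (\<lambda>\<omega>. g (W i \<omega>) * g (W j \<omega>)) = (if i = j then (LINT z|Q. (g z)\<^sup>2) else 0)" for i j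
  proof (cases "i = j")
    case True
    then show ?thesis using expectation_W[of "\<lambda>z. (g z)\<^sup>2" i] by (simp add: power2_eq_square)
  next
    case False
    have "expectation (\<lambda>\<omega>. \<Prod>k\<in>{i, j}. g (W k \<omega>)) = (\<Prod>k\<in>{i, j}. expectation (\<lambda>\<omega>. g (W k \<omega>)))"
      by (rule indep_vars_lebesgue_integral) (use int1 indep_vars_subset[OF indep_g] in auto)
    then show ?thesis using False mean expectation_W[OF g] by simp
  qed
  have eq: "(\<lambda>\<omega>. (\<Sum>i<n. g (W i \<omega>))\<^sup>2) = (\<lambda>\<omega>. \<Sum>i<n. \<Sum>j<n. g (W i \<omega>) * g (W j \<omega>))"
    by (simp add: power2_eq_square sum_product)
  show "integrable M (\<lambda>\<omega>. (\<Sum>i<n. g (W i \<omega>))\<^sup>2)"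
    unfolding eq using int by auto
  show "expectation (\<lambda>\<omega>. (\<Sum>i<n. g (W i \<omega>))\<^sup>2) = real n * (LINT z|Q. (g z)\<^sup>2)"
    unfolding eq using int cross by simp
qed

text \<open>Only a first moment is available, so the summands are truncated; the truncation error is
  small in mean, and the truncated average has a variance of order \<open>1 / n\<close>.\<close>

lemma weak_law_real:
  fixes g :: "'z \<Rightarrow> real"
  assumes g [measurable]: "g \<in> borel_measurable borel" and int: "integrable Q g"
  shows "tends_in_prob M (\<lambda>n \<omega>. (\<Sum>i<n. g (W i \<omega>)) / real n) (LINT z|Q. g z)"
  unfolding tends_in_prob_def
proof (intro allI impI)
  interpret Q: prob_space Q by (rule prob_space_law)
  fix e :: real assume "e > 0"
  define m where "m = (LINT z|Q. g z)"
  \<comment> \<open>Three error contributions of size \<open>d\<close> enter the final Markov bound,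
    and \<open>3 * d / e\<close> is three quarters of \<open>e\<close>.\<close>
  define d where "d = e\<^sup>2 / 4"
  have "d > 0" using \<open>e > 0\<close> by (simp add: d_def)
  define h where "h k z = (if \<bar>g z\<bar> \<le> real k then g z else 0)" for k :: nat and z
  have [measurable]: "h k \<in> borel_measurable borel" for k unfolding h_def by measurable
  have "(\<lambda>k. LINT z|Q. \<bar>g z - h k z\<bar>) \<longlonglongrightarrow> (LINT z|Q. 0)"
  proof (rule integral_dominated_convergence[where w="\<lambda>z. \<bar>g z\<bar>"])
    have "(\<lambda>k. \<bar>g z - h k z\<bar>) \<longlonglongrightarrow> 0" for z
    proof (rule tendsto_eventually)
      obtain N :: nat where "\<bar>g z\<bar> \<le> real N" using real_arch_simple by blast
      then show "\<forall>\<^sub>F k in sequentially. \<bar>g z - h k z\<bar> = 0"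
        by (intro eventually_sequentiallyI[of N]) (auto simp: h_def)
    qed
    then show "AE z in Q. (\<lambda>k. \<bar>g z - h k z\<bar>) \<longlonglongrightarrow> 0" by simp
  qed (use int in \<open>auto simp: h_def\<close>)
  then have "\<forall>\<^sub>F k in sequentially. (LINT z|Q. \<bar>g z - h k z\<bar>) < d"
    using \<open>d > 0\<close> by (intro order_tendstoD(2)) auto
  then obtain k where k: "(LINT z|Q. \<bar>g z - h k z\<bar>) < d"
    using eventually_happens'[OF sequentially_bot] by blast
  define mk where "mk = (LINT z|Q. h k z)"
  have h_bd: "\<bar>h k z\<bar> \<le> real k" for z by (auto simp: h_def)
  then have int_h: "integrable Q (h k)"
    by (intro Q.integrable_const_bound[where B="real k"]) auto
  have int_sq: "integrable Q (\<lambda>z. (h k z - mk)\<^sup>2)"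
  proof (rule Q.integrable_const_bound[where B="(real k + \<bar>mk\<bar>)\<^sup>2"])
    have "\<bar>h k z - mk\<bar> \<le> real k + \<bar>mk\<bar>" for z using h_bd[of z] by linarith
    then have "(h k z - mk)\<^sup>2 \<le> (real k + \<bar>mk\<bar>)\<^sup>2" for z
      by (rule power2_le_iff_abs_le[THEN iffD2, rotated]) simp
    then show "AE z in Q. norm ((h k z - mk)\<^sup>2) \<le> (real k + \<bar>mk\<bar>)\<^sup>2" by simp
  qed measurable
  define C where "C = (LINT z|Q. (h k z - mk)\<^sup>2)"
  have mean0: "(LINT z|Q. h k z - mk) = 0"
    using int_h by (simp add: mk_def Q.prob_space)
  have mk_near: "\<bar>mk - m\<bar> \<le> d"
  proof -
    have "\<bar>mk - m\<bar> = \<bar>LINT z|Q. g z - h k z\<bar>"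
      using int int_h by (simp add: mk_def m_def abs_minus_commute)
    also have "\<dots> \<le> (LINT z|Q. \<bar>g z - h k z\<bar>)" by (rule integral_abs_bound)
    finally show ?thesis using k by simp
  qed
  let ?r = "\<lambda>n \<omega>. (\<Sum>i<n. \<bar>g (W i \<omega>) - h k (W i \<omega>)\<bar>) / real n"
  let ?s = "\<lambda>n \<omega>. \<bar>\<Sum>i<n. h k (W i \<omega>) - mk\<bar> / real n"
  let ?q = "\<lambda>n \<omega>. (\<Sum>i<n. h k (W i \<omega>) - mk)\<^sup>2 / (real n)\<^sup>2"
  have split: "\<bar>(\<Sum>i<n. g (W i \<omega>)) / real n - m\<bar> \<le> ?r n \<omega> + (?q n \<omega> / d + d) / 2 + d" if "n > 0" for n \<omega>
  proof -
    have "(\<Sum>i<n. g (W i \<omega>)) / real n - m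
        = (\<Sum>i<n. g (W i \<omega>) - h k (W i \<omega>)) / real n + (\<Sum>i<n. h k (W i \<omega>) - mk) / real n + (mk - m)"
      using that by (simp add: sum_subtractf field_simps)
    also have "\<bar>\<dots>\<bar> \<le> ?r n \<omega> + ?s n \<omega> + \<bar>mk - m\<bar>"
    proof -
      have "\<bar>(\<Sum>i<n. g (W i \<omega>) - h k (W i \<omega>)) / real n\<bar> \<le> ?r n \<omega>"
        by (simp add: divide_right_mono)
      moreover have "\<bar>(\<Sum>i<n. h k (W i \<omega>) - mk) / real n\<bar> = ?s n \<omega>" by simp
      ultimately show ?thesis by linarith
    qed
    \<comment> \<open>The truncated average is controlled by its second moment. The inequality of
      arithmetic and geometric means replaces its absolute value by its square over
      \<open>d\<close>, whose mean drops below \<open>d\<close> once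
      \<open>C / real n < d\<^sup>2\<close>.\<close>
    also have "?s n \<omega> \<le> (?q n \<omega> / d + d) / 2"
    proof -
      have "2 * (?s n \<omega> / sqrt d) * sqrt d \<le> (?s n \<omega> / sqrt d)\<^sup>2 + (sqrt d)\<^sup>2"
        by (rule sum_squares_bound)
      then show ?thesis using \<open>d > 0\<close> by (simp add: power_divide power_mult_distrib mult.commute)
    qed
    finally show ?thesis using mk_near by linarith
  qed
  have r: "integrable M (?r n)" "expectation (?r n) \<le> d" if "n > 0" for n
  proof -
    have 1: "integrable M (\<lambda>\<omega>. \<bar>g (W i \<omega>) - h k (W i \<omega>)\<bar>)" for i
      using integrable_W[of "\<lambda>z. \<bar>g z - h k z\<bar>" i] int int_h by auto
    then show "integrable M (?r n)" by auto
    have "expectation (?r n) = (LINT z|Q. \<bar>g z - h k z\<bar>)"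
      using 1 expectation_W[of "\<lambda>z. \<bar>g z - h k z\<bar>"] that by simp
    then show "expectation (?r n) \<le> d" using k by simp
  qed
  have q: "integrable M (?q n)" "expectation (?q n) = C / real n" if "n > 0" for n
    using second_moment_sum[of "\<lambda>z. h k z - mk" n] int_sq mean0 that
    by (auto simp: C_def power2_eq_square)
  have "(\<lambda>n. C / real n) \<longlonglongrightarrow> 0" by (rule lim_const_over_n)
  then have "\<forall>\<^sub>F n in sequentially. C / real n < d\<^sup>2"
    using \<open>d > 0\<close> by (intro order_tendstoD(2)) auto
  then show "\<forall>\<^sub>F n in sequentially. \<exists>A\<in>sets M. prob A < e \<and>
      (\<forall>\<omega>\<in>space M - A. dist ((\<Sum>i<n. g (W i \<omega>)) / real n) (LINT z|Q. g z) < e)"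
    using eventually_gt_at_top[of 0]
  proof eventually_elim
    case (elim n)
    define R where "R = ?r n"
    define S where "S = ?q n"
    note R = r[OF elim(2), folded R_def] and S = q[OF elim(2), folded S_def]
    let ?u = "\<lambda>\<omega>. R \<omega> + (S \<omega> / d + d) / 2 + d"
    have int_u: "integrable M ?u" using R(1) S(1) by simp
    show ?case
    proof (intro bexI conjI ballI)
      have "prob {\<omega> \<in> space M. ?u \<omega> \<ge> e} \<le> expectation ?u / e"
      proof (rule integral_Markov_inequality_measure[OF int_u, of "{}"])
        have "?u \<omega> \<ge> 0" for \<omega> using \<open>d > 0\<close> unfolding R_def S_def
          by (intro add_nonneg_nonneg divide_nonneg_nonneg sum_nonneg) auto
        then show "AE \<omega> in M. 0 \<le> ?u \<omega>" by simp
      qed (use \<open>e > 0\<close> in auto)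
      also have "expectation ?u = expectation R + (C / real n / d + d) / 2 + d"
        using R(1) S by (simp add: prob_space)
      also have "\<dots> < 3 * d"
      proof -
        have "C / real n / d < d"
          using elim \<open>d > 0\<close> by (simp add: pos_divide_less_eq power2_eq_square ac_simps)
        moreover have "x + (c + d) / 2 + d < 3 * d" if "x \<le> d" "c < d" for x c :: real
          using that by (simp add: field_simps)
        ultimately show ?thesis using R(2) by blast
      qed
      also have "3 * d / e < e" using \<open>e > 0\<close> by (simp add: d_def power2_eq_square)
      finally show "prob {\<omega> \<in> space M. ?u \<omega> \<ge> e} < e"
        using \<open>e > 0\<close> by (simp add: divide_strict_right_mono)
      fix \<omega> assume "\<omega> \<in> space M - {\<omega> \<in> space M. ?u \<omega> \<ge> e}"
      then have "?u \<omega> < e" by auto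
      with split[OF elim(2), of \<omega>, folded m_def] show "dist ((\<Sum>i<n. g (W i \<omega>)) / real n) (LINT z|Q. g z) < e"
        unfolding dist_real_def m_def[symmetric] R_def S_def by (rule le_less_trans)
    qed (use int_u in measurable)
  qed
qed

lemma weak_law:
  fixes g :: "'z \<Rightarrow> 'c::euclidean_space"
  assumes g [measurable]: "g \<in> borel_measurable borel" and int: "integrable Q g"
  shows "tends_in_prob M (\<lambda>n \<omega>. sample_mean n (\<lambda>i. g (W i \<omega>))) (LINT z|Q. g z)"
proof (rule tends_in_prob_componentwise)
  show "tends_in_prob M (\<lambda>n \<omega>. sample_mean n (\<lambda>i. g (W i \<omega>)) \<bullet> b) ((LINT z|Q. g z) \<bullet> b)" for b
    using weak_law_real[of "\<lambda>z. g z \<bullet> b"] int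
    by (simp add: sample_mean_def inner_sum_left inverse_eq_divide)
qed unfold_locales

end

locale centered_iid_sample = iid_sample M W Q
  for M :: "'b measure" and W :: "nat \<Rightarrow> 'b \<Rightarrow> 'z::topological_space" and Q +
  fixes \<zeta> :: "'z \<Rightarrow> 'c::euclidean_space"
  assumes \<zeta>_measurable [measurable]: "\<zeta> \<in> borel_measurable borel"
    and \<zeta>_square_integrable: "integrable Q (\<lambda>z. (norm (\<zeta> z))\<^sup>2)"
    and \<zeta>_centered: "(LINT z|Q. \<zeta> z) = 0"
begin

definition root_n_mean :: "nat \<Rightarrow> 'b \<Rightarrow> 'c" where
  "root_n_mean n \<omega> = (\<Sum>i<n. \<zeta> (W i \<omega>)) /\<^sub>R sqrt (real n)"

lemma root_n_mean_measurable [measurable]: "root_n_mean n \<in> borel_measurable M"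
  unfolding root_n_mean_def by measurable

lemma \<zeta>_inner_square_integrable: "integrable Q (\<lambda>z. (v \<bullet> \<zeta> z)\<^sup>2)"
  by (rule integrable_inner_square[OF _ \<zeta>_square_integrable]) measurable

lemma \<zeta>_integrable: "integrable Q \<zeta>"
proof -
  interpret Q: prob_space Q by (rule prob_space_law)
  have "integrable Q (\<lambda>z. norm (\<zeta> z))"
    by (rule Q.square_integrable_imp_integrable) (use \<zeta>_square_integrable in auto)
  then show ?thesis by (subst (asm) integrable_norm_iff) auto
qed

lemma \<zeta>_inner_centered: "(LINT z|Q. v \<bullet> \<zeta> z) = 0"
  using \<zeta>_integrable \<zeta>_centered by simp

text \<open>After scaling, the second moment of each coordinate is the same for all
  \<open>n > 0\<close>; for \<open>n = 0\<close> the sum is empty.\<close>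

lemma bounded_in_prob_root_n_mean: "bounded_in_prob M root_n_mean"
proof (rule bounded_in_prob_second_moment)
  have eq: "(norm (root_n_mean n \<omega>))\<^sup>2 = (\<Sum>b\<in>Basis. (\<Sum>i<n. b \<bullet> \<zeta> (W i \<omega>))\<^sup>2 / real n)" for n \<omega>
    unfolding power2_norm_eq_inner euclidean_inner[of "root_n_mean n \<omega>" "root_n_mean n \<omega>"]
    by (intro sum.cong refl)
      (simp add: root_n_mean_def inner_sum_right inner_commute power_divide field_simps flip: power2_eq_square)
  note mom = second_moment_sum[OF _ \<zeta>_inner_square_integrable \<zeta>_inner_centered]
  show "integrable M (\<lambda>\<omega>. (norm (root_n_mean n \<omega>))\<^sup>2)" for n
    unfolding eq using mom(1) by auto
  show "expectation (\<lambda>\<omega>. (norm (root_n_mean n \<omega>))\<^sup>2) \<le> (\<Sum>b\<in>Basis. LINT z|Q. (b \<bullet> \<zeta> z)\<^sup>2)" for n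
    unfolding eq using mom by (cases "n = 0") (auto simp: sum_nonneg)
qed measurable

lemma central_limit_cos:
  "(\<lambda>n. expectation (\<lambda>\<omega>. cos (v \<bullet> root_n_mean n \<omega> + c)))
     \<longlonglongrightarrow> (LINT t|std_normal. cos (sqrt (LINT z|Q. (v \<bullet> \<zeta> z)\<^sup>2) * t + c))"
proof -
  define V where "V = (LINT z|Q. (v \<bullet> \<zeta> z)\<^sup>2)"
  have "V \<ge> 0" by (simp add: V_def)
  show ?thesis
  proof (cases "V = 0")
    \<comment> \<open>The central limit theorem needs a positive variance. A zero second moment
      makes every summand vanish almost surely, and both sides reduce to cos c.\<close>
    case True
    then have "AE z in Q. (v \<bullet> \<zeta> z)\<^sup>2 = 0"
      using \<zeta>_inner_square_integrable[of v] unfolding V_def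
      by (subst (asm) integral_nonneg_eq_0_iff_AE) auto
    then have "AE z in distr M borel (W i). v \<bullet> \<zeta> z = 0" for i
      unfolding law by eventually_elim simp
    then have "AE \<omega> in M. v \<bullet> \<zeta> (W i \<omega>) = 0" for i
      by (subst (asm) AE_distr_iff) auto
    then have "AE \<omega> in M. \<forall>i. v \<bullet> \<zeta> (W i \<omega>) = 0"
      by (simp add: AE_all_countable)
    then have "AE \<omega> in M. cos (v \<bullet> root_n_mean n \<omega> + c) = cos c" for n
      by eventually_elim (simp add: root_n_mean_def inner_sum_right)
    then have "expectation (\<lambda>\<omega>. cos (v \<bullet> root_n_mean n \<omega> + c)) = expectation (\<lambda>\<omega>. cos c)" for n
      by (intro integral_cong_AE) auto
    then show ?thesis using True std_normal.prob_space by (simp add: prob_space flip: V_def)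
  next
    case False
    define \<sigma> where "\<sigma> = sqrt V"
    have \<sigma>: "\<sigma> > 0" "\<sigma>\<^sup>2 = V" using False \<open>V \<ge> 0\<close> by (auto simp: \<sigma>_def)
    define X where "X i \<omega> = v \<bullet> \<zeta> (W i \<omega>)" for i \<omega>
    have [measurable]: "X i \<in> borel_measurable M" for i unfolding X_def by measurable
    have mean: "expectation (X i) = 0" for i
      unfolding X_def using expectation_W[of "\<lambda>z. v \<bullet> \<zeta> z" i] \<zeta>_inner_centered by simp
    have "weak_conv_m (\<lambda>n. distr M borel (\<lambda>\<omega>. (\<Sum>i<n. X i \<omega>) / sqrt (n * \<sigma>\<^sup>2))) std_normal"
    proof (rule central_limit_theorem_zero_mean)
      show "indep_vars (\<lambda>i. borel) X UNIV"
        unfolding X_def by (rule indep_vars_compose2[OF indep]) measurable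
      show "integrable M (\<lambda>x. (X n x)\<^sup>2)" for n
        unfolding X_def using integrable_W[of "\<lambda>z. (v \<bullet> \<zeta> z)\<^sup>2" n] \<zeta>_inner_square_integrable by simp
      show "variance (X n) = \<sigma>\<^sup>2" for n
        using mean[of n] expectation_W[of "\<lambda>z. (v \<bullet> \<zeta> z)\<^sup>2" n] by (simp add: \<sigma> V_def X_def)
      show "distr M borel (X n) = distr Q borel (\<lambda>z. v \<bullet> \<zeta> z)" for n
        unfolding law[of n, symmetric] X_def by (subst distr_distr) (auto simp: comp_def)
    qed (use mean \<sigma> in auto)
    then have "(\<lambda>n. LINT t|distr M borel (\<lambda>\<omega>. (\<Sum>i<n. X i \<omega>) / sqrt (n * \<sigma>\<^sup>2)). cos (\<sigma> * t + c))
        \<longlonglongrightarrow> (LINT t|std_normal. cos (\<sigma> * t + c))"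
      by (rule weak_conv_imp_integral_bdd_continuous_conv[rotated 2, where B=1])
        (auto intro!: real_distribution_distr std_normal.real_distribution_axioms)
    moreover have "(LINT t|distr M borel (\<lambda>\<omega>. (\<Sum>i<n. X i \<omega>) / sqrt (n * \<sigma>\<^sup>2)). cos (\<sigma> * t + c))
        = expectation (\<lambda>\<omega>. cos (v \<bullet> root_n_mean n \<omega> + c))" for n
    proof -
      have "\<sigma> * ((\<Sum>i<n. X i \<omega>) / sqrt (n * \<sigma>\<^sup>2)) = v \<bullet> root_n_mean n \<omega>" for \<omega>
        using \<sigma>(1) by (simp add: root_n_mean_def X_def real_sqrt_mult inner_sum_right divide_inverse)
      then show ?thesis by (subst integral_distr) auto
    qed
    ultimately show ?thesis by (simp add: \<sigma>_def V_def)
  qed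
qed

text \<open>\<open>\<zeta>\<close> is the influence function of \<open>T\<close>. A remainder that
  vanishes in probability changes neither tightness nor the limits of cosine expectations, so
  \<open>T\<close> inherits the Gaussian limit of the scaled sums. The conclusion on
  \<open>limiting_law\<close> carries the quadratic form, from which all variances and covariances
  are read off.\<close>

theorem asymptotically_linear:
  fixes T :: "nat \<Rightarrow> 'b \<Rightarrow> 'c"
  assumes T [measurable]: "\<And>n. T n \<in> borel_measurable M"
    and lin: "tends_in_prob M (\<lambda>n \<omega>. sqrt (real n) *\<^sub>R (T n \<omega> - \<theta>) - root_n_mean n \<omega>) 0"
  shows "asymptotically_normal M T \<theta>"
    and "centered_gaussian (\<lambda>v. LINT z|Q. (v \<bullet> \<zeta> z)\<^sup>2) (limiting_law M T \<theta>)"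
proof -
  let ?V = "\<lambda>v. LINT z|Q. (v \<bullet> \<zeta> z)\<^sup>2"
  let ?T = "\<lambda>n \<omega>. sqrt (real n) *\<^sub>R (T n \<omega> - \<theta>)"
  obtain \<mu> where \<mu>: "centered_gaussian ?V \<mu>"
    using centered_gaussian_exists[of \<zeta> Q] \<zeta>_square_integrable by auto
  have "weakly_converges (\<lambda>n. distr M borel (?T n)) \<mu>"
  proof (rule weakly_converges_distrI)
    show "prob_space \<mu>" "sets \<mu> = sets borel" using \<mu> by (auto simp: centered_gaussian_def)
    show "bounded_in_prob M ?T"
      by (rule bounded_in_prob_near[OF bounded_in_prob_root_n_mean lin]) unfold_locales
    fix v c
    have "(LINT x|\<mu>. cos (v \<bullet> x + c)) = (LINT t|std_normal. cos (sqrt (?V v) * t + c))"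
      by (rule centered_gaussian_integral(1)[OF \<mu>]) measurable
    then show "(\<lambda>n. expectation (\<lambda>\<omega>. cos (v \<bullet> ?T n \<omega> + c))) \<longlonglongrightarrow> (LINT x|\<mu>. cos (v \<bullet> x + c))"
      using expectation_cos_near[OF _ _ lin central_limit_cos[of v c]] by simp
  qed (auto intro: prob_space_axioms)
  then have law_\<mu>: "has_limiting_normal_law M T \<theta> \<mu>"
    using centered_gaussian_multivariate_normal[OF \<mu>] by (simp add: has_limiting_normal_law_def)
  then show "asymptotically_normal M T \<theta>"
    by (auto simp: asymptotically_normal_def)
  have "limiting_law M T \<theta> = \<mu>"
    unfolding limiting_law_def
  proof (rule the_equality)
    show "has_limiting_normal_law M T \<theta> \<mu>" by (rule law_\<mu>)
    fix \<nu> assume \<nu>: "has_limiting_normal_law M T \<theta> \<nu>"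
    \<comment> \<open>Two limits of the same sequence integrate every bounded continuous function
      alike; this is what makes the definite description in \<open>limiting_law\<close> denote
      \<open>\<mu>\<close>.\<close>
    show "\<nu> = \<mu>"
    proof (rule finite_measure_eqI_bounded_continuous)
      fix f :: "'c \<Rightarrow> real" assume f: "continuous_on UNIV f" "bounded (range f)"
      show "(LINT x|\<nu>. f x) = (LINT x|\<mu>. f x)"
        using \<nu> law_\<mu> f unfolding has_limiting_normal_law_def weakly_converges_def
        by (meson LIMSEQ_unique)
    qed (use \<nu> law_\<mu> in \<open>auto simp: has_limiting_normal_law_def multivariate_normal_def prob_space_def\<close>)
  qed
  then show "centered_gaussian ?V (limiting_law M T \<theta>)" using \<mu> by simp
qed

end

section \<open>Inverse propensity weighting\<close>

text \<open>Continuity of the projection suffices, so this holds for the Borel sets of any product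
  space, whether or not they coincide with the product sigma-algebra.\<close>

lemma borel_measurable_fst [measurable (raw)]:
  fixes f :: "'a \<Rightarrow> 'b::topological_space \<times> 'c::topological_space"
  assumes "f \<in> borel_measurable M"
  shows "(\<lambda>x. fst (f x)) \<in> borel_measurable M"
  using measurable_comp[OF assms borel_measurable_continuous_onI[OF continuous_on_fst[OF continuous_on_id]]]
  by (simp add: comp_def)

lemma borel_measurable_snd [measurable (raw)]:
  fixes f :: "'a \<Rightarrow> 'b::topological_space \<times> 'c::topological_space"
  assumes "f \<in> borel_measurable M"
  shows "(\<lambda>x. snd (f x)) \<in> borel_measurable M"
  using measurable_comp[OF assms borel_measurable_continuous_onI[OF continuous_on_snd[OF continuous_on_id]]]
  by (simp add: comp_def)

section \<open>Square integrability with respect to a weight\<close>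

lemma integrable_weighted_product:
  fixes f w :: "'a \<Rightarrow> real" and g :: "'a \<Rightarrow> 'b::{banach, second_countable_topology}"
  assumes [measurable]: "w \<in> borel_measurable M" "f \<in> borel_measurable M" "g \<in> borel_measurable M"
    and w: "AE x in M. 0 \<le> w x"
    and f: "integrable M (\<lambda>x. (f x)\<^sup>2 * w x)" and g: "integrable M (\<lambda>x. (norm (g x))\<^sup>2 * w x)"
  shows "integrable M (\<lambda>x. (w x * f x) *\<^sub>R g x)"
proof (rule Bochner_Integration.integrable_bound[OF Bochner_Integration.integrable_add[OF f g]])
  show "AE x in M. norm ((w x * f x) *\<^sub>R g x) \<le> norm ((f x)\<^sup>2 * w x + (norm (g x))\<^sup>2 * w x)"
    using w
  proof eventually_elim
    case (elim x)
    have "0 \<le> \<bar>f x\<bar> * norm (g x)" "2 * \<bar>f x\<bar> * norm (g x) \<le> \<bar>f x\<bar>\<^sup>2 + (norm (g x))\<^sup>2"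
      by (simp, rule sum_squares_bound)
    then have "\<bar>f x\<bar> * norm (g x) \<le> (f x)\<^sup>2 + (norm (g x))\<^sup>2"
      unfolding power2_abs by linarith
    then have "\<bar>f x\<bar> * norm (g x) * w x \<le> ((f x)\<^sup>2 + (norm (g x))\<^sup>2) * w x"
      using elim by (rule mult_right_mono)
    then show ?case using elim by (simp add: abs_mult algebra_simps)
  qed
qed measurable

lemma integrable_weighted_square_shift:
  fixes w :: "'a \<Rightarrow> real" and g :: "'a \<Rightarrow> 'b::{banach, second_countable_topology}"
  assumes [measurable]: "w \<in> borel_measurable M" "g \<in> borel_measurable M"
    and w: "AE x in M. 0 \<le> w x" and int: "integrable M w" "integrable M (\<lambda>x. (norm (g x))\<^sup>2 * w x)"
  shows "integrable M (\<lambda>x. (norm (g x - c))\<^sup>2 * w x)"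
proof (rule Bochner_Integration.integrable_bound)
  show "integrable M (\<lambda>x. 2 * ((norm (g x))\<^sup>2 * w x) + 2 * (norm c)\<^sup>2 * w x)"
    using int by auto
  show "AE x in M. norm ((norm (g x - c))\<^sup>2 * w x) \<le> norm (2 * ((norm (g x))\<^sup>2 * w x) + 2 * (norm c)\<^sup>2 * w x)"
    using w
  proof eventually_elim
    case (elim x)
    have "(norm (g x - c))\<^sup>2 \<le> (norm (g x) + norm c)\<^sup>2"
      by (rule power_mono[OF norm_triangle_ineq4]) simp
    also have "\<dots> \<le> 2 * (norm (g x))\<^sup>2 + 2 * (norm c)\<^sup>2"
      using sum_squares_bound[of "norm (g x)" "norm c"] by (simp add: power2_sum)
    finally have "(norm (g x - c))\<^sup>2 * w x \<le> (2 * (norm (g x))\<^sup>2 + 2 * (norm c)\<^sup>2) * w x"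
      using elim by (rule mult_right_mono)
    then show ?case using elim by (simp add: algebra_simps)
  qed
qed measurable

section \<open>Reweighting by the inverse propensity\<close>

lemma subalgebra_sigma_gen:
  assumes "X \<in> borel_measurable P"
  shows "subalgebra P (sigma_gen P X)"
  unfolding subalgebra_def sigma_gen_def using assms
  by (auto simp: sets_vimage_algebra2 intro: measurable_sets)

lemma measurable_sigma_gen: "X \<in> borel_measurable (sigma_gen P X)"
  unfolding sigma_gen_def by (rule measurable_vimage_algebra1) auto

text \<open>Stated as an equality of laws, it gives the transfer of integrals and of integrability
  for every integrand at once. On a rectangle, conditional independence splits off the factor P(D in
  B | X) = q(X), and the weight cancels it.\<close>

lemma inverse_propensity_distr:
  fixes X :: "'a \<Rightarrow> 'x::second_countable_topology" and Y :: "'a \<Rightarrow> 'y::second_countable_topology"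
    and D :: "'a \<Rightarrow> 'd::topological_space"
  assumes "prob_space P"
    and X [measurable]: "X \<in> borel_measurable P" and Y [measurable]: "Y \<in> borel_measurable P"
    and D [measurable]: "D \<in> borel_measurable P"
    and q [measurable]: "q \<in> borel_measurable borel" and B [measurable]: "B \<in> sets borel"
    and propensity: "AE \<omega> in P. q (X \<omega>) = cond_probability P X (\<lambda>\<omega>. D \<omega> \<in> B) \<omega>"
    and pos: "AE \<omega> in P. 0 < q (X \<omega>)"
    and int: "integrable P (\<lambda>\<omega>. 1 / q (X \<omega>))"
    and indep: "cond_indep P X Y D"
  shows "distr (density P (\<lambda>\<omega>. ennreal (indicator B (D \<omega>) / q (X \<omega>)))) borel (\<lambda>\<omega>. (X \<omega>, Y \<omega>))
       = distr P borel (\<lambda>\<omega>. (X \<omega>, Y \<omega>))" (is "?L = ?R")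
proof -
  interpret P: prob_space P by fact
  let ?F = "sigma_gen P X"
  interpret F: finite_measure_subalgebra P ?F
    by unfold_locales (rule subalgebra_sigma_gen[OF X])
  note measurable_sigma_gen[of X P, measurable]
  have eq: "emeasure ?L (C \<times> A) = emeasure ?R (C \<times> A)"
    if [measurable]: "C \<in> sets borel" "A \<in> sets borel" for C A
  proof -
    \<comment> \<open>The part of the integrand that is a function of \<open>X\<close>, and so may
      be moved across the conditional expectation.\<close>
    define f where "f \<omega> = indicator C (X \<omega>) / q (X \<omega>)" for \<omega>
    define gA where "gA = (indicator {\<omega> \<in> space P. Y \<omega> \<in> A} :: 'a \<Rightarrow> real)"
    define gAB where "gAB = (indicator {\<omega> \<in> space P. Y \<omega> \<in> A \<and> D \<omega> \<in> B} :: 'a \<Rightarrow> real)"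
    have [measurable]: "f \<in> borel_measurable ?F" "f \<in> borel_measurable P"
      "gA \<in> borel_measurable P" "gAB \<in> borel_measurable P"
      unfolding f_def gA_def gAB_def by measurable
    have f_int: "integrable P (\<lambda>\<omega>. f \<omega> * gAB \<omega>)"
      by (rule Bochner_Integration.integrable_bound[OF int])
        (auto simp: f_def gAB_def indicator_def)
    have ind_int: "integrable P (\<lambda>\<omega>. indicator C (X \<omega>) * gA \<omega>)"
      by (rule P.integrable_const_bound[where B=1]) (auto simp: gA_def indicator_def)
    have "AE \<omega> in P. real_cond_exp P ?F gAB \<omega> = real_cond_exp P ?F gA \<omega> * cond_probability P X (\<lambda>\<omega>. D \<omega> \<in> B) \<omega>"
      using indep that(2) B unfolding cond_indep_def cond_probability_def cond_expectation_def gAB_def gA_def by blast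
    with propensity pos have "AE \<omega> in P. f \<omega> * real_cond_exp P ?F gAB \<omega> = indicator C (X \<omega>) * real_cond_exp P ?F gA \<omega>"
      by eventually_elim (simp add: f_def)
    then have "(LINT \<omega>|P. f \<omega> * real_cond_exp P ?F gAB \<omega>) = (LINT \<omega>|P. indicator C (X \<omega>) * real_cond_exp P ?F gA \<omega>)"
      by (intro integral_cong_AE) auto
    then have LINT: "(LINT \<omega>|P. f \<omega> * gAB \<omega>) = (LINT \<omega>|P. indicator C (X \<omega>) * gA \<omega>)"
      by (simp add: F.real_cond_exp_intg(2)[OF f_int] F.real_cond_exp_intg(2)[OF ind_int])
    have "emeasure ?L (C \<times> A)
        = (\<integral>\<^sup>+ \<omega>. ennreal (indicator B (D \<omega>) / q (X \<omega>)) * indicator ((\<lambda>\<omega>. (X \<omega>, Y \<omega>)) -` (C \<times> A) \<inter> space P) \<omega> \<partial>P)"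
      by (subst emeasure_distr) (auto simp: emeasure_density borel_Times)
    also have "\<dots> = (\<integral>\<^sup>+ \<omega>. ennreal (f \<omega> * gAB \<omega>) \<partial>P)"
      by (intro nn_integral_cong) (auto simp: f_def gAB_def indicator_def)
    also have "\<dots> = ennreal (LINT \<omega>|P. f \<omega> * gAB \<omega>)"
      using pos by (intro nn_integral_eq_integral f_int) (auto simp: f_def gAB_def indicator_def elim: eventually_mono)
    also have "\<dots> = ennreal (LINT \<omega>|P. indicator C (X \<omega>) * gA \<omega>)" using LINT by simp
    also have "\<dots> = (\<integral>\<^sup>+ \<omega>. ennreal (indicator C (X \<omega>) * gA \<omega>) \<partial>P)"
      by (rule nn_integral_eq_integral[symmetric, OF ind_int]) (auto simp: gA_def)
    also have "\<dots> = (\<integral>\<^sup>+ \<omega>. indicator ((\<lambda>\<omega>. (X \<omega>, Y \<omega>)) -` (C \<times> A) \<inter> space P) \<omega> \<partial>P)"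
      by (intro nn_integral_cong) (auto simp: gA_def indicator_def)
    also have "\<dots> = emeasure ?R (C \<times> A)"
      by (subst emeasure_distr) (auto simp: borel_Times)
    finally show ?thesis .
  qed
  have sets: "sets (borel :: ('x \<times> 'y) measure)
      = sigma_sets UNIV {C \<times> A | C A. C \<in> sets (borel :: 'x measure) \<and> A \<in> sets (borel :: 'y measure)}"
    using sets_pair_measure[of "borel :: 'x measure" "borel :: 'y measure"] unfolding borel_prod by simp
  show ?thesis
  proof (rule measure_eqI_generator_eq[where E="{C \<times> A | C A. C \<in> sets borel \<and> A \<in> sets borel}" and \<Omega>=UNIV and A="\<lambda>_. UNIV"])
    show "Int_stable {C \<times> A | C A. C \<in> sets (borel :: 'x measure) \<and> A \<in> sets (borel :: 'y measure)}"
      by (rule Int_stable_pair_measure_generator)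
    \<comment> \<open>The whole space is a rectangle, so the reweighted measure has total mass 1; in
      particular it is finite, as uniqueness of extension demands.\<close>
    have "?L UNIV = ?R UNIV" using eq[of UNIV UNIV] by simp
    moreover have "emeasure ?R UNIV = 1"
      using P.emeasure_space_1 by (subst emeasure_distr) auto
    ultimately show "emeasure ?L UNIV \<noteq> \<infinity>" by simp
    show "range (\<lambda>_::nat. UNIV) \<subseteq> {C \<times> A | C A. C \<in> sets (borel :: 'x measure) \<and> A \<in> sets (borel :: 'y measure)}"
      using UNIV_Times_UNIV by (auto intro!: exI[of _ UNIV])
    show "emeasure ?L Z = emeasure ?R Z" if "Z \<in> {C \<times> A | C A. C \<in> sets borel \<and> A \<in> sets borel}" for Z
      using that eq by auto
  qed (auto simp: sets)
qed

section \<open>Pairs of integrable functions and the moments of one arm\<close>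

lemma integrable_Pair_iff:
  fixes f :: "'a \<Rightarrow> 'b::{banach, second_countable_topology}" and g :: "'a \<Rightarrow> 'c::{banach, second_countable_topology}"
  shows "integrable M (\<lambda>x. (f x, g x)) \<longleftrightarrow> integrable M f \<and> integrable M g"
proof (intro iffI conjI)
  assume int: "integrable M (\<lambda>x. (f x, g x))"
  show "integrable M f" using integrable_bounded_linear[OF bounded_linear_fst int] by simp
  show "integrable M g" using integrable_bounded_linear[OF bounded_linear_snd int] by simp
next
  assume int: "integrable M f \<and> integrable M g"
  have "bounded_linear (\<lambda>x::'b. (x, 0::'c))" "bounded_linear (\<lambda>y::'c. (0::'b, y))"
    by (auto intro!: bounded_linear_Pair bounded_linear_ident bounded_linear_zero)
  from integrable_bounded_linear[OF this(1)] integrable_bounded_linear[OF this(2)]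
  have "integrable M (\<lambda>x. (f x, 0::'c) + (0::'b, g x))"
    using int by (intro Bochner_Integration.integrable_add) blast+
  then show "integrable M (\<lambda>x. (f x, g x))" by simp
qed

lemma integral_Pair:
  fixes f :: "'a \<Rightarrow> 'b::{banach, second_countable_topology}" and g :: "'a \<Rightarrow> 'c::{banach, second_countable_topology}"
  assumes "integrable M f" "integrable M g"
  shows "(LINT x|M. (f x, g x)) = ((LINT x|M. f x), (LINT x|M. g x))"
proof -
  have int: "integrable M (\<lambda>x. (f x, g x))" using assms by (simp add: integrable_Pair_iff)
  show ?thesis
    using integral_bounded_linear[OF bounded_linear_fst int] integral_bounded_linear[OF bounded_linear_snd int]
    by (simp add: prod_eq_iff)
qed

text \<open>One of the two treatment arms: \<open>I\<close> indicates membership, \<open>q\<close> is its probability given the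
  covariates and \<open>Y\<close> its potential outcome.\<close>

locale ipw_arm = prob_space P for P :: "'a measure" +
  fixes X :: "'a \<Rightarrow> 'x::euclidean_space" and Y I :: "'a \<Rightarrow> real" and q :: "'x \<Rightarrow> real"
  assumes X_measurable [measurable]: "X \<in> borel_measurable P"
    and Y_measurable [measurable]: "Y \<in> borel_measurable P"
    and I_measurable [measurable]: "I \<in> borel_measurable P"
    and q_measurable [measurable]: "q \<in> borel_measurable borel"
    and I_01: "\<And>\<omega>. \<omega> \<in> space P \<Longrightarrow> I \<omega> = 0 \<or> I \<omega> = 1"
    and q_bounds: "AE \<omega> in P. 0 < q (X \<omega>) \<and> q (X \<omega>) \<le> 1"
    and inv_q_integrable: "integrable P (\<lambda>\<omega>. 1 / q (X \<omega>))"
    and X_square_integrable: "integrable P (\<lambda>\<omega>. (norm (X \<omega>))\<^sup>2 * (1 / q (X \<omega>)))"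
    and Y_square_integrable: "integrable P (\<lambda>\<omega>. (Y \<omega>)\<^sup>2 * (1 / q (X \<omega>)))"
    and reweighting: "distr (density P (\<lambda>\<omega>. ennreal (I \<omega> / q (X \<omega>)))) borel (\<lambda>\<omega>. (X \<omega>, Y \<omega>))
          = distr P borel (\<lambda>\<omega>. (X \<omega>, Y \<omega>))"
begin

definition w :: "'a \<Rightarrow> real" where "w \<omega> = I \<omega> / q (X \<omega>)"
definition iq :: "'a \<Rightarrow> real" where "iq \<omega> = 1 / q (X \<omega>)"
definition Z :: "'a \<Rightarrow> 'x \<times> real" where "Z \<omega> = (X \<omega>, Y \<omega>)"
definition \<theta> :: "'x \<times> real" where "\<theta> = ((LINT \<omega>|P. X \<omega>), (LINT \<omega>|P. Y \<omega>))"

lemma measurable_w [measurable]: "w \<in> borel_measurable P"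
  and measurable_iq [measurable]: "iq \<in> borel_measurable P"
  and measurable_Z [measurable]: "Z \<in> borel_measurable P"
  unfolding w_def iq_def Z_def by measurable

lemma iq_ge_1: "AE \<omega> in P. 1 \<le> iq \<omega>"
  using q_bounds unfolding iq_def by eventually_elim auto

lemma iq_nonneg: "AE \<omega> in P. 0 \<le> iq \<omega>"
  using iq_ge_1 by eventually_elim auto

text \<open>An indicator equals its square, so a squared weight carries the indicator once.
  Reweighting removes it together with one factor 1 / q, and a single factor \<open>iq\<close>
  remains; this is why the moment assumptions involve 1 / q and not its square.\<close>

lemma w_square: "\<omega> \<in> space P \<Longrightarrow> (w \<omega>)\<^sup>2 = w \<omega> * iq \<omega>"
  using I_01[of \<omega>] by (auto simp: w_def iq_def power2_eq_square)

lemma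
  fixes G :: "'x \<times> real \<Rightarrow> 'c::{banach, second_countable_topology}"
  assumes G [measurable]: "G \<in> borel_measurable borel"
  shows weighting_integrable: "integrable P (\<lambda>\<omega>. w \<omega> *\<^sub>R G (Z \<omega>)) \<longleftrightarrow> integrable P (\<lambda>\<omega>. G (Z \<omega>))"
    and weighting_integral: "(LINT \<omega>|P. w \<omega> *\<^sub>R G (Z \<omega>)) = (LINT \<omega>|P. G (Z \<omega>))"
proof -
  have nn: "AE \<omega> in P. 0 \<le> I \<omega> / q (X \<omega>)"
    using q_bounds AE_space by eventually_elim (use I_01 in force)
  show "integrable P (\<lambda>\<omega>. w \<omega> *\<^sub>R G (Z \<omega>)) \<longleftrightarrow> integrable P (\<lambda>\<omega>. G (Z \<omega>))"
    using arg_cong[OF reweighting, of "\<lambda>m. integrable m G"] nn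
    by (simp add: integrable_distr_eq integrable_density w_def Z_def)
  show "(LINT \<omega>|P. w \<omega> *\<^sub>R G (Z \<omega>)) = (LINT \<omega>|P. G (Z \<omega>))"
    using arg_cong[OF reweighting, of "\<lambda>m. LINT z|m. G z"] nn
    by (simp add: integral_distr integral_density w_def Z_def)
qed

lemma
  fixes G :: "'x \<times> real \<Rightarrow> 'c::{banach, second_countable_topology}"
  assumes G [measurable]: "G \<in> borel_measurable borel"
  shows square_weighting_integrable: "integrable P (\<lambda>\<omega>. (w \<omega>)\<^sup>2 *\<^sub>R G (Z \<omega>)) \<longleftrightarrow> integrable P (\<lambda>\<omega>. iq \<omega> *\<^sub>R G (Z \<omega>))"
    and square_weighting_integral: "(LINT \<omega>|P. (w \<omega>)\<^sup>2 *\<^sub>R G (Z \<omega>)) = (LINT \<omega>|P. iq \<omega> *\<^sub>R G (Z \<omega>))"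
proof -
  \<comment> \<open>The surviving factor 1 / q is a function of the covariates and can be absorbed
    into the integrand before reweighting.\<close>
  define H where "H z = (1 / q (fst z)) *\<^sub>R G z" for z
  have [measurable]: "H \<in> borel_measurable borel" unfolding H_def by measurable
  have H: "H (Z \<omega>) = iq \<omega> *\<^sub>R G (Z \<omega>)" for \<omega> by (simp add: H_def Z_def iq_def)
  have w: "(w \<omega>)\<^sup>2 *\<^sub>R G (Z \<omega>) = w \<omega> *\<^sub>R H (Z \<omega>)" if "\<omega> \<in> space P" for \<omega>
    unfolding H using w_square[OF that] by simp
  show "integrable P (\<lambda>\<omega>. (w \<omega>)\<^sup>2 *\<^sub>R G (Z \<omega>)) \<longleftrightarrow> integrable P (\<lambda>\<omega>. iq \<omega> *\<^sub>R G (Z \<omega>))"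
    by (subst Bochner_Integration.integrable_cong[OF refl w]) (simp, simp add: weighting_integrable, simp add: H)
  show "(LINT \<omega>|P. (w \<omega>)\<^sup>2 *\<^sub>R G (Z \<omega>)) = (LINT \<omega>|P. iq \<omega> *\<^sub>R G (Z \<omega>))"
    by (subst Bochner_Integration.integral_cong[OF refl w]) (simp, simp add: weighting_integral, simp add: H)
qed

lemma integrable_iq: "integrable P iq"
  unfolding iq_def by (rule inv_q_integrable)

lemma integrable_norm_Z_square: "integrable P (\<lambda>\<omega>. (norm (Z \<omega> - c))\<^sup>2 * iq \<omega>)"
proof (rule integrable_weighted_square_shift)
  have "(\<lambda>\<omega>. (norm (Z \<omega>))\<^sup>2 * iq \<omega>) = (\<lambda>\<omega>. (norm (X \<omega>))\<^sup>2 * (1 / q (X \<omega>)) + (Y \<omega>)\<^sup>2 * (1 / q (X \<omega>)))"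
    by (simp add: Z_def iq_def norm_Pair distrib_right add_divide_distrib)
  then show "integrable P (\<lambda>\<omega>. (norm (Z \<omega>))\<^sup>2 * iq \<omega>)"
    using X_square_integrable Y_square_integrable by simp
qed (use iq_nonneg integrable_iq in auto)

lemma integrable_Z_product:
  fixes f :: "'x \<times> real \<Rightarrow> real" and g :: "'x \<times> real \<Rightarrow> 'c::{banach, second_countable_topology}"
  assumes f: "bounded_linear f" and g: "bounded_linear g"
  shows "integrable P (\<lambda>\<omega>. (iq \<omega> * f (Z \<omega> - c)) *\<^sub>R g (Z \<omega> - c))"
proof -
  have [measurable]: "f \<in> borel_measurable borel" "g \<in> borel_measurable borel"
    using f g by (auto intro!: borel_measurable_continuous_onI linear_continuous_on)
  have sq: "integrable P (\<lambda>\<omega>. (norm (h (Z \<omega> - c)))\<^sup>2 * iq \<omega>)"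
    if h: "bounded_linear h" and [measurable]: "h \<in> borel_measurable borel"
    for h :: "'x \<times> real \<Rightarrow> 'd::{banach, second_countable_topology}"
  proof -
    obtain K where K: "\<And>x. norm (h x) \<le> norm x * K" "K \<ge> 0"
      using bounded_linear.nonneg_bounded[OF h] by blast
    show ?thesis
    proof (rule Bochner_Integration.integrable_bound[OF integrable_mult_right[of "K\<^sup>2", OF integrable_norm_Z_square[of c]]])
      show "AE \<omega> in P. norm ((norm (h (Z \<omega> - c)))\<^sup>2 * iq \<omega>) \<le> norm (K\<^sup>2 * ((norm (Z \<omega> - c))\<^sup>2 * iq \<omega>))"
        using iq_nonneg
      proof eventually_elim
        case (elim \<omega>)
        have "(norm (h (Z \<omega> - c)))\<^sup>2 * iq \<omega> \<le> (norm (Z \<omega> - c) * K)\<^sup>2 * iq \<omega>"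
          using elim K by (intro mult_right_mono power_mono) auto
        then show ?case using elim by (simp add: power_mult_distrib ac_simps)
      qed
    qed measurable
  qed
  show ?thesis
    by (rule integrable_weighted_product) (use sq[OF f] sq[OF g] iq_nonneg in auto)
qed

lemma integrable_iq_Z:
  fixes g :: "'x \<times> real \<Rightarrow> 'c::{banach, second_countable_topology}"
  assumes g: "bounded_linear g"
  shows "integrable P (\<lambda>\<omega>. iq \<omega> *\<^sub>R g (Z \<omega> - c))"
proof -
  have "integrable P (\<lambda>\<omega>. (iq \<omega> * 1) *\<^sub>R (Z \<omega> - c))"
    by (rule integrable_weighted_product) (use iq_nonneg integrable_iq integrable_norm_Z_square in auto)
  from integrable_bounded_linear[OF g this] show ?thesis
    using linear_cmul[OF bounded_linear.linear[OF g]] by simp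
qed

text \<open>Propensities are at most 1, so the inversely weighted variable dominates the plain
  one.\<close>

lemma integrable_Z: "integrable P Z"
proof (rule Bochner_Integration.integrable_bound)
  show "integrable P (\<lambda>\<omega>. iq \<omega> *\<^sub>R (Z \<omega> - 0))"
    by (rule integrable_iq_Z[OF bounded_linear_ident])
  show "AE \<omega> in P. norm (Z \<omega>) \<le> norm (iq \<omega> *\<^sub>R (Z \<omega> - 0))"
    using iq_ge_1
  proof eventually_elim
    case (elim \<omega>)
    then have "1 * norm (Z \<omega>) \<le> iq \<omega> * norm (Z \<omega>)" by (intro mult_right_mono) auto
    then show ?case using elim by simp
  qed
qed measurable

lemma \<theta>_eq: "\<theta> = (LINT \<omega>|P. Z \<omega>)"
  using integrable_Z unfolding \<theta>_def Z_def by (subst integral_Pair) (auto simp: integrable_Pair_iff)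

lemma integrable_w: "integrable P w" and integral_w: "(LINT \<omega>|P. w \<omega>) = 1"
  using weighting_integrable[of "\<lambda>_. 1::real"] weighting_integral[of "\<lambda>_. 1::real"]
  by (simp_all add: prob_space)

lemma integrable_w_Z: "integrable P (\<lambda>\<omega>. w \<omega> *\<^sub>R (Z \<omega> - \<theta>))"
  and integral_w_Z: "(LINT \<omega>|P. w \<omega> *\<^sub>R (Z \<omega> - \<theta>)) = 0"
  using weighting_integrable[of "\<lambda>z. z - \<theta>"] weighting_integral[of "\<lambda>z. z - \<theta>"] integrable_Z
  by (simp_all add: \<theta>_eq prob_space)

lemma integrable_w_Z_square: "integrable P (\<lambda>\<omega>. (w \<omega>)\<^sup>2 * (norm (Z \<omega> - \<theta>))\<^sup>2)"
  using square_weighting_integrable[of "\<lambda>z. (norm (z - \<theta>))\<^sup>2"] integrable_norm_Z_square[of \<theta>]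
  by (simp add: mult.commute)

lemma integrable_w_square: "integrable P (\<lambda>\<omega>. (w \<omega>)\<^sup>2)"
  using square_weighting_integrable[of "\<lambda>_. 1::real"] integrable_iq by simp

lemma integrable_w_square_Z:
  fixes g :: "'x \<times> real \<Rightarrow> 'c::{banach, second_countable_topology}"
  assumes g: "bounded_linear g"
  shows "integrable P (\<lambda>\<omega>. (w \<omega>)\<^sup>2 *\<^sub>R g (Z \<omega> - \<theta>))"
proof -
  have [measurable]: "g \<in> borel_measurable borel"
    using g by (auto intro!: borel_measurable_continuous_onI linear_continuous_on)
  show ?thesis
    using square_weighting_integrable[of "\<lambda>z. g (z - \<theta>)"] integrable_iq_Z[OF g] by simp
qed

lemma
  fixes f :: "'x \<times> real \<Rightarrow> real" and g :: "'x \<times> real \<Rightarrow> 'c::{banach, second_countable_topology}"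
  assumes f: "bounded_linear f" and g: "bounded_linear g"
  shows integrable_w_Z_product: "integrable P (\<lambda>\<omega>. ((w \<omega>)\<^sup>2 * f (Z \<omega> - \<theta>)) *\<^sub>R g (Z \<omega> - \<theta>))"
    and integral_w_Z_product: "(LINT \<omega>|P. ((w \<omega>)\<^sup>2 * f (Z \<omega> - \<theta>)) *\<^sub>R g (Z \<omega> - \<theta>))
      = (LINT \<omega>|P. (iq \<omega> * f (Z \<omega> - \<theta>)) *\<^sub>R g (Z \<omega> - \<theta>))"
proof -
  have [measurable]: "f \<in> borel_measurable borel" "g \<in> borel_measurable borel"
    using f g by (auto intro!: borel_measurable_continuous_onI linear_continuous_on)
  show "integrable P (\<lambda>\<omega>. ((w \<omega>)\<^sup>2 * f (Z \<omega> - \<theta>)) *\<^sub>R g (Z \<omega> - \<theta>))"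
    using square_weighting_integrable[of "\<lambda>z. f (z - \<theta>) *\<^sub>R g (z - \<theta>)"] integrable_Z_product[OF f g] by simp
  show "(LINT \<omega>|P. ((w \<omega>)\<^sup>2 * f (Z \<omega> - \<theta>)) *\<^sub>R g (Z \<omega> - \<theta>))
      = (LINT \<omega>|P. (iq \<omega> * f (Z \<omega> - \<theta>)) *\<^sub>R g (Z \<omega> - \<theta>))"
    using square_weighting_integral[of "\<lambda>z. f (z - \<theta>) *\<^sub>R g (z - \<theta>)"] by simp
qed


text \<open>The tower property: \<open>iq\<close> and \<open>f (X \<omega>)\<close> are functions of
  the covariates, so under the integral the outcome may be replaced by its conditional mean. This is
  how the conditional means enter the criterion of the theorem.\<close>

lemma conditional_outcome:
  fixes f :: "'x \<Rightarrow> real"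
  assumes [measurable]: "f \<in> borel_measurable borel"
    and int: "integrable P (\<lambda>\<omega>. iq \<omega> * f (X \<omega>))" "integrable P (\<lambda>\<omega>. iq \<omega> * (f (X \<omega>) * (Y \<omega> - c)))"
  shows "integrable P (\<lambda>\<omega>. iq \<omega> * (f (X \<omega>) * (cond_expectation P X Y \<omega> - c)))"
    and "(LINT \<omega>|P. iq \<omega> * (f (X \<omega>) * (cond_expectation P X Y \<omega> - c)))
      = (LINT \<omega>|P. iq \<omega> * (f (X \<omega>) * (Y \<omega> - c)))"
proof -
  let ?F = "sigma_gen P X"
  let ?h = "\<lambda>\<omega>. iq \<omega> * f (X \<omega>)"
  interpret F: finite_measure_subalgebra P ?F
    by unfold_locales (rule subalgebra_sigma_gen[OF X_measurable])
  note measurable_sigma_gen[of X P, measurable]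
  have [measurable]: "?h \<in> borel_measurable ?F" unfolding iq_def by measurable
  have "integrable P (\<lambda>\<omega>. iq \<omega> * (f (X \<omega>) * (Y \<omega> - c)) + c * ?h \<omega>)"
    using int by auto
  then have hY: "integrable P (\<lambda>\<omega>. ?h \<omega> * Y \<omega>)"
    by (simp add: algebra_simps)
  note ce = F.real_cond_exp_intg[OF hY]
  have exp: "iq \<omega> * (f (X \<omega>) * (y - c)) = ?h \<omega> * y - c * ?h \<omega>" for \<omega> y
    by (simp add: algebra_simps)
  show "integrable P (\<lambda>\<omega>. iq \<omega> * (f (X \<omega>) * (cond_expectation P X Y \<omega> - c)))"
    unfolding exp cond_expectation_def using ce(1) int(1) by simp
  show "(LINT \<omega>|P. iq \<omega> * (f (X \<omega>) * (cond_expectation P X Y \<omega> - c)))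
      = (LINT \<omega>|P. iq \<omega> * (f (X \<omega>) * (Y \<omega> - c)))"
    unfolding exp cond_expectation_def using ce int(1) hY by simp
qed

end

section \<open>The population\<close>

lemma inner_outer: "a \<bullet> (outer u v *v c) = (a \<bullet> u) * (v \<bullet> c)"
proof -
  have "outer u v *v c = (v \<bullet> c) *\<^sub>R u"
    by (simp add: outer_def matrix_vector_mult_def inner_vec_def vec_eq_iff sum_distrib_left ac_simps)
  then show ?thesis by simp
qed

lemma norm_outer: "norm (outer u v) = norm u * norm v"
proof -
  have "(norm (outer u v))\<^sup>2 = (norm u * norm v)\<^sup>2"
    unfolding power2_norm_eq_inner power_mult_distrib
    by (simp add: outer_def inner_vec_def sum_product power2_eq_square ac_simps)
  then show ?thesis by (simp add: power2_eq_iff_nonneg)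
qed

lemma bounded_bilinear_outer: "bounded_bilinear outer"
proof
  show "\<exists>K. \<forall>a b. norm (outer a b :: real^'k^'k) \<le> norm a * norm b * K"
    by (intro exI[of _ 1]) (simp add: norm_outer)
qed (simp_all add: outer_def vec_eq_iff algebra_simps)

lemma borel_measurable_outer [measurable (raw)]:
  assumes "f \<in> borel_measurable M" "g \<in> borel_measurable M"
  shows "(\<lambda>x. outer (f x) (g x)) \<in> borel_measurable M"
  using assms
  by (rule borel_measurable_continuous_Pair)
    (intro bounded_bilinear.continuous_on[OF bounded_bilinear_outer] continuous_intros)

text \<open>The covariates occur in both arms and carry the weight 1 / (p (1 - p)) = 1 / p + 1 / (1
  - p), while each potential outcome carries the weight of its own arm. The last assumption excludes
  affine collinearity of the covariates.\<close>

locale ipw_population = prob_space P for P :: "'a measure" +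
  fixes X :: "'a \<Rightarrow> real ^ 'k" and D YT YC :: "'a \<Rightarrow> real" and p :: "real ^ 'k \<Rightarrow> real"
  assumes X_measurable [measurable]: "X \<in> borel_measurable P"
    and D_measurable [measurable]: "D \<in> borel_measurable P"
    and YT_measurable [measurable]: "YT \<in> borel_measurable P"
    and YC_measurable [measurable]: "YC \<in> borel_measurable P"
    and treatment: "\<And>\<omega>. \<omega> \<in> space P \<Longrightarrow> D \<omega> \<in> {0, 1}"
    and p_measurable [measurable]: "p \<in> borel_measurable borel"
    and propensity: "AE \<omega> in P. p (X \<omega>) = cond_probability P X (\<lambda>\<omega>. D \<omega> = 1) \<omega>"
    and overlap: "AE \<omega> in P. 0 < p (X \<omega>) \<and> p (X \<omega>) < 1"
    and unconfoundedness: "cond_indep P X (\<lambda>\<omega>. (YT \<omega>, YC \<omega>)) D"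
    and weight_integrable: "integrable P (\<lambda>\<omega>. 1 / (p (X \<omega>) * (1 - p (X \<omega>))))"
    and X_integrable: "integrable P (\<lambda>\<omega>. (norm (X \<omega>))\<^sup>2 / (p (X \<omega>) * (1 - p (X \<omega>))))"
    and YT_integrable: "integrable P (\<lambda>\<omega>. (YT \<omega>)\<^sup>2 / p (X \<omega>))"
    and YC_integrable: "integrable P (\<lambda>\<omega>. (YC \<omega>)\<^sup>2 / (1 - p (X \<omega>)))"
    and nondegenerate: "\<And>v c. (AE \<omega> in P. v \<bullet> X \<omega> = c) \<Longrightarrow> v = 0"
begin

lemma weights_bounded:
  "AE \<omega> in P. 1 / p (X \<omega>) \<le> 1 / (p (X \<omega>) * (1 - p (X \<omega>)))"
  "AE \<omega> in P. 1 / (1 - p (X \<omega>)) \<le> 1 / (p (X \<omega>) * (1 - p (X \<omega>)))"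
  using overlap by (eventually_elim, auto intro!: divide_left_mono mult_pos_pos simp: mult_le_cancel_left1 mult_le_cancel_right1)+

lemma inv_weights_integrable:
  "integrable P (\<lambda>\<omega>. 1 / p (X \<omega>))" "integrable P (\<lambda>\<omega>. 1 / (1 - p (X \<omega>)))"
proof -
  have "AE \<omega> in P. norm (1 / p (X \<omega>)) \<le> norm (1 / (p (X \<omega>) * (1 - p (X \<omega>))))"
    using overlap weights_bounded(1) by eventually_elim auto
  then show "integrable P (\<lambda>\<omega>. 1 / p (X \<omega>))"
    by (intro Bochner_Integration.integrable_bound[OF weight_integrable]) auto
  have "AE \<omega> in P. norm (1 / (1 - p (X \<omega>))) \<le> norm (1 / (p (X \<omega>) * (1 - p (X \<omega>))))"
    using overlap weights_bounded(2) by eventually_elim auto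
  then show "integrable P (\<lambda>\<omega>. 1 / (1 - p (X \<omega>)))"
    by (intro Bochner_Integration.integrable_bound[OF weight_integrable]) auto
qed

lemma X_weighted_integrable:
  "integrable P (\<lambda>\<omega>. (norm (X \<omega>))\<^sup>2 * (1 / p (X \<omega>)))"
  "integrable P (\<lambda>\<omega>. (norm (X \<omega>))\<^sup>2 * (1 / (1 - p (X \<omega>))))"
proof -
  have *: "norm ((norm (X \<omega>))\<^sup>2 * u) \<le> norm ((norm (X \<omega>))\<^sup>2 / v)" if "0 \<le> u" "u \<le> 1 / v" for u v \<omega>
  proof -
    have "(norm (X \<omega>))\<^sup>2 * u \<le> (norm (X \<omega>))\<^sup>2 * (1 / v)"
      by (rule mult_left_mono) (use that in auto)
    also have "\<dots> = (norm (X \<omega>))\<^sup>2 / v" by simp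
    finally show ?thesis
      using that order_trans[OF that] by (simp add: abs_mult)
  qed
  have "AE \<omega> in P. norm ((norm (X \<omega>))\<^sup>2 * (1 / p (X \<omega>))) \<le> norm ((norm (X \<omega>))\<^sup>2 / (p (X \<omega>) * (1 - p (X \<omega>))))"
    using overlap weights_bounded(1) by eventually_elim (rule *, auto)
  then show "integrable P (\<lambda>\<omega>. (norm (X \<omega>))\<^sup>2 * (1 / p (X \<omega>)))"
    by (intro Bochner_Integration.integrable_bound[OF X_integrable]) auto
  have "AE \<omega> in P. norm ((norm (X \<omega>))\<^sup>2 * (1 / (1 - p (X \<omega>)))) \<le> norm ((norm (X \<omega>))\<^sup>2 / (p (X \<omega>) * (1 - p (X \<omega>))))"
    using overlap weights_bounded(2) by eventually_elim (rule *, auto)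
  then show "integrable P (\<lambda>\<omega>. (norm (X \<omega>))\<^sup>2 * (1 / (1 - p (X \<omega>))))"
    by (intro Bochner_Integration.integrable_bound[OF X_integrable]) auto
qed

lemma control_propensity: "AE \<omega> in P. 1 - p (X \<omega>) = cond_probability P X (\<lambda>\<omega>. D \<omega> \<in> {0}) \<omega>"
proof -
  let ?F = "sigma_gen P X"
  interpret F: finite_measure_subalgebra P ?F
    by unfold_locales (rule subalgebra_sigma_gen[OF X_measurable])
  let ?d = "indicator {\<omega> \<in> space P. D \<omega> = 1} :: 'a \<Rightarrow> real"
  have int_d: "integrable P ?d"
    by (rule integrable_real_indicator) (auto simp: emeasure_eq_measure)
  have "AE \<omega> in P. real_cond_exp P ?F (indicator {\<omega> \<in> space P. D \<omega> \<in> {0}}) \<omega> = real_cond_exp P ?F (\<lambda>\<omega>. 1 - ?d \<omega>) \<omega>"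
    by (rule F.real_cond_exp_cong) (use treatment in \<open>auto simp: indicator_def intro!: AE_I2\<close>)
  moreover have "AE \<omega> in P. real_cond_exp P ?F (\<lambda>\<omega>. 1 - ?d \<omega>) \<omega> = real_cond_exp P ?F (\<lambda>\<omega>. 1) \<omega> - real_cond_exp P ?F ?d \<omega>"
    by (rule F.real_cond_exp_diff) (use int_d in auto)
  moreover have "AE \<omega> in P. real_cond_exp P ?F (\<lambda>\<omega>. 1) \<omega> = 1"
    by (rule F.real_cond_exp_F_meas) auto
  ultimately show ?thesis
    using propensity unfolding cond_probability_def cond_expectation_def
    by eventually_elim simp
qed

text \<open>Unconfoundedness concerns the pair of potential outcomes, whereas an arm involves one of
  them. The identity of laws is obtained for the pair and pushed forward along
  \<open>proj\<close>.\<close>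

lemma arm_reweighting:
  fixes I :: "'a \<Rightarrow> real" and proj :: "real \<times> real \<Rightarrow> real"
  assumes B [measurable]: "B \<in> sets borel" and [measurable]: "q \<in> borel_measurable borel"
    and [measurable]: "proj \<in> borel_measurable borel" "I \<in> borel_measurable P"
    and I: "\<And>\<omega>. \<omega> \<in> space P \<Longrightarrow> I \<omega> = indicator B (D \<omega>)"
    and q: "AE \<omega> in P. q (X \<omega>) = cond_probability P X (\<lambda>\<omega>. D \<omega> \<in> B) \<omega>" "AE \<omega> in P. 0 < q (X \<omega>)"
      "integrable P (\<lambda>\<omega>. 1 / q (X \<omega>))"
  shows "distr (density P (\<lambda>\<omega>. ennreal (I \<omega> / q (X \<omega>)))) borel (\<lambda>\<omega>. (X \<omega>, proj (YT \<omega>, YC \<omega>)))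
       = distr P borel (\<lambda>\<omega>. (X \<omega>, proj (YT \<omega>, YC \<omega>)))"
proof -
  let ?Y = "\<lambda>\<omega>. (YT \<omega>, YC \<omega>)"
  have eq: "distr (density P (\<lambda>\<omega>. ennreal (indicator B (D \<omega>) / q (X \<omega>)))) borel (\<lambda>\<omega>. (X \<omega>, ?Y \<omega>))
      = distr P borel (\<lambda>\<omega>. (X \<omega>, ?Y \<omega>))"
    by (rule inverse_propensity_distr[OF prob_space_axioms _ _ _ _ _ q unconfoundedness]) measurable
  have dens: "density P (\<lambda>\<omega>. ennreal (I \<omega> / q (X \<omega>))) = density P (\<lambda>\<omega>. ennreal (indicator B (D \<omega>) / q (X \<omega>)))"
    by (rule density_cong) (use I in auto)
  have "distr (distr m borel (\<lambda>\<omega>. (X \<omega>, ?Y \<omega>))) borel (\<lambda>z. (fst z, proj (snd z)))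
      = distr m borel (\<lambda>\<omega>. (X \<omega>, proj (?Y \<omega>)))" if [measurable_cong]: "sets m = sets P" for m
    by (subst distr_distr) (auto simp: comp_def)
  from this[of P] this[of "density P (\<lambda>\<omega>. ennreal (indicator B (D \<omega>) / q (X \<omega>)))"] eq
  show ?thesis unfolding dens by simp
qed

lemma treatment_indicator:
  assumes "\<omega> \<in> space P"
  shows "D \<omega> = indicator {1} (D \<omega>)" "1 - D \<omega> = indicator {0} (D \<omega>)"
  using treatment[OF assms] by auto

sublocale T: ipw_arm P X YT D p
proof unfold_locales
  show "distr (density P (\<lambda>\<omega>. ennreal (D \<omega> / p (X \<omega>)))) borel (\<lambda>\<omega>. (X \<omega>, YT \<omega>)) = distr P borel (\<lambda>\<omega>. (X \<omega>, YT \<omega>))"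
    using arm_reweighting[of "{1}" p fst D, OF _ _ _ _ treatment_indicator(1)] propensity overlap inv_weights_integrable(1)
    by (auto elim: eventually_mono)
qed (use treatment overlap inv_weights_integrable X_weighted_integrable YT_integrable in \<open>auto elim: eventually_mono\<close>)

text \<open>The control arm is a treatment arm for the complementary indicator and propensity, so
  the two arms share all moment computations.\<close>

sublocale C: ipw_arm P X YC "\<lambda>\<omega>. 1 - D \<omega>" "\<lambda>x. 1 - p x"
proof unfold_locales
  show "distr (density P (\<lambda>\<omega>. ennreal ((1 - D \<omega>) / (1 - p (X \<omega>))))) borel (\<lambda>\<omega>. (X \<omega>, YC \<omega>)) = distr P borel (\<lambda>\<omega>. (X \<omega>, YC \<omega>))"
    using arm_reweighting[of "{0}" "\<lambda>x. 1 - p x" snd "\<lambda>\<omega>. 1 - D \<omega>", OF _ _ _ _ treatment_indicator(2)] control_propensity overlap inv_weights_integrable(2)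
    by (auto elim: eventually_mono)
qed (use treatment overlap inv_weights_integrable X_weighted_integrable YC_integrable in \<open>auto elim: eventually_mono\<close>)


section \<open>The covariance of the influence function\<close>

definition \<zeta> :: "'a \<Rightarrow> (real^'k) \<times> real" where
  "\<zeta> \<omega> = T.w \<omega> *\<^sub>R (T.Z \<omega> - T.\<theta>) - C.w \<omega> *\<^sub>R (C.Z \<omega> - C.\<theta>)"

definition U :: "'a \<Rightarrow> real^'k" where "U \<omega> = X \<omega> - (LINT \<omega>|P. X \<omega>)"

definition A :: "real^'k^'k" where
  "A = (LINT \<omega>|P. (1 / (p (X \<omega>) * (1 - p (X \<omega>)))) *\<^sub>R outer (U \<omega>) (U \<omega>))"

definition VT :: "'a \<Rightarrow> real" where "VT \<omega> = YT \<omega> - (LINT \<omega>|P. YT \<omega>)"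
definition VC :: "'a \<Rightarrow> real" where "VC \<omega> = YC \<omega> - (LINT \<omega>|P. YC \<omega>)"

text \<open>Kept with squared weights, since this is the form in which sample averages approach it;
  \<open>uncorrelated_iff\<close> rewrites it with conditional means.\<close>

definition b :: "real^'k" where
  "b = (LINT \<omega>|P. ((T.w \<omega>)\<^sup>2 * VT \<omega>) *\<^sub>R U \<omega>) + (LINT \<omega>|P. ((C.w \<omega>)\<^sup>2 * VC \<omega>) *\<^sub>R U \<omega>)"

lemma centered_Z: "T.Z \<omega> - T.\<theta> = (U \<omega>, VT \<omega>)" "C.Z \<omega> - C.\<theta> = (U \<omega>, VC \<omega>)"
  by (simp_all add: T.Z_def T.\<theta>_def C.Z_def C.\<theta>_def U_def VT_def VC_def)

lemma measurable_\<zeta> [measurable]: "\<zeta> \<in> borel_measurable P"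
  and measurable_U [measurable]: "U \<in> borel_measurable P"
  unfolding \<zeta>_def U_def by measurable

lemma weights_disjoint: "\<omega> \<in> space P \<Longrightarrow> T.w \<omega> = 0 \<or> C.w \<omega> = 0"
  using treatment[of \<omega>] by (auto simp: T.w_def C.w_def)

lemma \<zeta>_product:
  assumes "\<omega> \<in> space P"
  shows "(u \<bullet> \<zeta> \<omega>) * (v \<bullet> \<zeta> \<omega>)
    = ((T.w \<omega>)\<^sup>2 * (u \<bullet> (T.Z \<omega> - T.\<theta>))) * (v \<bullet> (T.Z \<omega> - T.\<theta>))
      + ((C.w \<omega>)\<^sup>2 * (u \<bullet> (C.Z \<omega> - C.\<theta>))) * (v \<bullet> (C.Z \<omega> - C.\<theta>))"
  using weights_disjoint[OF assms]
  by (auto simp: \<zeta>_def inner_diff_right power2_eq_square algebra_simps)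

lemma \<zeta>_centered: "(LINT \<omega>|P. \<zeta> \<omega>) = 0"
  unfolding \<zeta>_def using T.integrable_w_Z C.integrable_w_Z T.integral_w_Z C.integral_w_Z by simp

lemma \<zeta>_square_integrable: "integrable P (\<lambda>\<omega>. (norm (\<zeta> \<omega>))\<^sup>2)"
proof -
  have eq: "(norm (\<zeta> \<omega>))\<^sup>2 = (T.w \<omega>)\<^sup>2 * (norm (T.Z \<omega> - T.\<theta>))\<^sup>2 + (C.w \<omega>)\<^sup>2 * (norm (C.Z \<omega> - C.\<theta>))\<^sup>2"
    if "\<omega> \<in> space P" for \<omega>
    using weights_disjoint[OF that] by (auto simp: \<zeta>_def power_mult_distrib)
  show ?thesis
    using T.integrable_w_Z_square C.integrable_w_Z_square
    by (subst Bochner_Integration.integrable_cong[OF refl eq]) auto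
qed

lemma \<zeta>_moments:
  "(LINT \<omega>|P. (u \<bullet> \<zeta> \<omega>) * (v \<bullet> \<zeta> \<omega>))
    = (LINT \<omega>|P. ((T.w \<omega>)\<^sup>2 * (u \<bullet> (U \<omega>, VT \<omega>))) * (v \<bullet> (U \<omega>, VT \<omega>)))
      + (LINT \<omega>|P. ((C.w \<omega>)\<^sup>2 * (u \<bullet> (U \<omega>, VC \<omega>))) * (v \<bullet> (U \<omega>, VC \<omega>)))"
proof -
  note int = T.integrable_w_Z_product[OF bounded_linear_inner_right bounded_linear_inner_right, of u v]
    C.integrable_w_Z_product[OF bounded_linear_inner_right bounded_linear_inner_right, of u v]
  show ?thesis
    using int unfolding real_scaleR_def centered_Z[symmetric]
    by (subst Bochner_Integration.integral_cong[OF refl \<zeta>_product]) auto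
qed

lemma weight_sum: "AE \<omega> in P. 1 / (p (X \<omega>) * (1 - p (X \<omega>))) = T.iq \<omega> + C.iq \<omega>"
  using overlap by eventually_elim (auto simp: T.iq_def C.iq_def field_simps)

lemma weighted_outer_integrable: "integrable P (\<lambda>\<omega>. (1 / (p (X \<omega>) * (1 - p (X \<omega>)))) *\<^sub>R outer (U \<omega>) (U \<omega>))"
  and weighted_U_integrable: "integrable P (\<lambda>\<omega>. (1 / (p (X \<omega>) * (1 - p (X \<omega>)))) *\<^sub>R U \<omega>)"
proof -
  have sq: "integrable P (\<lambda>\<omega>. (norm (U \<omega>))\<^sup>2 * (1 / (p (X \<omega>) * (1 - p (X \<omega>)))))"
    unfolding U_def
  proof (rule integrable_weighted_square_shift)
    show "AE \<omega> in P. 0 \<le> 1 / (p (X \<omega>) * (1 - p (X \<omega>)))"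
      using overlap by eventually_elim auto
  qed (use X_integrable weight_integrable in auto)
  show "integrable P (\<lambda>\<omega>. (1 / (p (X \<omega>) * (1 - p (X \<omega>)))) *\<^sub>R outer (U \<omega>) (U \<omega>))"
  proof (rule Bochner_Integration.integrable_bound[OF sq])
    have "norm (outer u u) = (norm u)\<^sup>2" for u :: "real^'k"
      using norm_outer[of u u] by (simp add: power2_eq_square)
    then show "AE \<omega> in P. norm ((1 / (p (X \<omega>) * (1 - p (X \<omega>)))) *\<^sub>R outer (U \<omega>) (U \<omega>))
        \<le> norm ((norm (U \<omega>))\<^sup>2 * (1 / (p (X \<omega>) * (1 - p (X \<omega>)))))"
      by (simp add: abs_mult)
  qed measurable
  have "integrable P (\<lambda>\<omega>. (1 / (p (X \<omega>) * (1 - p (X \<omega>))) * 1) *\<^sub>R U \<omega>)"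
  proof (rule integrable_weighted_product)
    show "AE \<omega> in P. 0 \<le> 1 / (p (X \<omega>) * (1 - p (X \<omega>)))"
      using overlap by eventually_elim auto
  qed (use sq weight_integrable in auto)
  then show "integrable P (\<lambda>\<omega>. (1 / (p (X \<omega>) * (1 - p (X \<omega>)))) *\<^sub>R U \<omega>)" by simp
qed

lemma inner_A: "a \<bullet> (A *v c) = (LINT \<omega>|P. 1 / (p (X \<omega>) * (1 - p (X \<omega>))) * ((a \<bullet> U \<omega>) * (U \<omega> \<bullet> c)))"
  and inner_A_integrable: "integrable P (\<lambda>\<omega>. 1 / (p (X \<omega>) * (1 - p (X \<omega>))) * ((a \<bullet> U \<omega>) * (U \<omega> \<bullet> c)))"
proof -
  have lin: "bounded_linear (\<lambda>A :: real^'k^'k. a \<bullet> (A *v c))"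
    by (rule linear_conv_bounded_linear[THEN iffD1])
      (auto intro!: linearI simp: matrix_vector_mult_add_rdistrib inner_add_right scaleR_matrix_vector_assoc[symmetric])
  have eq: "a \<bullet> ((r *\<^sub>R outer u v) *v c) = r * ((a \<bullet> u) * (v \<bullet> c))" for r u v
    by (simp add: scaleR_matrix_vector_assoc[symmetric] inner_outer)
  show "a \<bullet> (A *v c) = (LINT \<omega>|P. 1 / (p (X \<omega>) * (1 - p (X \<omega>))) * ((a \<bullet> U \<omega>) * (U \<omega> \<bullet> c)))"
    using integral_bounded_linear[OF lin weighted_outer_integrable] unfolding eq A_def by simp
  show "integrable P (\<lambda>\<omega>. 1 / (p (X \<omega>) * (1 - p (X \<omega>))) * ((a \<bullet> U \<omega>) * (U \<omega> \<bullet> c)))"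
    using integrable_bounded_linear[OF lin weighted_outer_integrable] unfolding eq .
qed

text \<open>The quadratic form is the integral of a positive weight times a square. If it vanishes,
  \<open>a \<bullet> X \<omega>\<close> is almost surely constant, which the absence of collinearity
  forbids for nonzero \<open>a\<close>.\<close>

lemma A_nonneg: "a \<bullet> (A *v a) \<ge> 0"
  and A_definite: "a \<bullet> (A *v a) = 0 \<Longrightarrow> a = 0"
proof -
  have nn: "AE \<omega> in P. 0 \<le> 1 / (p (X \<omega>) * (1 - p (X \<omega>))) * ((a \<bullet> U \<omega>) * (U \<omega> \<bullet> a))"
    using overlap by eventually_elim (simp add: inner_commute)
  then show "a \<bullet> (A *v a) \<ge> 0"
    unfolding inner_A by (rule integral_nonneg_AE)
  assume "a \<bullet> (A *v a) = 0"
  then have "AE \<omega> in P. 1 / (p (X \<omega>) * (1 - p (X \<omega>))) * ((a \<bullet> U \<omega>) * (U \<omega> \<bullet> a)) = 0"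
    unfolding inner_A using inner_A_integrable nn by (subst (asm) integral_nonneg_eq_0_iff_AE) auto
  with overlap have "AE \<omega> in P. a \<bullet> X \<omega> = a \<bullet> (LINT \<omega>|P. X \<omega>)"
    by eventually_elim (auto simp: U_def inner_diff_right inner_commute)
  then show "a = 0" by (rule nondegenerate)
qed

lemma det_A: "det A \<noteq> 0"
proof -
  have "a = 0" if "A *v a = 0" for a using A_definite[of a] that by simp
  then show ?thesis
    using matrix_left_invertible_ker[of A] invertible_left_inverse[of A] invertible_det_nz[of A] by auto
qed

text \<open>Both arms have the same centered covariates, so once squared weights are turned into
  inverse propensities the two contributions add up by \<open>weight_sum\<close>; this produces the
  weight in \<open>A\<close>.\<close>

lemma \<zeta>_moment_covariates: "(LINT \<omega>|P. ((a, 0) \<bullet> \<zeta> \<omega>) * ((c, 0) \<bullet> \<zeta> \<omega>)) = a \<bullet> (A *v c)"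
proof -
  have lin: "bounded_linear (\<lambda>z::(real^'k) \<times> real. a \<bullet> fst z)" for a
    by (intro bounded_linear_compose[OF bounded_linear_inner_right] bounded_linear_fst)
  note T = T.integral_w_Z_product[OF lin lin, unfolded centered_Z, of a c]
    T.integrable_Z_product[OF lin lin, of a T.\<theta> c, unfolded centered_Z]
  note C = C.integral_w_Z_product[OF lin lin, unfolded centered_Z, of a c]
    C.integrable_Z_product[OF lin lin, of a C.\<theta> c, unfolded centered_Z]
  have "(LINT \<omega>|P. ((a, 0) \<bullet> \<zeta> \<omega>) * ((c, 0) \<bullet> \<zeta> \<omega>))
      = (LINT \<omega>|P. T.iq \<omega> * (a \<bullet> U \<omega>) * (c \<bullet> U \<omega>) + C.iq \<omega> * (a \<bullet> U \<omega>) * (c \<bullet> U \<omega>))"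
    unfolding \<zeta>_moments using T C by (simp add: inner_Pair)
  also have "\<dots> = a \<bullet> (A *v c)"
    unfolding inner_A
  proof (rule integral_cong_AE)
    show "AE \<omega> in P. T.iq \<omega> * (a \<bullet> U \<omega>) * (c \<bullet> U \<omega>) + C.iq \<omega> * (a \<bullet> U \<omega>) * (c \<bullet> U \<omega>)
        = 1 / (p (X \<omega>) * (1 - p (X \<omega>))) * ((a \<bullet> U \<omega>) * (U \<omega> \<bullet> c))"
      using weight_sum by eventually_elim (simp only:, simp add: inner_commute algebra_simps)
  qed measurable
  finally show ?thesis .
qed

lemma b_summands_integrable:
  "integrable P (\<lambda>\<omega>. ((T.w \<omega>)\<^sup>2 * VT \<omega>) *\<^sub>R U \<omega>)" "integrable P (\<lambda>\<omega>. ((C.w \<omega>)\<^sup>2 * VC \<omega>) *\<^sub>R U \<omega>)"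
  using T.integrable_w_Z_product[OF bounded_linear_snd bounded_linear_fst]
    C.integrable_w_Z_product[OF bounded_linear_snd bounded_linear_fst]
  by (simp_all add: centered_Z)

lemma \<zeta>_moment_mixed: "(LINT \<omega>|P. ((a, 0) \<bullet> \<zeta> \<omega>) * ((0, 1) \<bullet> \<zeta> \<omega>)) = a \<bullet> b"
proof -
  have "a \<bullet> b = (LINT \<omega>|P. a \<bullet> (((T.w \<omega>)\<^sup>2 * VT \<omega>) *\<^sub>R U \<omega>)) + (LINT \<omega>|P. a \<bullet> (((C.w \<omega>)\<^sup>2 * VC \<omega>) *\<^sub>R U \<omega>))"
    unfolding b_def inner_add_right using b_summands_integrable by (simp only: integral_inner_right)
  then show ?thesis unfolding \<zeta>_moments by (simp add: inner_Pair ac_simps)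
qed

end

section \<open>From squared weights to conditional means\<close>

lemma (in ipw_arm) weighted_conditional_outcome:
  defines "\<beta> \<equiv> (LINT \<omega>|P. Y \<omega>)" and "\<mu> \<equiv> (LINT \<omega>|P. X \<omega>)"
  shows "integrable P (\<lambda>\<omega>. iq \<omega> * (cond_expectation P X Y \<omega> - \<beta>))"
    and "integrable P (\<lambda>\<omega>. iq \<omega> * (cond_expectation P X Y \<omega> - \<beta>) * ((X \<omega> - \<mu>) \<bullet> e))"
    and "(LINT \<omega>|P. iq \<omega> * (cond_expectation P X Y \<omega> - \<beta>) * ((X \<omega> - \<mu>) \<bullet> e))
      = (LINT \<omega>|P. (w \<omega>)\<^sup>2 * (Y \<omega> - \<beta>) * ((X \<omega> - \<mu>) \<bullet> e))"
proof -
  have Z: "Z \<omega> - \<theta> = (X \<omega> - \<mu>, Y \<omega> - \<beta>)" for \<omega> by (simp add: Z_def \<theta>_def \<beta>_def \<mu>_def)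
  have lin: "bounded_linear (\<lambda>z::'x \<times> real. fst z \<bullet> e)"
    by (intro bounded_linear_compose[OF bounded_linear_inner_left] bounded_linear_fst)
  have 1: "integrable P (\<lambda>\<omega>. iq \<omega> * 1)" "integrable P (\<lambda>\<omega>. iq \<omega> * (1 * (Y \<omega> - \<beta>)))"
    using integrable_iq integrable_iq_Z[OF bounded_linear_snd, of \<theta>] by (simp_all add: Z)
  show "integrable P (\<lambda>\<omega>. iq \<omega> * (cond_expectation P X Y \<omega> - \<beta>))"
    using conditional_outcome(1)[OF _ 1] by simp
  have 2: "integrable P (\<lambda>\<omega>. iq \<omega> * ((X \<omega> - \<mu>) \<bullet> e))"
      "integrable P (\<lambda>\<omega>. iq \<omega> * (((X \<omega> - \<mu>) \<bullet> e) * (Y \<omega> - \<beta>)))"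
    using integrable_iq_Z[OF lin, of \<theta>] integrable_Z_product[OF lin bounded_linear_snd, of \<theta>]
    by (simp_all add: Z ac_simps)
  \<comment> \<open>First \<open>Y\<close> is replaced by its conditional mean under the weight
    \<open>iq\<close>; the last claim then exchanges \<open>iq\<close> for the squared weight by
    reweighting.\<close>
  note ce = conditional_outcome[of "\<lambda>x. (x - \<mu>) \<bullet> e", OF _ 2]
  show "integrable P (\<lambda>\<omega>. iq \<omega> * (cond_expectation P X Y \<omega> - \<beta>) * ((X \<omega> - \<mu>) \<bullet> e))"
    using ce(1) by (simp add: ac_simps)
  show "(LINT \<omega>|P. iq \<omega> * (cond_expectation P X Y \<omega> - \<beta>) * ((X \<omega> - \<mu>) \<bullet> e))
      = (LINT \<omega>|P. (w \<omega>)\<^sup>2 * (Y \<omega> - \<beta>) * ((X \<omega> - \<mu>) \<bullet> e))"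
    using ce(2) integral_w_Z_product[OF lin bounded_linear_snd] by (simp add: Z ac_simps)
qed

text \<open>The integrability clauses of \<open>uncorrelated\<close> follow from the moment
  assumptions, and the covariance itself equals \<open>b\<close>, which is checked coordinate by
  coordinate.\<close>

lemma (in ipw_population) uncorrelated_iff:
  "uncorrelated P X (\<lambda>\<omega>. 1 / p (X \<omega>) * (cond_expectation P X YT \<omega> - (LINT \<omega>|P. YT \<omega>))
      + 1 / (1 - p (X \<omega>)) * (cond_expectation P X YC \<omega> - (LINT \<omega>|P. YC \<omega>))) \<longleftrightarrow> b = 0"
proof -
  define V where "V \<omega> = 1 / p (X \<omega>) * (cond_expectation P X YT \<omega> - (LINT \<omega>|P. YT \<omega>))
      + 1 / (1 - p (X \<omega>)) * (cond_expectation P X YC \<omega> - (LINT \<omega>|P. YC \<omega>))" for \<omega>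
  note T = T.weighted_conditional_outcome[unfolded T.iq_def]
    and C = C.weighted_conditional_outcome[unfolded C.iq_def]
  have V_int: "integrable P V" unfolding V_def using T(1) C(1) by (rule Bochner_Integration.integrable_add)
  have VU_eq: "V \<omega> * (U \<omega> \<bullet> e)
      = 1 / p (X \<omega>) * (cond_expectation P X YT \<omega> - (LINT \<omega>|P. YT \<omega>)) * ((X \<omega> - (LINT \<omega>|P. X \<omega>)) \<bullet> e)
      + 1 / (1 - p (X \<omega>)) * (cond_expectation P X YC \<omega> - (LINT \<omega>|P. YC \<omega>)) * ((X \<omega> - (LINT \<omega>|P. X \<omega>)) \<bullet> e)" for \<omega> e
    by (simp add: V_def U_def distrib_right)
  have VU_int: "integrable P (\<lambda>\<omega>. V \<omega> * (U \<omega> \<bullet> e))" for e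
    unfolding VU_eq using T(2) C(2) by (rule Bochner_Integration.integrable_add)
  have VU: "(LINT \<omega>|P. V \<omega> * (U \<omega> \<bullet> e)) = b \<bullet> e" for e
  proof -
    have "(LINT \<omega>|P. V \<omega> * (U \<omega> \<bullet> e)) = (LINT \<omega>|P. (T.w \<omega>)\<^sup>2 * VT \<omega> * (U \<omega> \<bullet> e)) + (LINT \<omega>|P. (C.w \<omega>)\<^sup>2 * VC \<omega> * (U \<omega> \<bullet> e))"
      unfolding VU_eq VT_def VC_def unfolding U_def T(3)[symmetric] C(3)[symmetric]
      by (rule Bochner_Integration.integral_add[OF T(2) C(2)])
    also have "\<dots> = (LINT \<omega>|P. (((T.w \<omega>)\<^sup>2 * VT \<omega>) *\<^sub>R U \<omega>) \<bullet> e) + (LINT \<omega>|P. (((C.w \<omega>)\<^sup>2 * VC \<omega>) *\<^sub>R U \<omega>) \<bullet> e)"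
      by simp
    also have "\<dots> = b \<bullet> e"
      unfolding b_def inner_add_left using b_summands_integrable by (simp only: integral_inner_left)
    finally show ?thesis .
  qed
  have X_int: "integrable P X"
    using T.integrable_Z unfolding T.Z_def by (simp add: integrable_Pair_iff)
  then have U_int: "integrable P U" and U_mean: "(LINT \<omega>|P. U \<omega>) = 0"
    unfolding U_def by (simp_all add: prob_space)
  have "integrable P (\<lambda>\<omega>. \<Sum>e\<in>Basis. (V \<omega> * (U \<omega> \<bullet> e)) *\<^sub>R e)"
    using VU_int by (intro Bochner_Integration.integrable_sum integrable_scaleR_left) auto
  then have VU_vec: "integrable P (\<lambda>\<omega>. V \<omega> *\<^sub>R U \<omega>)"
    by (simp add: scaleR_sum_right[symmetric] euclidean_representation flip: scaleR_scaleR)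
  then have "integrable P (\<lambda>\<omega>. V \<omega> *\<^sub>R U \<omega> + V \<omega> *\<^sub>R (LINT \<omega>|P. X \<omega>))"
    using V_int by simp
  then have VX_int: "integrable P (\<lambda>\<omega>. V \<omega> *\<^sub>R X \<omega>)"
    by (simp add: U_def algebra_simps)
  \<comment> \<open>\<open>V\<close> need not have mean zero, because the weights precede the
    centered conditional means; its mean drops out since \<open>U\<close> is centered.\<close>
  have "covariance P X V = (LINT \<omega>|P. V \<omega> *\<^sub>R U \<omega> - (LINT \<omega>|P. V \<omega>) *\<^sub>R U \<omega>)"
    unfolding covariance_def U_def by (simp add: scaleR_left_diff_distrib)
  also have "\<dots> = (LINT \<omega>|P. V \<omega> *\<^sub>R U \<omega>)"
    using VU_vec U_int U_mean by simp
  also have "\<dots> = b"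
  proof (rule euclidean_eqI)
    fix e :: "real^'k"
    show "(LINT \<omega>|P. V \<omega> *\<^sub>R U \<omega>) \<bullet> e = b \<bullet> e"
      using VU[of e] integral_inner_left[OF VU_vec, of e] by simp
  qed
  finally have "covariance P X V = b" .
  then show ?thesis
    using X_int V_int VX_int unfolding uncorrelated_def V_def by simp
qed

section \<open>Continuity and measurability of solutions of linear systems\<close>

definition cramer_solution :: "real^'k^'k \<Rightarrow> real^'k \<Rightarrow> real^'k" where
  "cramer_solution A b = (\<chi> k. det (\<chi> i j. if j = k then b $ i else A $ i $ j) / det A)"

lemma matrix_inv_mult_eq:
  fixes A :: "real^'k^'k"
  assumes "det A \<noteq> 0"
  shows "A *v (matrix_inv A *v b) = b"
proof -
  have "invertible A" using assms by (simp add: invertible_det_nz)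
  then have "A ** matrix_inv A = mat 1"
    unfolding invertible_def matrix_inv_def by (rule someI2_ex) blast
  then show ?thesis by (simp add: matrix_vector_mul_assoc)
qed

text \<open>\<open>matrix_inv\<close> is defined by choice; Cramer's rule exhibits the solution as a
  rational function of the entries, from which continuity and measurability can be read off.\<close>

lemma matrix_inv_mult_cramer: "det A \<noteq> 0 \<Longrightarrow> matrix_inv A *v b = cramer_solution A b"
  using cramer[of A "matrix_inv A *v b" b] matrix_inv_mult_eq[of A b] by (simp add: cramer_solution_def)

lemma tendsto_det [tendsto_intros]:
  fixes A :: "'a \<Rightarrow> real^'k^'k"
  assumes "(A \<longlongrightarrow> B) F"
  shows "((\<lambda>x. det (A x)) \<longlongrightarrow> det B) F"
  unfolding det_def by (intro tendsto_intros assms)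

lemma isCont_cramer_solution:
  fixes A :: "real^'k^'k"
  assumes "det A \<noteq> 0"
  shows "isCont (\<lambda>z. cramer_solution (fst z) (snd z)) (A, b)"
proof -
  have "((\<lambda>z::(real^'k^'k) \<times> (real^'k). fst z) \<longlongrightarrow> A) (at (A, b))"
    "((\<lambda>z::(real^'k^'k) \<times> (real^'k). snd z) \<longlongrightarrow> b) (at (A, b))"
    by (rule tendsto_eq_intros | simp)+
  then have "((\<lambda>z::(real^'k^'k) \<times> (real^'k). cramer_solution (fst z) (snd z)) \<longlongrightarrow> cramer_solution A b) (at (A, b))"
    unfolding cramer_solution_def using assms
    by (auto intro!: tendsto_intros)
  then show ?thesis unfolding isCont_def by simp
qed

lemma borel_measurable_vec_nth [measurable (raw)]:
  fixes f :: "'a \<Rightarrow> 'b::real_normed_vector ^ 'k"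
  assumes "f \<in> borel_measurable M"
  shows "(\<lambda>x. f x $ i) \<in> borel_measurable M"
  using measurable_compose[OF assms borel_measurable_continuous_onI[of "\<lambda>v. v $ i"]]
  by (simp add: continuous_intros)

lemma borel_measurable_vec_lambda [measurable (raw)]:
  fixes f :: "'k::finite \<Rightarrow> 'a \<Rightarrow> 'b::euclidean_space"
  assumes f: "\<And>k. f k \<in> borel_measurable M"
  shows "(\<lambda>x. \<chi> k. f k x) \<in> borel_measurable M"
proof (subst borel_measurable_euclidean_space, intro ballI)
  fix i :: "'b^'k" assume "i \<in> Basis"
  then obtain k u where "i = axis k u" by (auto simp: Basis_vec_def)
  then show "(\<lambda>x. (\<chi> k. f k x) \<bullet> i) \<in> borel_measurable M"
    using f[of k] by (simp add: inner_axis)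
qed

lemma borel_measurable_det [measurable (raw)]:
  fixes f :: "'a \<Rightarrow> real^'k^'k"
  assumes [measurable]: "f \<in> borel_measurable M"
  shows "(\<lambda>x. det (f x)) \<in> borel_measurable M"
  unfolding det_def by measurable

lemma borel_measurable_matrix_inv_mult:
  fixes f :: "'a \<Rightarrow> real^'k^'k"
  assumes [measurable]: "f \<in> borel_measurable M" "g \<in> borel_measurable M"
  shows "(\<lambda>x. matrix_inv (f x) *v g x) \<in> borel_measurable M"
proof -
  \<comment> \<open>For a singular matrix the defining predicate of the inverse is unsatisfiable,
    hence the chosen value is the same for all singular matrices and measurability survives
    there.\<close>
  have "matrix_inv A *v b = (if det A \<noteq> 0 then cramer_solution A b else (SOME _ :: real^'k^'k. False) *v b)"
    for A :: "real^'k^'k" and b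
  proof (cases "det A = 0")
    case True
    then have "\<not> (A ** A' = mat 1 \<and> A' ** A = mat 1)" for A'
      using invertible_det_nz[of A] unfolding invertible_def by blast
    then have "matrix_inv A = (SOME _. False)"
      unfolding matrix_inv_def by (intro arg_cong[where f=Eps]) blast
    then show ?thesis using True by simp
  qed (simp add: matrix_inv_mult_cramer)
  moreover have "(\<lambda>x. if det (f x) \<noteq> 0 then cramer_solution (f x) (g x) else C *v g x) \<in> borel_measurable M" for C
    unfolding cramer_solution_def matrix_vector_mult_def
    by measurable
  ultimately show ?thesis by simp
qed

section \<open>Asymptotics of the estimators\<close>

text \<open>Polarization: a centered Gaussian law is specified by the variances of its projections,
  and these determine mixed moments.\<close>

lemma centered_gaussian_covariance:
  fixes \<zeta> :: "'a \<Rightarrow> 'b::euclidean_space"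
  assumes \<mu>: "centered_gaussian (\<lambda>v. LINT z|Q. (v \<bullet> \<zeta> z)\<^sup>2) \<mu>"
    and [measurable]: "\<zeta> \<in> borel_measurable Q" and sq: "\<And>v. integrable Q (\<lambda>z. (v \<bullet> \<zeta> z)\<^sup>2)"
  shows "(LINT x|\<mu>. (u \<bullet> x) * (v \<bullet> x)) = (LINT z|Q. (u \<bullet> \<zeta> z) * (v \<bullet> \<zeta> z))"
proof -
  have pol: "(u \<bullet> x) * (v \<bullet> x) = (((u + v) \<bullet> x)\<^sup>2 - ((u - v) \<bullet> x)\<^sup>2) / 4" for x :: 'b
    by (simp add: inner_add_left inner_diff_left power2_eq_square algebra_simps)
  note m = centered_gaussian_moments[OF \<mu>]
  show ?thesis
    unfolding pol using m(3,4)[of "u + v"] m(3,4)[of "u - v"] sq[of "u + v"] sq[of "u - v"] by simp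
qed

lemma centered_gaussian_square_integrable:
  assumes \<mu>: "centered_gaussian V \<mu>"
  shows "integrable \<mu> (\<lambda>x. (norm x)\<^sup>2)"
proof -
  have "(\<lambda>x::'a. (norm x)\<^sup>2) = (\<lambda>x. \<Sum>b\<in>Basis. (b \<bullet> x)\<^sup>2)"
    unfolding power2_norm_eq_inner by (subst euclidean_inner) (simp add: power2_eq_square inner_commute)
  then show ?thesis using centered_gaussian_moments(3)[OF \<mu>] by simp
qed

lemma centered_gaussian_variance:
  fixes \<mu> :: "real measure"
  assumes "centered_gaussian V \<mu>"
  shows "(LINT x|\<mu>. (x - (LINT y|\<mu>. y))\<^sup>2) = V 1"
  using centered_gaussian_moments[OF assms, of 1] by simp

text \<open>\<open>covariance\<close> is a vector-valued integral, so taking the inner product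
  inside requires integrability of the product; square integrability of the Gaussian law provides
  it, and the means vanish.\<close>

lemma inner_covariance_centered_gaussian:
  fixes \<zeta> :: "'a \<Rightarrow> 'b::euclidean_space \<times> real"
  assumes \<mu>: "centered_gaussian (\<lambda>v. LINT z|Q. (v \<bullet> \<zeta> z)\<^sup>2) \<mu>"
    and [measurable]: "\<zeta> \<in> borel_measurable Q" and sq: "\<And>v. integrable Q (\<lambda>z. (v \<bullet> \<zeta> z)\<^sup>2)"
  shows "a \<bullet> covariance \<mu> fst snd = (LINT z|Q. ((a, 0) \<bullet> \<zeta> z) * ((0, 1) \<bullet> \<zeta> z))"
proof -
  have [measurable_cong]: "sets \<mu> = sets borel" and "prob_space \<mu>"
    using \<mu> by (auto simp: centered_gaussian_def)
  interpret \<mu>: prob_space \<mu> by fact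
  note sq_\<mu> = centered_gaussian_square_integrable[OF \<mu>]
  have "integrable \<mu> (\<lambda>x. norm x)"
    by (rule \<mu>.square_integrable_imp_integrable[OF _ sq_\<mu>]) measurable
  then have int: "integrable \<mu> (\<lambda>x. x)"
    by (subst (asm) integrable_norm_iff) measurable
  have mean: "(LINT x|\<mu>. x) = 0"
  proof (rule euclidean_eqI)
    fix v :: "'b \<times> real"
    show "(LINT x|\<mu>. x) \<bullet> v = 0 \<bullet> v"
      using centered_gaussian_moments(2)[OF \<mu>, of v] integral_inner_left[OF int, of v]
      by (simp add: inner_commute)
  qed
  have fst_mean: "(LINT x|\<mu>. fst x) = 0" and snd_mean: "(LINT x|\<mu>. snd x) = 0"
    using integral_bounded_linear[OF bounded_linear_fst int] integral_bounded_linear[OF bounded_linear_snd int] mean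
    by simp_all
  have prod_int: "integrable \<mu> (\<lambda>x. snd x *\<^sub>R fst x)"
  proof (rule Bochner_Integration.integrable_bound[OF sq_\<mu>])
    have "norm (snd x *\<^sub>R fst x) \<le> norm x * norm x" for x :: "'b \<times> real"
      unfolding norm_scaleR using norm_fst_le[of "fst x" "snd x"] norm_snd_le[of "snd x" "fst x"]
      by (intro mult_mono) auto
    then show "AE x in \<mu>. norm (snd x *\<^sub>R fst x) \<le> norm ((norm x)\<^sup>2)"
      by (simp add: power2_eq_square)
  qed measurable
  have "a \<bullet> covariance \<mu> fst snd = a \<bullet> (LINT x|\<mu>. snd x *\<^sub>R fst x)"
    by (simp add: covariance_def fst_mean snd_mean)
  also have "\<dots> = (LINT x|\<mu>. a \<bullet> (snd x *\<^sub>R fst x))"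
    by (rule integral_inner_right[symmetric]) (rule prod_int)
  also have "\<dots> = (LINT x|\<mu>. ((a, 0) \<bullet> x) * ((0, 1) \<bullet> x))"
    by (simp add: inner_prod_def ac_simps)
  also have "\<dots> = (LINT z|Q. ((a, 0) \<bullet> \<zeta> z) * ((0, 1) \<bullet> \<zeta> z))"
    by (rule centered_gaussian_covariance[OF assms])
  finally show ?thesis .
qed

text \<open>The error of a ratio is a / s - \<theta> = (a - s \<theta>) / s. For weighted sums the
  numerator becomes a sum of centered terms, and the random denominator, divided by
  \<open>n\<close>, tends to 1.\<close>

lemma ratio_expansion:
  fixes a \<theta> :: "'c::real_vector"
  assumes "n > 0" "s \<noteq> 0"
  shows "sqrt (real n) *\<^sub>R (a /\<^sub>R s - \<theta>) = (1 / (s /\<^sub>R real n)) *\<^sub>R ((a - s *\<^sub>R \<theta>) /\<^sub>R sqrt (real n))"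
proof -
  have "1 / (s /\<^sub>R real n) * inverse (sqrt (real n)) = sqrt (real n) * inverse s"
  proof -
    have "real n = sqrt (real n) * sqrt (real n)" by simp
    then show ?thesis using assms
      by (simp add: divide_simps)
  qed
  then have "(1 / (s /\<^sub>R real n)) *\<^sub>R ((a - s *\<^sub>R \<theta>) /\<^sub>R sqrt (real n)) = (sqrt (real n) * inverse s) *\<^sub>R (a - s *\<^sub>R \<theta>)"
    by (simp only: scaleR_scaleR)
  also have "\<dots> = sqrt (real n) *\<^sub>R (a /\<^sub>R s - \<theta>)"
    using assms by (simp add: scaleR_diff_right)
  finally show ?thesis by simp
qed

section \<open>Expansion of the sample moments about population means\<close>

lemma sample_mean_diff: "sample_mean n (\<lambda>i. f i - g i) = sample_mean n f - sample_mean n g"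
  by (simp add: sample_mean_def sum_subtractf scaleR_diff_right)

lemma sample_mean_add: "sample_mean n (\<lambda>i. f i + g i) = sample_mean n f + sample_mean n g"
  by (simp add: sample_mean_def sum.distrib scaleR_add_right)

lemma sample_mean_const: "n > 0 \<Longrightarrow> sample_mean n (\<lambda>i. c) = c"
  by (simp add: sample_mean_def scaleR_sum_left[symmetric] sum_constant_scaleR)

lemma (in bounded_bilinear) sample_mean_left: "sample_mean n (\<lambda>i. prod (f i) c) = prod (sample_mean n f) c"
  by (simp add: sample_mean_def sum_left scaleR_left)

lemma (in bounded_bilinear) sample_mean_right: "sample_mean n (\<lambda>i. prod c (f i)) = prod c (sample_mean n f)"
  by (simp add: sample_mean_def sum_right scaleR_right)

text \<open>The summands of \<open>A_hat\<close> are not independent, as they share the sample mean.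
  Centering at a constant \<open>m\<close> instead leaves averages of functions of single
  observations, and each correction term has the factor \<open>sample_mean n u\<close>, which tends
  to 0 when \<open>m\<close> is the population mean.\<close>

lemma A_hat_expansion:
  fixes x :: "nat \<Rightarrow> real^'k" and p :: "real^'k \<Rightarrow> real" and m :: "real^'k"
  assumes "n > 0"
  defines "w \<equiv> \<lambda>i. 1 / (p (x i) * (1 - p (x i)))" and "u \<equiv> \<lambda>i. x i - m"
  shows "A_hat p n x = sample_mean n (\<lambda>i. w i *\<^sub>R outer (u i) (u i))
    - outer (sample_mean n (\<lambda>i. w i *\<^sub>R u i)) (sample_mean n u)
    - outer (sample_mean n u) (sample_mean n (\<lambda>i. w i *\<^sub>R u i))
    + sample_mean n w *\<^sub>R outer (sample_mean n u) (sample_mean n u)"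
proof -
  interpret bounded_bilinear outer by (rule bounded_bilinear_outer)
  have x: "x i - sample_mean n x = u i - sample_mean n u" for i
    using assms(1) by (simp add: u_def sample_mean_diff sample_mean_const)
  have "A_hat p n x = sample_mean n (\<lambda>i. w i *\<^sub>R outer (u i) (u i) - outer (w i *\<^sub>R u i) (sample_mean n u)
      - outer (sample_mean n u) (w i *\<^sub>R u i) + w i *\<^sub>R outer (sample_mean n u) (sample_mean n u))"
    unfolding A_hat_def x
    by (simp add: w_def diff_left diff_right scaleR_left scaleR_right scaleR_diff_right scaleR_add_right inverse_eq_divide algebra_simps)
  then show ?thesis
    by (simp add: sample_mean_diff sample_mean_add sample_mean_left sample_mean_right
        bounded_bilinear.sample_mean_left[OF bounded_bilinear_scaleR])
qed

text \<open>The same device for three estimated centers: \<open>eT\<close>, \<open>eC\<close> and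
  \<open>sample_mean n u\<close> are their errors, and every term but the first contains at least
  one of them.\<close>

lemma b_hat_expansion:
  fixes x :: "nat \<Rightarrow> real^'k" and p :: "real^'k \<Rightarrow> real" and m :: "real^'k"
    and d yT yC :: "nat \<Rightarrow> real" and cT cC :: real and n :: nat
  assumes "n > 0"
  defines "kT \<equiv> \<lambda>i. d i / (p (x i))\<^sup>2" and "kC \<equiv> \<lambda>i. (1 - d i) / (1 - p (x i))\<^sup>2"
    and "u \<equiv> \<lambda>i. x i - m" and "vT \<equiv> \<lambda>i. yT i - cT" and "vC \<equiv> \<lambda>i. yC i - cC"
    and "eT \<equiv> sample_mean n (\<lambda>i. d i * obs_outcome d yT yC i / p (x i)) - cT"
    and "eC \<equiv> sample_mean n (\<lambda>i. (1 - d i) * obs_outcome d yT yC i / (1 - p (x i))) - cC"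
  shows "b_hat p n x d yT yC = sample_mean n (\<lambda>i. (kT i * vT i + kC i * vC i) *\<^sub>R u i)
    - eT *\<^sub>R sample_mean n (\<lambda>i. kT i *\<^sub>R u i) - eC *\<^sub>R sample_mean n (\<lambda>i. kC i *\<^sub>R u i)
    - (sample_mean n (\<lambda>i. kT i * vT i + kC i * vC i) - eT * sample_mean n kT - eC * sample_mean n kC)
        *\<^sub>R sample_mean n u"
proof -
  note scaleR = bounded_bilinear.sample_mean_left[OF bounded_bilinear_scaleR]
    bounded_bilinear.sample_mean_right[OF bounded_bilinear_scaleR]
    bounded_bilinear.sample_mean_right[OF bounded_bilinear_mult]
  have x: "x i - sample_mean n x = u i - sample_mean n u" for i
    using assms(1) by (simp add: u_def sample_mean_diff sample_mean_const)
  have "b_hat p n x d yT yC = sample_mean n (\<lambda>i. (kT i * (vT i - eT) + kC i * (vC i - eC)) *\<^sub>R (u i - sample_mean n u))"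
    unfolding b_hat_def Let_def x by (simp add: kT_def kC_def vT_def vC_def eT_def eC_def)
  also have "\<dots> = sample_mean n (\<lambda>i. (kT i * vT i + kC i * vC i) *\<^sub>R u i - eT *\<^sub>R (kT i *\<^sub>R u i) - eC *\<^sub>R (kC i *\<^sub>R u i)
      - (kT i * vT i + kC i * vC i - eT * kT i - eC * kC i) *\<^sub>R sample_mean n u)"
    by (simp add: algebra_simps)
  finally show ?thesis by (simp add: sample_mean_diff scaleR del: scaleR_scaleR)
qed

lemma borel_measurable_ipw_contrast:
  fixes x :: "nat \<Rightarrow> 'a \<Rightarrow> 'x::second_countable_topology" and z :: "nat \<Rightarrow> 'a \<Rightarrow> 'c::euclidean_space"
  assumes [measurable]: "p \<in> borel_measurable borel" "\<And>i. x i \<in> borel_measurable M"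
    "\<And>i. d i \<in> borel_measurable M" "\<And>i. z i \<in> borel_measurable M"
  shows "(\<lambda>\<omega>. ipw_contrast p n (\<lambda>i. x i \<omega>) (\<lambda>i. d i \<omega>) (\<lambda>i. z i \<omega>)) \<in> borel_measurable M"
  unfolding ipw_contrast_def by measurable

lemma ipw_contrast_Pair:
  "ipw_contrast p n x d (\<lambda>i. (f i, g i)) = (ipw_contrast p n x d f, ipw_contrast p n x d g)"
  by (simp add: ipw_contrast_def prod_eq_iff fst_sum snd_sum)

section \<open>The estimators on an independent sample\<close>

locale ipw_sampling = pop: ipw_population P X D YT YC p +
  smp: iid_sample M "\<lambda>i \<omega>. (Xs i \<omega>, Ds i \<omega>, YTs i \<omega>, YCs i \<omega>)" "distr P borel (\<lambda>\<omega>. (X \<omega>, D \<omega>, YT \<omega>, YC \<omega>))"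
  for P :: "'a measure" and X :: "'a \<Rightarrow> real ^ 'k" and D YT YC :: "'a \<Rightarrow> real" and p :: "real ^ 'k \<Rightarrow> real"
    and M :: "'b measure" and Xs :: "nat \<Rightarrow> 'b \<Rightarrow> real ^ 'k" and Ds YTs YCs :: "nat \<Rightarrow> 'b \<Rightarrow> real"
begin

abbreviation "W \<equiv> \<lambda>i \<omega>. (Xs i \<omega>, Ds i \<omega>, YTs i \<omega>, YCs i \<omega>)"
abbreviation "Obs \<equiv> \<lambda>\<omega>. (X \<omega>, D \<omega>, YT \<omega>, YC \<omega>)"
abbreviation "Q \<equiv> distr P borel Obs"

lemma sample_measurable [measurable]:
  "Xs i \<in> borel_measurable M" "Ds i \<in> borel_measurable M" "YTs i \<in> borel_measurable M" "YCs i \<in> borel_measurable M"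
  using smp.W_measurable[of i, THEN borel_measurable_fst] smp.W_measurable[of i, THEN borel_measurable_snd, THEN borel_measurable_fst]
    smp.W_measurable[of i, THEN borel_measurable_snd, THEN borel_measurable_snd, THEN borel_measurable_fst]
    smp.W_measurable[of i, THEN borel_measurable_snd, THEN borel_measurable_snd, THEN borel_measurable_snd]
  by simp_all

lemma
  fixes g :: "(real^'k) \<times> real \<times> real \<times> real \<Rightarrow> 'c::{banach, second_countable_topology}"
  assumes g [measurable]: "g \<in> borel_measurable borel" and f: "\<And>\<omega>. \<omega> \<in> space P \<Longrightarrow> g (Obs \<omega>) = f \<omega>"
  shows law_integral: "(LINT z|Q. g z) = (LINT \<omega>|P. f \<omega>)"
    and law_integrable: "integrable Q g \<longleftrightarrow> integrable P f"
proof -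
  show "(LINT z|Q. g z) = (LINT \<omega>|P. f \<omega>)"
    by (subst integral_distr) (auto intro!: Bochner_Integration.integral_cong f)
  show "integrable Q g \<longleftrightarrow> integrable P f"
    by (subst integrable_distr_eq) (auto intro!: Bochner_Integration.integrable_cong f)
qed

lemma mean_tends:
  fixes g :: "(real^'k) \<times> real \<times> real \<times> real \<Rightarrow> 'c::euclidean_space"
  assumes g: "g \<in> borel_measurable borel" and f: "\<And>\<omega>. \<omega> \<in> space P \<Longrightarrow> g (Obs \<omega>) = f \<omega>"
    and int: "integrable P f"
  shows "tends_in_prob M (\<lambda>n \<omega>. sample_mean n (\<lambda>i. g (W i \<omega>))) (LINT \<omega>|P. f \<omega>)"
  using smp.weak_law[OF g] law_integral[OF g f] law_integrable[OF g f] int by simp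

definition gT :: "(real^'k) \<times> real \<times> real \<times> real \<Rightarrow> real" where
  "gT z = fst (snd z) / p (fst z)"

definition gC :: "(real^'k) \<times> real \<times> real \<times> real \<Rightarrow> real" where
  "gC z = (1 - fst (snd z)) / (1 - p (fst z))"

text \<open>The covariates are paired with the observed outcome, so that \<open>x_ipw\<close> and
  \<open>beta_ipw\<close> form a single contrast. Wherever the weight of an arm is nonzero,
  \<open>J\<close> contains the potential outcome of that arm.\<close>

definition J :: "(real^'k) \<times> real \<times> real \<times> real \<Rightarrow> (real^'k) \<times> real" where
  "J z = (fst z, fst (snd z) * fst (snd (snd z)) + (1 - fst (snd z)) * snd (snd (snd z)))"

definition \<zeta>T :: "(real^'k) \<times> real \<times> real \<times> real \<Rightarrow> (real^'k) \<times> real" where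
  "\<zeta>T z = gT z *\<^sub>R (J z - pop.T.\<theta>)"

definition \<zeta>C :: "(real^'k) \<times> real \<times> real \<times> real \<Rightarrow> (real^'k) \<times> real" where
  "\<zeta>C z = gC z *\<^sub>R (J z - pop.C.\<theta>)"

definition \<zeta>J :: "(real^'k) \<times> real \<times> real \<times> real \<Rightarrow> (real^'k) \<times> real" where
  "\<zeta>J z = \<zeta>T z - \<zeta>C z"

lemma g_measurable [measurable]: "gT \<in> borel_measurable borel" "gC \<in> borel_measurable borel"
  and J_measurable [measurable]: "J \<in> borel_measurable borel"
  unfolding gT_def gC_def J_def by measurable

lemma \<zeta>_measurable [measurable]: "\<zeta>T \<in> borel_measurable borel" "\<zeta>C \<in> borel_measurable borel" "\<zeta>J \<in> borel_measurable borel"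
  unfolding \<zeta>J_def \<zeta>T_def \<zeta>C_def by measurable

lemma g_Obs: "gT (Obs \<omega>) = pop.T.w \<omega>" "gC (Obs \<omega>) = pop.C.w \<omega>"
  by (simp_all add: gT_def gC_def pop.T.w_def pop.C.w_def)

lemma \<zeta>_Obs:
  assumes "\<omega> \<in> space P"
  shows "\<zeta>T (Obs \<omega>) = pop.T.w \<omega> *\<^sub>R (pop.T.Z \<omega> - pop.T.\<theta>)"
    and "\<zeta>C (Obs \<omega>) = pop.C.w \<omega> *\<^sub>R (pop.C.Z \<omega> - pop.C.\<theta>)"
    and "\<zeta>J (Obs \<omega>) = pop.\<zeta> \<omega>"
proof -
  show 1: "\<zeta>T (Obs \<omega>) = pop.T.w \<omega> *\<^sub>R (pop.T.Z \<omega> - pop.T.\<theta>)" "\<zeta>C (Obs \<omega>) = pop.C.w \<omega> *\<^sub>R (pop.C.Z \<omega> - pop.C.\<theta>)"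
    unfolding \<zeta>T_def \<zeta>C_def g_Obs using pop.treatment[OF assms]
    by (auto simp: pop.T.w_def pop.C.w_def J_def pop.T.Z_def pop.C.Z_def)
  show "\<zeta>J (Obs \<omega>) = pop.\<zeta> \<omega>"
    unfolding \<zeta>J_def 1 pop.\<zeta>_def ..
qed

text \<open>The arms are instantiated separately because the remainder of the joint expansion
  involves each scaled arm sum, which has to be bounded in probability; the difference
  \<open>\<zeta>J\<close> carries the limit law.\<close>

sublocale cltT: centered_iid_sample M W Q \<zeta>T
proof unfold_locales
  show "integrable Q (\<lambda>z. (norm (\<zeta>T z))\<^sup>2)"
    using pop.T.integrable_w_Z_square by (subst law_integrable) (auto simp: \<zeta>_Obs power_mult_distrib)
  show "(LINT z|Q. \<zeta>T z) = 0"
    using pop.T.integral_w_Z by (subst law_integral[OF \<zeta>_measurable(1), OF \<zeta>_Obs(1)]) auto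
qed measurable

sublocale cltC: centered_iid_sample M W Q \<zeta>C
proof unfold_locales
  show "integrable Q (\<lambda>z. (norm (\<zeta>C z))\<^sup>2)"
    using pop.C.integrable_w_Z_square by (subst law_integrable) (auto simp: \<zeta>_Obs power_mult_distrib)
  show "(LINT z|Q. \<zeta>C z) = 0"
    using pop.C.integral_w_Z by (subst law_integral[OF \<zeta>_measurable(2), OF \<zeta>_Obs(2)]) auto
qed measurable

sublocale cltJ: centered_iid_sample M W Q \<zeta>J
proof unfold_locales
  show "integrable Q (\<lambda>z. (norm (\<zeta>J z))\<^sup>2)"
    using pop.\<zeta>_square_integrable by (subst law_integrable) (auto simp: \<zeta>_Obs)
  show "(LINT z|Q. \<zeta>J z) = 0"
    using pop.\<zeta>_centered by (subst law_integral[OF \<zeta>_measurable(3), OF \<zeta>_Obs(3)]) auto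
qed measurable

lemma finite_M: "finite_measure M" by unfold_locales

definition Jhat :: "nat \<Rightarrow> 'b \<Rightarrow> (real^'k) \<times> real" where
  "Jhat n \<omega> = ipw_contrast p n (\<lambda>i. Xs i \<omega>) (\<lambda>i. Ds i \<omega>) (\<lambda>i. J (W i \<omega>))"

lemma Jhat_eq:
  "Jhat n \<omega> = (x_ipw p n (\<lambda>i. Xs i \<omega>) (\<lambda>i. Ds i \<omega>),
     beta_ipw p n (\<lambda>i. Xs i \<omega>) (\<lambda>i. Ds i \<omega>) (\<lambda>i. YTs i \<omega>) (\<lambda>i. YCs i \<omega>))"
  unfolding Jhat_def J_def x_ipw_def beta_ipw_def
  by (simp add: ipw_contrast_Pair obs_outcome_def[abs_def])

lemma Jhat_measurable [measurable]: "Jhat n \<in> borel_measurable M"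
  unfolding Jhat_def by (rule borel_measurable_ipw_contrast) measurable

abbreviation \<theta>J :: "(real^'k) \<times> real" where "\<theta>J \<equiv> (0, (LINT \<omega>|P. YT \<omega>) - (LINT \<omega>|P. YC \<omega>))"

text \<open>By \<open>ratio_expansion\<close> the remainder consists of the scaled sum of each arm,
  bounded in probability, times the deviation from 1 of the reciprocal mean weight, which tends to
  0.\<close>

lemma Jhat_linear:
  "tends_in_prob M (\<lambda>n \<omega>. sqrt (real n) *\<^sub>R (Jhat n \<omega> - \<theta>J) - cltJ.root_n_mean n \<omega>) 0"
proof -
  let ?sT = "\<lambda>n \<omega>. sample_mean n (\<lambda>i. gT (W i \<omega>))" and ?sC = "\<lambda>n \<omega>. sample_mean n (\<lambda>i. gC (W i \<omega>))"
  have sT: "tends_in_prob M ?sT 1" and sC: "tends_in_prob M ?sC 1"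
    using mean_tends[OF g_measurable(1) g_Obs(1) pop.T.integrable_w]
      mean_tends[OF g_measurable(2) g_Obs(2) pop.C.integrable_w] pop.T.integral_w pop.C.integral_w
    by simp_all
  have "isCont (\<lambda>s::real. 1 / s - 1) 1" by (intro continuous_intros) auto
  from tends_in_prob_compose[OF sT this] tends_in_prob_compose[OF sC this]
  have "tends_in_prob M (\<lambda>n \<omega>. 1 / ?sT n \<omega> - 1) 0" "tends_in_prob M (\<lambda>n \<omega>. 1 / ?sC n \<omega> - 1) 0"
    by simp_all
  note zero = bounded_bilinear.tends_in_prob_zero_prod_bounded[OF bounded_bilinear_scaleR _ _ finite_M]
  have R: "tends_in_prob M (\<lambda>n \<omega>. (1 / ?sT n \<omega> - 1) *\<^sub>R cltT.root_n_mean n \<omega> - (1 / ?sC n \<omega> - 1) *\<^sub>R cltC.root_n_mean n \<omega>) 0"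
    using tends_in_prob_diff[OF zero[OF \<open>tends_in_prob M (\<lambda>n \<omega>. 1 / ?sT n \<omega> - 1) 0\<close> cltT.bounded_in_prob_root_n_mean]
        zero[OF \<open>tends_in_prob M (\<lambda>n \<omega>. 1 / ?sC n \<omega> - 1) 0\<close> cltC.bounded_in_prob_root_n_mean] finite_M]
    by simp
  show ?thesis
  \<comment> \<open>The expansion needs nonzero sums of weights; the limit (1, 1) of the mean
    weights lies in the open quadrant where this holds.\<close>
  proof (rule tends_in_prob_cong_near[OF R tends_in_prob_Pair[OF sT sC finite_M] finite_M])
    show "open ({0<..} \<times> {0<..} :: (real \<times> real) set)" by (intro open_Times) auto
    fix n :: nat and \<omega> assume n: "n > 0" and pos: "(?sT n \<omega>, ?sC n \<omega>) \<in> {0<..} \<times> {0<..}"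
    define sT where "sT = (\<Sum>i<n. gT (W i \<omega>))"
    define sC where "sC = (\<Sum>i<n. gC (W i \<omega>))"
    define aT where "aT = (\<Sum>i<n. gT (W i \<omega>) *\<^sub>R J (W i \<omega>))"
    define aC where "aC = (\<Sum>i<n. gC (W i \<omega>) *\<^sub>R J (W i \<omega>))"
    have mean: "?sT n \<omega> = sT /\<^sub>R real n" "?sC n \<omega> = sC /\<^sub>R real n"
      by (simp_all add: sample_mean_def sT_def sC_def)
    have nz: "sT \<noteq> 0" "sC \<noteq> 0" using pos unfolding mean by auto
    have J: "Jhat n \<omega> = aT /\<^sub>R sT - aC /\<^sub>R sC"
      unfolding Jhat_def ipw_contrast_def sT_def sC_def aT_def aC_def gT_def gC_def by simp
    have \<theta>: "\<theta>J = pop.T.\<theta> - pop.C.\<theta>" by (simp add: pop.T.\<theta>_def pop.C.\<theta>_def)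
    have rT: "cltT.root_n_mean n \<omega> = (aT - sT *\<^sub>R pop.T.\<theta>) /\<^sub>R sqrt (real n)"
      unfolding cltT.root_n_mean_def \<zeta>T_def aT_def sT_def
      by (simp add: scaleR_diff_right sum_subtractf scaleR_sum_left)
    have rC: "cltC.root_n_mean n \<omega> = (aC - sC *\<^sub>R pop.C.\<theta>) /\<^sub>R sqrt (real n)"
      unfolding cltC.root_n_mean_def \<zeta>C_def aC_def sC_def
      by (simp add: scaleR_diff_right sum_subtractf scaleR_sum_left)
    have rJ: "cltJ.root_n_mean n \<omega> = cltT.root_n_mean n \<omega> - cltC.root_n_mean n \<omega>"
      unfolding cltJ.root_n_mean_def cltT.root_n_mean_def cltC.root_n_mean_def \<zeta>J_def
      by (simp add: scaleR_diff_right sum_subtractf)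
    have "sqrt (real n) *\<^sub>R (Jhat n \<omega> - \<theta>J)
        = sqrt (real n) *\<^sub>R (aT /\<^sub>R sT - pop.T.\<theta>) - sqrt (real n) *\<^sub>R (aC /\<^sub>R sC - pop.C.\<theta>)"
      unfolding J \<theta> by (simp add: scaleR_diff_right)
    also have "\<dots> = (1 / ?sT n \<omega>) *\<^sub>R cltT.root_n_mean n \<omega> - (1 / ?sC n \<omega>) *\<^sub>R cltC.root_n_mean n \<omega>"
      unfolding mean rT rC ratio_expansion[OF n nz(1)] ratio_expansion[OF n nz(2)] ..
    finally show "sqrt (real n) *\<^sub>R (Jhat n \<omega> - \<theta>J) - cltJ.root_n_mean n \<omega>
        = (1 / ?sT n \<omega> - 1) *\<^sub>R cltT.root_n_mean n \<omega> - (1 / ?sC n \<omega> - 1) *\<^sub>R cltC.root_n_mean n \<omega>"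
      unfolding rJ by (simp add: scaleR_left_diff_distrib)
  qed auto
qed

lemma mean_U_tends: "tends_in_prob M (\<lambda>n \<omega>. sample_mean n (\<lambda>i. Xs i \<omega> - (LINT \<omega>|P. X \<omega>))) 0"
proof -
  have X_int: "integrable P X"
    using pop.T.integrable_Z unfolding pop.T.Z_def by (simp add: integrable_Pair_iff)
  have "integrable P pop.U" "(LINT \<omega>|P. pop.U \<omega>) = 0"
    unfolding pop.U_def using X_int by (simp_all add: pop.prob_space)
  then show ?thesis
    using mean_tends[of "\<lambda>z. fst z - (LINT \<omega>|P. X \<omega>)" pop.U] by (simp add: pop.U_def)
qed

lemma A_hat_tends: "tends_in_prob M (\<lambda>n \<omega>. A_hat p n (\<lambda>i. Xs i \<omega>)) pop.A"
proof -
  define m where "m = (LINT \<omega>|P. X \<omega>)"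
  define w :: "real^'k \<Rightarrow> real" where "w x = 1 / (p x * (1 - p x))" for x
  have [measurable]: "w \<in> borel_measurable borel" unfolding w_def by measurable
  let ?w = "\<lambda>n \<omega>. sample_mean n (\<lambda>i. w (Xs i \<omega>))"
  let ?wu = "\<lambda>n \<omega>. sample_mean n (\<lambda>i. w (Xs i \<omega>) *\<^sub>R (Xs i \<omega> - m))"
  let ?wuu = "\<lambda>n \<omega>. sample_mean n (\<lambda>i. w (Xs i \<omega>) *\<^sub>R outer (Xs i \<omega> - m) (Xs i \<omega> - m))"
  let ?u = "\<lambda>n \<omega>. sample_mean n (\<lambda>i. Xs i \<omega> - m)"
  have w: "tends_in_prob M ?w (LINT \<omega>|P. w (X \<omega>))"
    using mean_tends[of "\<lambda>z. w (fst z)" "\<lambda>\<omega>. w (X \<omega>)"] pop.weight_integrable by (simp add: w_def)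
  have wu: "tends_in_prob M ?wu (LINT \<omega>|P. w (X \<omega>) *\<^sub>R pop.U \<omega>)"
    using mean_tends[of "\<lambda>z. w (fst z) *\<^sub>R (fst z - m)" "\<lambda>\<omega>. w (X \<omega>) *\<^sub>R pop.U \<omega>"] pop.weighted_U_integrable
    by (simp add: w_def pop.U_def m_def)
  have wuu: "tends_in_prob M ?wuu pop.A"
    using mean_tends[of "\<lambda>z. w (fst z) *\<^sub>R outer (fst z - m) (fst z - m)" "\<lambda>\<omega>. w (X \<omega>) *\<^sub>R outer (pop.U \<omega>) (pop.U \<omega>)"]
      pop.weighted_outer_integrable
    by (simp add: w_def pop.U_def m_def pop.A_def)
  have u: "tends_in_prob M ?u 0" using mean_U_tends by (simp add: m_def)
  interpret bounded_bilinear "outer :: real^'k \<Rightarrow> _" by (rule bounded_bilinear_outer)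
  note prod = tends_in_prob_prod[OF _ _ finite_M]
  \<comment> \<open>Every correction contains \<open>?u\<close>, which tends to 0, while its other
    factors converge; only \<open>?wuu\<close> contributes to the limit.\<close>
  have lim: "tends_in_prob M (\<lambda>n \<omega>. ?wuu n \<omega> - outer (?wu n \<omega>) (?u n \<omega>) - outer (?u n \<omega>) (?wu n \<omega>)
      + ?w n \<omega> *\<^sub>R outer (?u n \<omega>) (?u n \<omega>)) pop.A"
    using tends_in_prob_add[OF tends_in_prob_diff[OF tends_in_prob_diff[OF wuu prod[OF wu u] finite_M] prod[OF u wu] finite_M]
        bounded_bilinear.tends_in_prob_prod[OF bounded_bilinear_scaleR w prod[OF u u] finite_M] finite_M]
    by (simp add: zero_left zero_right)
  show ?thesis
    by (rule tends_in_prob_cong[OF lim finite_M]) (simp add: A_hat_expansion[where m=m] w_def)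
qed

lemma b_hat_tends: "tends_in_prob M (\<lambda>n \<omega>. b_hat p n (\<lambda>i. Xs i \<omega>) (\<lambda>i. Ds i \<omega>) (\<lambda>i. YTs i \<omega>) (\<lambda>i. YCs i \<omega>)) pop.b"
proof -
  define m where "m = (LINT \<omega>|P. X \<omega>)"
  define cT where "cT = (LINT \<omega>|P. YT \<omega>)"
  define cC where "cC = (LINT \<omega>|P. YC \<omega>)"
  define kT where "kT z = fst (snd z) / (p (fst z))\<^sup>2" for z :: "(real^'k) \<times> real \<times> real \<times> real"
  define kC where "kC z = (1 - fst (snd z)) / (1 - p (fst z))\<^sup>2" for z :: "(real^'k) \<times> real \<times> real \<times> real"
  define u where "u z = fst z - m" for z :: "(real^'k) \<times> real \<times> real \<times> real"
  define h where "h z = kT z * (fst (snd (snd z)) - cT) + kC z * (snd (snd (snd z)) - cC)" for z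
  have [measurable]: "kT \<in> borel_measurable borel" "kC \<in> borel_measurable borel" "u \<in> borel_measurable borel"
    "h \<in> borel_measurable borel"
    unfolding kT_def[abs_def] kC_def[abs_def] u_def[abs_def] h_def[abs_def] by measurable
  \<comment> \<open>The treatment indicator enters to the first power over a squared propensity;
    being 0 or 1, it gives the squared weight.\<close>
  have k_Obs: "kT (Obs \<omega>) = (pop.T.w \<omega>)\<^sup>2" "kC (Obs \<omega>) = (pop.C.w \<omega>)\<^sup>2" if "\<omega> \<in> space P" for \<omega>
    using pop.treatment[OF that] by (auto simp: kT_def kC_def pop.T.w_def pop.C.w_def power2_eq_square)
  have u_Obs: "u (Obs \<omega>) = pop.U \<omega>" for \<omega> by (simp add: u_def m_def pop.U_def)
  have h_Obs: "h (Obs \<omega>) = (pop.T.w \<omega>)\<^sup>2 * pop.VT \<omega> + (pop.C.w \<omega>)\<^sup>2 * pop.VC \<omega>" if "\<omega> \<in> space P" for \<omega>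
    unfolding h_def k_Obs[OF that] by (simp add: cT_def cC_def pop.VT_def pop.VC_def)
  have int: "integrable P (\<lambda>\<omega>. (pop.T.w \<omega>)\<^sup>2 * pop.VT \<omega>)" "integrable P (\<lambda>\<omega>. (pop.C.w \<omega>)\<^sup>2 * pop.VC \<omega>)"
    using pop.T.integrable_w_square_Z[OF bounded_linear_snd] pop.C.integrable_w_square_Z[OF bounded_linear_snd]
    by (simp_all add: pop.centered_Z)
  have intU: "integrable P (\<lambda>\<omega>. (pop.T.w \<omega>)\<^sup>2 *\<^sub>R pop.U \<omega>)" "integrable P (\<lambda>\<omega>. (pop.C.w \<omega>)\<^sup>2 *\<^sub>R pop.U \<omega>)"
    using pop.T.integrable_w_square_Z[OF bounded_linear_fst] pop.C.integrable_w_square_Z[OF bounded_linear_fst]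
    by (simp_all add: pop.centered_Z)
  let ?m = "\<lambda>g n \<omega>. sample_mean n (\<lambda>i. g (W i \<omega>))"
  have hu: "tends_in_prob M (?m (\<lambda>z. h z *\<^sub>R u z)) pop.b"
    using mean_tends[of "\<lambda>z. h z *\<^sub>R u z" "\<lambda>\<omega>. ((pop.T.w \<omega>)\<^sup>2 * pop.VT \<omega>) *\<^sub>R pop.U \<omega> + ((pop.C.w \<omega>)\<^sup>2 * pop.VC \<omega>) *\<^sub>R pop.U \<omega>"]
      pop.b_summands_integrable
    by (simp add: h_Obs u_Obs scaleR_left_distrib pop.b_def)
  have kTu: "tends_in_prob M (?m (\<lambda>z. kT z *\<^sub>R u z)) (LINT \<omega>|P. (pop.T.w \<omega>)\<^sup>2 *\<^sub>R pop.U \<omega>)"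
    and kCu: "tends_in_prob M (?m (\<lambda>z. kC z *\<^sub>R u z)) (LINT \<omega>|P. (pop.C.w \<omega>)\<^sup>2 *\<^sub>R pop.U \<omega>)"
    using mean_tends[of "\<lambda>z. kT z *\<^sub>R u z" "\<lambda>\<omega>. (pop.T.w \<omega>)\<^sup>2 *\<^sub>R pop.U \<omega>"]
      mean_tends[of "\<lambda>z. kC z *\<^sub>R u z" "\<lambda>\<omega>. (pop.C.w \<omega>)\<^sup>2 *\<^sub>R pop.U \<omega>"] intU
    by (simp_all add: k_Obs u_Obs)
  have h: "tends_in_prob M (?m h) (LINT \<omega>|P. (pop.T.w \<omega>)\<^sup>2 * pop.VT \<omega> + (pop.C.w \<omega>)\<^sup>2 * pop.VC \<omega>)"
    using mean_tends[of h "\<lambda>\<omega>. (pop.T.w \<omega>)\<^sup>2 * pop.VT \<omega> + (pop.C.w \<omega>)\<^sup>2 * pop.VC \<omega>"] int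
    by (simp add: h_Obs)
  have kT: "tends_in_prob M (?m kT) (LINT \<omega>|P. (pop.T.w \<omega>)\<^sup>2)"
    and kC: "tends_in_prob M (?m kC) (LINT \<omega>|P. (pop.C.w \<omega>)\<^sup>2)"
    using mean_tends[of kT "\<lambda>\<omega>. (pop.T.w \<omega>)\<^sup>2"] mean_tends[of kC "\<lambda>\<omega>. (pop.C.w \<omega>)\<^sup>2"]
    by (simp_all add: k_Obs pop.T.integrable_w_square pop.C.integrable_w_square)
  have u: "tends_in_prob M (?m u) 0" using mean_U_tends by (simp add: m_def u_def)
  define yT where "yT z = fst (snd z) * snd (J z) / p (fst z)" for z :: "(real^'k) \<times> real \<times> real \<times> real"
  define yC where "yC z = (1 - fst (snd z)) * snd (J z) / (1 - p (fst z))" for z :: "(real^'k) \<times> real \<times> real \<times> real"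
  have [measurable]: "yT \<in> borel_measurable borel" "yC \<in> borel_measurable borel"
    unfolding yT_def[abs_def] yC_def[abs_def] by measurable
  have y_Obs: "yT (Obs \<omega>) = pop.T.w \<omega> *\<^sub>R snd (pop.T.Z \<omega>)" "yC (Obs \<omega>) = pop.C.w \<omega> *\<^sub>R snd (pop.C.Z \<omega>)"
    if "\<omega> \<in> space P" for \<omega>
    using pop.treatment[OF that] by (auto simp: yT_def yC_def J_def pop.T.w_def pop.C.w_def pop.T.Z_def pop.C.Z_def)
  have snd_int: "integrable P (\<lambda>\<omega>. snd (pop.T.Z \<omega>))" "integrable P (\<lambda>\<omega>. snd (pop.C.Z \<omega>))"
    using integrable_bounded_linear[OF bounded_linear_snd] pop.T.integrable_Z pop.C.integrable_Z by blast+
  have "tends_in_prob M (?m yT) (LINT \<omega>|P. pop.T.w \<omega> *\<^sub>R snd (pop.T.Z \<omega>))"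
    by (rule mean_tends[of yT, OF _ y_Obs(1)]) (use pop.T.weighting_integrable[of snd] snd_int in auto)
  then have mT: "tends_in_prob M (?m yT) cT"
    using pop.T.weighting_integral[of snd] by (simp add: cT_def pop.T.Z_def)
  have "tends_in_prob M (?m yC) (LINT \<omega>|P. pop.C.w \<omega> *\<^sub>R snd (pop.C.Z \<omega>))"
    by (rule mean_tends[of yC, OF _ y_Obs(2)]) (use pop.C.weighting_integrable[of snd] snd_int in auto)
  then have mC: "tends_in_prob M (?m yC) cC"
    using pop.C.weighting_integral[of snd] by (simp add: cC_def pop.C.Z_def)
  have eT: "tends_in_prob M (\<lambda>n \<omega>. ?m yT n \<omega> - cT) 0" and eC: "tends_in_prob M (\<lambda>n \<omega>. ?m yC n \<omega> - cC) 0"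
    using tends_in_prob_diff[OF mT tends_in_prob_const[of M cT] finite_M] tends_in_prob_diff[OF mC tends_in_prob_const[of M cC] finite_M]
    by simp_all
  note sc = bounded_bilinear.tends_in_prob_prod[OF bounded_bilinear_scaleR _ _ finite_M]
    and mu = bounded_bilinear.tends_in_prob_prod[OF bounded_bilinear_mult _ _ finite_M]
    and di = tends_in_prob_diff[OF _ _ finite_M]
  \<comment> \<open>The estimated centers have errors tending to 0 and all other averages converge,
    so the limit is that of the first average.\<close>
  have lim: "tends_in_prob M (\<lambda>n \<omega>. ?m (\<lambda>z. h z *\<^sub>R u z) n \<omega>
      - (?m yT n \<omega> - cT) *\<^sub>R ?m (\<lambda>z. kT z *\<^sub>R u z) n \<omega>
      - (?m yC n \<omega> - cC) *\<^sub>R ?m (\<lambda>z. kC z *\<^sub>R u z) n \<omega>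
      - (?m h n \<omega> - (?m yT n \<omega> - cT) * ?m kT n \<omega> - (?m yC n \<omega> - cC) * ?m kC n \<omega>) *\<^sub>R ?m u n \<omega>) pop.b"
    using di[OF di[OF di[OF hu sc[OF eT kTu]] sc[OF eC kCu]] sc[OF di[OF di[OF h mu[OF eT kT]] mu[OF eC kC]] u]]
    by simp
  show ?thesis
  proof (rule tends_in_prob_cong[OF lim finite_M])
    fix n :: nat and \<omega> assume "n > 0"
    from b_hat_expansion[OF this, of p "\<lambda>i. Xs i \<omega>" "\<lambda>i. Ds i \<omega>" "\<lambda>i. YTs i \<omega>" "\<lambda>i. YCs i \<omega>" cT cC m]
    show "b_hat p n (\<lambda>i. Xs i \<omega>) (\<lambda>i. Ds i \<omega>) (\<lambda>i. YTs i \<omega>) (\<lambda>i. YCs i \<omega>) =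
        ?m (\<lambda>z. h z *\<^sub>R u z) n \<omega>
      - (?m yT n \<omega> - cT) *\<^sub>R ?m (\<lambda>z. kT z *\<^sub>R u z) n \<omega>
      - (?m yC n \<omega> - cC) *\<^sub>R ?m (\<lambda>z. kC z *\<^sub>R u z) n \<omega>
      - (?m h n \<omega> - (?m yT n \<omega> - cT) * ?m kT n \<omega> - (?m yC n \<omega> - cC) * ?m kC n \<omega>) *\<^sub>R ?m u n \<omega>"
      by (simp add: h_def u_def kT_def kC_def yT_def yC_def J_def obs_outcome_def)
  qed
qed

section \<open>The linearly modified estimator\<close>

definition \<alpha> :: "real^'k" where "\<alpha> = matrix_inv pop.A *v pop.b"

abbreviation ahat :: "nat \<Rightarrow> 'b \<Rightarrow> real^'k" where
  "ahat n \<omega> \<equiv> alpha_hat p n (\<lambda>i. Xs i \<omega>) (\<lambda>i. Ds i \<omega>) (\<lambda>i. YTs i \<omega>) (\<lambda>i. YCs i \<omega>)"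

lemma A_\<alpha>: "pop.A *v \<alpha> = pop.b"
  unfolding \<alpha>_def by (rule matrix_inv_mult_eq[OF pop.det_A])

text \<open>Nonsingularity is an open condition satisfied by the limit of \<open>A_hat\<close>. On
  that set \<open>alpha_hat\<close> is the continuous Cramer solution; the arbitrary inverse of a
  singular \<open>A_hat\<close> matters only with vanishing probability.\<close>

lemma ahat_tends: "tends_in_prob M ahat \<alpha>"
proof -
  have lim: "tends_in_prob M (\<lambda>n \<omega>. cramer_solution (A_hat p n (\<lambda>i. Xs i \<omega>))
      (b_hat p n (\<lambda>i. Xs i \<omega>) (\<lambda>i. Ds i \<omega>) (\<lambda>i. YTs i \<omega>) (\<lambda>i. YCs i \<omega>))) \<alpha>"
    using tends_in_prob_compose2[OF A_hat_tends b_hat_tends finite_M isCont_cramer_solution[OF pop.det_A]]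
    unfolding \<alpha>_def matrix_inv_mult_cramer[OF pop.det_A] .
  show ?thesis
  proof (rule tends_in_prob_cong_near[OF lim A_hat_tends finite_M])
    show "open {A :: real^'k^'k. det A \<noteq> 0}"
      by (intro open_Collect_neq) (auto simp: continuous_on_def intro!: tendsto_intros)
  qed (use pop.det_A in \<open>auto simp: alpha_hat_def matrix_inv_mult_cramer\<close>)
qed

lemma A_hat_measurable [measurable]: "(\<lambda>\<omega>. A_hat p n (\<lambda>i. Xs i \<omega>)) \<in> borel_measurable M"
  unfolding A_hat_def sample_mean_def by measurable

lemma b_hat_measurable [measurable]:
  "(\<lambda>\<omega>. b_hat p n (\<lambda>i. Xs i \<omega>) (\<lambda>i. Ds i \<omega>) (\<lambda>i. YTs i \<omega>) (\<lambda>i. YCs i \<omega>)) \<in> borel_measurable M"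
  unfolding b_hat_def sample_mean_def obs_outcome_def Let_def by measurable

lemma ahat_measurable [measurable]: "ahat n \<in> borel_measurable M"
  unfolding alpha_hat_def by (rule borel_measurable_matrix_inv_mult) measurable

lemma centered_iid_sample_functional: "centered_iid_sample M W Q (\<lambda>z. l \<bullet> \<zeta>J z)"
proof unfold_locales
  show "integrable Q (\<lambda>z. (norm (l \<bullet> \<zeta>J z))\<^sup>2)"
    using cltJ.\<zeta>_inner_square_integrable[of l] by simp
  show "(LINT z|Q. l \<bullet> \<zeta>J z) = 0" by (rule cltJ.\<zeta>_inner_centered)
qed measurable

text \<open>A real estimator whose error follows the projection of the joint scaled sum onto
  \<open>l\<close> has the projected influence function, so the general limit theorem is applied
  once more in dimension one.\<close>

lemma functional_limit:
  fixes T :: "nat \<Rightarrow> 'b \<Rightarrow> real"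
  assumes T: "\<And>n. T n \<in> borel_measurable M"
    and lin: "tends_in_prob M (\<lambda>n \<omega>. sqrt (real n) * (T n \<omega> - \<theta>) - l \<bullet> cltJ.root_n_mean n \<omega>) 0"
  shows "asymptotically_normal M T \<theta>"
    and "asyvar M T \<theta> = (LINT \<omega>|P. (l \<bullet> pop.\<zeta> \<omega>)\<^sup>2)"
proof -
  interpret l: centered_iid_sample M W Q "\<lambda>z. l \<bullet> \<zeta>J z"
    by (rule centered_iid_sample_functional)
  have root: "l.root_n_mean n \<omega> = l \<bullet> cltJ.root_n_mean n \<omega>" for n \<omega>
    unfolding l.root_n_mean_def cltJ.root_n_mean_def by (simp add: inner_sum_right)
  have lin': "tends_in_prob M (\<lambda>n \<omega>. sqrt (real n) *\<^sub>R (T n \<omega> - \<theta>) - l.root_n_mean n \<omega>) 0"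
    using lin unfolding root by simp
  show "asymptotically_normal M T \<theta>" by (rule l.asymptotically_linear(1)[OF T lin'])
  have "asyvar M T \<theta> = (LINT z|Q. (l \<bullet> \<zeta>J z)\<^sup>2)"
    unfolding asyvar_def Let_def
    using centered_gaussian_variance[OF l.asymptotically_linear(2)[OF T lin']] by simp
  also have "\<dots> = (LINT \<omega>|P. (l \<bullet> pop.\<zeta> \<omega>)\<^sup>2)"
    by (rule law_integral) (auto simp: \<zeta>_Obs)
  finally show "asyvar M T \<theta> = (LINT \<omega>|P. (l \<bullet> pop.\<zeta> \<omega>)\<^sup>2)" .
qed

lemma Jhat_functional_linear:
  "tends_in_prob M (\<lambda>n \<omega>. l \<bullet> (sqrt (real n) *\<^sub>R (Jhat n \<omega> - \<theta>J)) - l \<bullet> cltJ.root_n_mean n \<omega>) 0"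
proof -
  have "isCont (\<lambda>x. l \<bullet> x) 0" by (intro continuous_intros)
  from tends_in_prob_compose[OF Jhat_linear this] show ?thesis
    by (simp add: inner_diff_right)
qed

lemma beta_ipw_limit:
  defines "T \<equiv> \<lambda>n \<omega>. beta_ipw p n (\<lambda>i. Xs i \<omega>) (\<lambda>i. Ds i \<omega>) (\<lambda>i. YTs i \<omega>) (\<lambda>i. YCs i \<omega>)"
  shows "asymptotically_normal M T (snd \<theta>J)"
    and "asyvar M T (snd \<theta>J) = (LINT \<omega>|P. ((0, 1) \<bullet> pop.\<zeta> \<omega>)\<^sup>2)"
proof -
  have T: "T n = (\<lambda>\<omega>. snd (Jhat n \<omega>))" for n by (simp add: T_def Jhat_eq)
  have meas: "T n \<in> borel_measurable M" for n unfolding T by measurable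
  have lin: "tends_in_prob M (\<lambda>n \<omega>. sqrt (real n) * (T n \<omega> - snd \<theta>J) - (0, 1) \<bullet> cltJ.root_n_mean n \<omega>) 0"
    using Jhat_functional_linear[of "(0, 1)"] by (simp add: T inner_prod_def)
  show "asymptotically_normal M T (snd \<theta>J)" "asyvar M T (snd \<theta>J) = (LINT \<omega>|P. ((0, 1) \<bullet> pop.\<zeta> \<omega>)\<^sup>2)"
    using functional_limit[OF meas lin] by simp_all
qed

lemma beta_lm_limit:
  defines "T \<equiv> \<lambda>n \<omega>. beta_lm p n (\<lambda>i. Xs i \<omega>) (\<lambda>i. Ds i \<omega>) (\<lambda>i. YTs i \<omega>) (\<lambda>i. YCs i \<omega>)"
  shows "asymptotically_normal M T (snd \<theta>J)"
    and "asyvar M T (snd \<theta>J) = (LINT \<omega>|P. ((- \<alpha>, 1) \<bullet> pop.\<zeta> \<omega>)\<^sup>2)"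
proof -
  have T: "T n = (\<lambda>\<omega>. snd (Jhat n \<omega>) - ahat n \<omega> \<bullet> fst (Jhat n \<omega>))" for n
    by (simp add: T_def Jhat_eq beta_lm_def)
  have meas: "T n \<in> borel_measurable M" for n unfolding T by measurable
  have "bounded_in_prob M (\<lambda>n \<omega>. sqrt (real n) *\<^sub>R (Jhat n \<omega> - \<theta>J))"
    by (rule bounded_in_prob_near[OF cltJ.bounded_in_prob_root_n_mean Jhat_linear finite_M])
  from bounded_in_prob_bounded_linear[OF this bounded_linear_fst]
  have bd: "bounded_in_prob M (\<lambda>n \<omega>. sqrt (real n) *\<^sub>R fst (Jhat n \<omega>))" by simp
  \<comment> \<open>The error of the estimated coefficient multiplies sqrt n times
    \<open>x_ipw\<close>, which is bounded in probability as \<open>x_ipw\<close> estimates 0;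
    consistency of \<open>ahat\<close> is therefore enough, without any rate.\<close>
  have "tends_in_prob M (\<lambda>n \<omega>. ahat n \<omega> - \<alpha>) 0"
    using tends_in_prob_diff[OF ahat_tends tends_in_prob_const[of M \<alpha>] finite_M] by simp
  from bounded_bilinear.tends_in_prob_zero_prod_bounded[OF bounded_bilinear_inner this bd finite_M]
  have rest: "tends_in_prob M (\<lambda>n \<omega>. (ahat n \<omega> - \<alpha>) \<bullet> (sqrt (real n) *\<^sub>R fst (Jhat n \<omega>))) 0" .
  have eq: "sqrt (real n) * (T n \<omega> - snd \<theta>J) - (- \<alpha>, 1) \<bullet> cltJ.root_n_mean n \<omega>
      = (- \<alpha>, 1) \<bullet> (sqrt (real n) *\<^sub>R (Jhat n \<omega> - \<theta>J)) - (- \<alpha>, 1) \<bullet> cltJ.root_n_mean n \<omega>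
        - (ahat n \<omega> - \<alpha>) \<bullet> (sqrt (real n) *\<^sub>R fst (Jhat n \<omega>))" for n \<omega>
    unfolding T by (simp add: inner_prod_def inner_diff_left algebra_simps)
  have lin: "tends_in_prob M (\<lambda>n \<omega>. sqrt (real n) * (T n \<omega> - snd \<theta>J) - (- \<alpha>, 1) \<bullet> cltJ.root_n_mean n \<omega>) 0"
    unfolding eq using tends_in_prob_diff[OF Jhat_functional_linear[of "(- \<alpha>, 1)"] rest finite_M] by simp
  show "asymptotically_normal M T (snd \<theta>J)" "asyvar M T (snd \<theta>J) = (LINT \<omega>|P. ((- \<alpha>, 1) \<bullet> pop.\<zeta> \<omega>)\<^sup>2)"
    using functional_limit[OF meas lin] by simp_all
qed

lemma joint_limit:
  "asymptotically_normal M Jhat \<theta>J" "covariance (limiting_law M Jhat \<theta>J) fst snd = pop.b"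
proof -
  note lim = cltJ.asymptotically_linear[OF Jhat_measurable Jhat_linear]
  show "asymptotically_normal M Jhat \<theta>J" by (rule lim(1))
  have meas: "\<zeta>J \<in> borel_measurable Q" by measurable
  have "a \<bullet> covariance (limiting_law M Jhat \<theta>J) fst snd = a \<bullet> pop.b" for a
  proof -
    have "a \<bullet> covariance (limiting_law M Jhat \<theta>J) fst snd = (LINT z|Q. ((a, 0) \<bullet> \<zeta>J z) * ((0, 1) \<bullet> \<zeta>J z))"
      by (rule inner_covariance_centered_gaussian[OF lim(2) meas cltJ.\<zeta>_inner_square_integrable])
    also have "\<dots> = (LINT \<omega>|P. ((a, 0) \<bullet> pop.\<zeta> \<omega>) * ((0, 1) \<bullet> pop.\<zeta> \<omega>))"
      by (rule law_integral) (auto simp: \<zeta>_Obs)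
    finally show ?thesis by (simp only: pop.\<zeta>_moment_mixed)
  qed
  then show "covariance (limiting_law M Jhat \<theta>J) fst snd = pop.b"
    using vector_eq_ldot by blast
qed

text \<open>\<alpha> is the regression coefficient of the outcome coordinate of the influence
  function on its covariate coordinates. With \<open>A *v \<alpha> = b\<close> the cross term is
  twice the quadratic term, and the residual variance falls by the explained part.\<close>

lemma variance_reduction:
  "(LINT \<omega>|P. ((- \<alpha>, 1) \<bullet> pop.\<zeta> \<omega>)\<^sup>2) = (LINT \<omega>|P. ((0, 1) \<bullet> pop.\<zeta> \<omega>)\<^sup>2) - \<alpha> \<bullet> (pop.A *v \<alpha>)"
proof -
  have sq: "integrable P (\<lambda>\<omega>. (v \<bullet> pop.\<zeta> \<omega>)\<^sup>2)" for v
    using cltJ.\<zeta>_inner_square_integrable[of v] by (subst (asm) law_integrable) (auto simp: \<zeta>_Obs)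
  have int: "integrable P (\<lambda>\<omega>. (u \<bullet> pop.\<zeta> \<omega>) * (v \<bullet> pop.\<zeta> \<omega>))" for u v
    by (rule integrable_mult_of_squares[OF _ _ sq sq]) measurable
  have "((- \<alpha>, 1) \<bullet> z)\<^sup>2 = ((0, 1) \<bullet> z) * ((0, 1) \<bullet> z) - 2 * (((\<alpha>, 0) \<bullet> z) * ((0, 1) \<bullet> z)) + ((\<alpha>, 0) \<bullet> z) * ((\<alpha>, 0) \<bullet> z)"
    for z :: "(real^'k) \<times> real"
    by (simp add: inner_prod_def power2_eq_square algebra_simps)
  then have "(LINT \<omega>|P. ((- \<alpha>, 1) \<bullet> pop.\<zeta> \<omega>)\<^sup>2)
      = (LINT \<omega>|P. ((0, 1) \<bullet> pop.\<zeta> \<omega>) * ((0, 1) \<bullet> pop.\<zeta> \<omega>)) - 2 * (\<alpha> \<bullet> pop.b) + \<alpha> \<bullet> (pop.A *v \<alpha>)"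
    using int by (simp add: pop.\<zeta>_moment_mixed pop.\<zeta>_moment_covariates)
  then show ?thesis by (simp add: A_\<alpha> power2_eq_square)
qed

end

theorem theorem7:
  fixes P :: "'a measure" and M :: "'b measure"
    and X :: "'a \<Rightarrow> real ^ 'k" and D YT YC :: "'a \<Rightarrow> real"
    and p :: "real ^ 'k \<Rightarrow> real"
    and Xs :: "nat \<Rightarrow> 'b \<Rightarrow> real ^ 'k" and Ds YTs YCs :: "nat \<Rightarrow> 'b \<Rightarrow> real"
  defines "\<beta>\<^sub>T \<equiv> (LINT \<omega>|P. YT \<omega>)" and "\<beta>\<^sub>C \<equiv> (LINT \<omega>|P. YC \<omega>)"
    and "\<beta>\<^sub>T\<^sub>X \<equiv> cond_expectation P X YT" and "\<beta>\<^sub>C\<^sub>X \<equiv> cond_expectation P X YC"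
  defines "\<beta> \<equiv> \<beta>\<^sub>T - \<beta>\<^sub>C"
  defines "B\<^sub>i\<^sub>p\<^sub>w \<equiv> (\<lambda>n \<omega>. beta_ipw p n (\<lambda>i. Xs i \<omega>) (\<lambda>i. Ds i \<omega>) (\<lambda>i. YTs i \<omega>) (\<lambda>i. YCs i \<omega>))"
    and "B\<^sub>l\<^sub>m \<equiv> (\<lambda>n \<omega>. beta_lm p n (\<lambda>i. Xs i \<omega>) (\<lambda>i. Ds i \<omega>) (\<lambda>i. YTs i \<omega>) (\<lambda>i. YCs i \<omega>))"
    and "X\<^sub>i\<^sub>p\<^sub>w \<equiv> (\<lambda>n \<omega>. x_ipw p n (\<lambda>i. Xs i \<omega>) (\<lambda>i. Ds i \<omega>))"
  \<comment> \<open>the population\<close>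
  assumes "prob_space P"
    and "X \<in> borel_measurable P" and "D \<in> borel_measurable P"
    and "YT \<in> borel_measurable P" and "YC \<in> borel_measurable P"
    and treatment: "\<And>\<omega>. \<omega> \<in> space P \<Longrightarrow> D \<omega> \<in> {0, 1}"
    and propensity_measurable: "p \<in> borel_measurable borel"
    and propensity: "AE \<omega> in P. p (X \<omega>) = cond_probability P X (\<lambda>\<omega>. D \<omega> = 1) \<omega>"
    and overlap: "AE \<omega> in P. 0 < p (X \<omega>) \<and> p (X \<omega>) < 1"
    and unconfoundedness: "cond_indep P X (\<lambda>\<omega>. (YT \<omega>, YC \<omega>)) D"
  \<comment> \<open>regularity: the moments making the asymptotic (co)variances finite, and no collinearity\<close>
    and "integrable P (\<lambda>\<omega>. 1 / (p (X \<omega>) * (1 - p (X \<omega>))))"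
    and "integrable P (\<lambda>\<omega>. (norm (X \<omega>))\<^sup>2 / (p (X \<omega>) * (1 - p (X \<omega>))))"
    and "integrable P (\<lambda>\<omega>. (YT \<omega>)\<^sup>2 / p (X \<omega>))"
    and "integrable P (\<lambda>\<omega>. (YC \<omega>)\<^sup>2 / (1 - p (X \<omega>)))"
    and nondegenerate: "\<And>v c. (AE \<omega> in P. v \<bullet> X \<omega> = c) \<Longrightarrow> v = 0"
  \<comment> \<open>the sample\<close>
    and "prob_space M"
    and independent: "prob_space.indep_vars M (\<lambda>_. borel)
          (\<lambda>i \<omega>. (Xs i \<omega>, Ds i \<omega>, YTs i \<omega>, YCs i \<omega>)) UNIV"
    and identically_distributed: "\<And>i. distr M borel (\<lambda>\<omega>. (Xs i \<omega>, Ds i \<omega>, YTs i \<omega>, YCs i \<omega>))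
          = distr P borel (\<lambda>\<omega>. (X \<omega>, D \<omega>, YT \<omega>, YC \<omega>))"
  shows "asymptotically_normal M B\<^sub>i\<^sub>p\<^sub>w \<beta>
    \<and> asymptotically_normal M B\<^sub>l\<^sub>m \<beta>
    \<and> asymptotically_normal M (\<lambda>n \<omega>. (X\<^sub>i\<^sub>p\<^sub>w n \<omega>, B\<^sub>i\<^sub>p\<^sub>w n \<omega>)) (0, \<beta>)
    \<and> asyvar M B\<^sub>l\<^sub>m \<beta> \<le> asyvar M B\<^sub>i\<^sub>p\<^sub>w \<beta>
    \<and> (asycov M X\<^sub>i\<^sub>p\<^sub>w 0 B\<^sub>i\<^sub>p\<^sub>w \<beta> \<noteq> 0 \<longrightarrow> asyvar M B\<^sub>l\<^sub>m \<beta> < asyvar M B\<^sub>i\<^sub>p\<^sub>w \<beta>)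
    \<and> (asycov M X\<^sub>i\<^sub>p\<^sub>w 0 B\<^sub>i\<^sub>p\<^sub>w \<beta> = 0 \<longleftrightarrow>
         uncorrelated P X (\<lambda>\<omega>. 1 / p (X \<omega>) * (\<beta>\<^sub>T\<^sub>X \<omega> - \<beta>\<^sub>T) + 1 / (1 - p (X \<omega>)) * (\<beta>\<^sub>C\<^sub>X \<omega> - \<beta>\<^sub>C)))"
proof -
  interpret pop: ipw_population P X D YT YC p
    by (rule ipw_population.intro[OF \<open>prob_space P\<close>], unfold_locales) (rule assms; assumption)+
  interpret ipw_sampling P X D YT YC p M Xs Ds YTs YCs
  proof (rule ipw_sampling.intro[OF pop.ipw_population_axioms iid_sample.intro[OF \<open>prob_space M\<close>]], unfold_locales)
  qed (rule independent identically_distributed)+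
  have \<beta>: "\<beta> = snd \<theta>J" by (simp add: \<beta>_def \<beta>\<^sub>T_def \<beta>\<^sub>C_def)
  have joint: "(\<lambda>n \<omega>. (X\<^sub>i\<^sub>p\<^sub>w n \<omega>, B\<^sub>i\<^sub>p\<^sub>w n \<omega>)) = Jhat" "(0, \<beta>) = \<theta>J"
    by (simp_all add: fun_eq_iff Jhat_eq X\<^sub>i\<^sub>p\<^sub>w_def B\<^sub>i\<^sub>p\<^sub>w_def \<beta>)
  \<comment> \<open>The asymptotic covariance is the vector \<open>b\<close> itself, so the
    strictness claim and the equivalence both become statements about \<open>b\<close> being
    zero.\<close>
  have cov: "asycov M X\<^sub>i\<^sub>p\<^sub>w 0 B\<^sub>i\<^sub>p\<^sub>w \<beta> = pop.b"
    unfolding asycov_def joint by (rule joint_limit(2))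
  note ipw = beta_ipw_limit[folded B\<^sub>i\<^sub>p\<^sub>w_def \<beta>] and lm = beta_lm_limit[folded B\<^sub>l\<^sub>m_def \<beta>]
  have var: "asyvar M B\<^sub>l\<^sub>m \<beta> = asyvar M B\<^sub>i\<^sub>p\<^sub>w \<beta> - \<alpha> \<bullet> (pop.A *v \<alpha>)"
    unfolding ipw(2) lm(2) by (rule variance_reduction)
  have le: "asyvar M B\<^sub>l\<^sub>m \<beta> \<le> asyvar M B\<^sub>i\<^sub>p\<^sub>w \<beta>"
    unfolding var using pop.A_nonneg[of \<alpha>] by simp
  have less: "asyvar M B\<^sub>l\<^sub>m \<beta> < asyvar M B\<^sub>i\<^sub>p\<^sub>w \<beta>" if "pop.b \<noteq> 0"
  proof -
    have "\<alpha> \<noteq> 0" using that A_\<alpha> by auto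
    then have "\<alpha> \<bullet> (pop.A *v \<alpha>) > 0"
      using pop.A_nonneg[of \<alpha>] pop.A_definite[of \<alpha>] by force
    then show ?thesis unfolding var by simp
  qed
  have "asymptotically_normal M (\<lambda>n \<omega>. (X\<^sub>i\<^sub>p\<^sub>w n \<omega>, B\<^sub>i\<^sub>p\<^sub>w n \<omega>)) (0, \<beta>)"
    unfolding joint by (rule joint_limit(1))
  then show ?thesis
    unfolding cov using ipw(1) lm(1) le less pop.uncorrelated_iff
    by (simp add: \<beta>\<^sub>T_def \<beta>\<^sub>C_def \<beta>\<^sub>T\<^sub>X_def \<beta>\<^sub>C\<^sub>X_def)
qed

end
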